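(* Let $\gamma\in(0,\infty)$ and suppose $p=p_n$ satisfies $p_n/n\to\gamma$ as $n\to\infty$. Let $\widetilde f$ be a base prediction procedure, $\widetilde f(\cdot;\mathcal{D}_1,\mathcal{D}_2)$ the associated one-step ingredient predictor (see context), and $\ell:\mathbb{R}\times\mathbb{R}\to\mathbb{R}_{\ge0}$ a loss that is convex in its second argument. Suppose there is a function $R^{\mathrm{det}}(\cdot,\cdot;\widetilde f):(0,\infty]\times(0,\infty]\to[0,\infty]$ whose restriction to $[\gamma,\infty]\times[\gamma,\infty]$ is proper and lower semicontinuous, and, with $$\mathcal{M}_\gamma^{\mathrm{os}}=\arg\min_{(\zeta_1,\zeta_2):\,\zeta_1^{-1}+\zeta_2^{-1}\le\gamma^{-1}}R^{\mathrm{det}}(\zeta_1,\zeta_2;\widetilde f),$$ suppose that: (a) $R(\widetilde f(\cdot;\mathcal{D}_{k_{1,m}},\mathcal{D}_{k_{2,m}}))$ is uniformly bounded away from $0$; (b) for datasets $\mathcal{D}_{k_{1,m}},\mathcal{D}_{k_{2,m}}$ with $k_{1,m}$ and $k_{2,m}$ observations and $p_m$ features, $R(\widetilde f(\cdot;\mathcal{D}_{k_{1,m}},\mathcal{D}_{k_{2,m}}))\to R^{\mathrm{det}}(\phi_1,\phi_2;\widetilde f)$ in probability as $k_{1,m},k_{2,m},p_m\to\infty$ and $(p_m/k_{1,m},p_m/k_{2,m})\to(\phi_1,\phi_2)\in\mathcal{M}_\gamma^{\mathrm{os}}$; (c) $R^{\mathrm{det}}(\cdot,\cdot;\widetilde f)$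 is continuous on $\mathcal{M}_\gamma^{\mathrm{os}}$ (as a function on $[\gamma,\infty]\times[\gamma,\infty]$); (d) either (O1) $\widehat\sigma_\Xi=O_p(1)$ and $\min_{(\xi_1,\xi_2)\in\Xi_n}R^{\mathrm{det}}(p_n/n_{1,\xi_1},p_n/n_{2,\xi_2};\widetilde f)\sqrt{n_{\mathrm{te}}/\log n}\to\infty$, or (O2) $\widehat\kappa_\Xi=O_p(1)$. Let $\widehat f^{\mathrm{os}}$ be the one-step predictor based on $\widetilde f$ with parameter $M$ (see context). Then for any $M\ge1$, as $n\to\infty$, $$\left(R(\widehat f^{\mathrm{os}};\mathcal{D}_n)-\min_{1/\zeta_1+1/\zeta_2\le1/\gamma}R^{\mathrm{det}}(\zeta_1,\zeta_2;\widetilde f)\right)_+=o_p(1).$$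
   Context: $\mathcal{D}_n$ consists of $n$ i.i.d. observations $(X_i,Y_i)\in\mathbb{R}^{p_n}\times\mathbb{R}$ from a distribution $P$ (which may depend on $n$); datasets with $k$ observations and $p$ features likewise consist of i.i.d. pairs in $\mathbb{R}^p\times\mathbb{R}$, and $\mathcal{D}_{k_{1,m}},\mathcal{D}_{k_{2,m}}$ are independent with common data distribution ((b) covers disjoint subsets of $\mathcal{D}_n$). $(X_0,Y_0)\sim P$ is independent of everything else. The conditional risk of a predictor $f$ computed from the data is $R(f)=\int\ell(y,f(x))\,dP(x,y)$; $R(\widehat f^{\mathrm{os}};\mathcal{D}_n)$ is the conditional risk of $\widehat f^{\mathrm{os}}$. Proper means not identically $+\infty$; $1/\infty=0$; $(a)_+=\max\{a,0\}$. One-step ingredient predictor: for a base procedure $\widetilde f$ (mapping a dataset $\mathcal{D}$ to $\widetilde f(\cdot;\mathcal{D}):\mathbb{R}^p\to\mathbb{R}$) and disjoint datasets $\mathcal{D}_1,\mathcal{D}_2$, $$\widetilde f(x;\mathcal{D}_1,\mathcal{D}_2)=\widetilde f(x;\mathcal{D}_1)+x^\top\Big(\sum_{j\in\mathcal{D}_2}X_jX_j^\top\Big)^{\dagger}\Big(\sum_{j\in\mathcal{D}_2}X_jr_j\Big),\qquad r_j=Y_j-\widetilde f(X_j;\mathcal{D}_1),$$ where $\dagger$ is the Moore–Penrose inverse. One-step procedure: fix $\nu\in(0,1)$; let $n_{\mathrm{te}}<n$, $n_{\mathrm{tr}}=n-n_{\mathrm{te}}$, where $n_{\mathrm{te}}/n\to0$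 and $\log n/n_{\mathrm{te}}\to0$. Put $\Xi_n=\{(\xi_1,\xi_2):\xi_1\in\{2,\dots,\lceil n_{\mathrm{tr}}/\lfloor n^\nu\rfloor-2\rceil\},\ \xi_2\in\{1,\dots,\xi_1-1\}\}$, $n_{1,\xi_1}=n_{\mathrm{tr}}-\xi_1\lfloor n^\nu\rfloor$, $n_{2,\xi_2}=\xi_2\lfloor n^\nu\rfloor$. Split $\mathcal{D}_n$ at random into $\mathcal{D}_{\mathrm{tr}}$ (size $n_{\mathrm{tr}}$) and $\mathcal{D}_{\mathrm{te}}$ (size $n_{\mathrm{te}}$, index set $\mathcal{I}_{\mathrm{te}}$). For $\xi=(\xi_1,\xi_2)\in\Xi_n$ and $1\le j\le M$ draw random pairs of disjoint subsets $(\mathcal{D}_{\mathrm{tr}}^{\xi_1,j},\mathcal{D}_{\mathrm{tr}}^{\xi_2,j})$ of $\mathcal{D}_{\mathrm{tr}}$ of sizes $n_{1,\xi_1}$ and $n_{2,\xi_2}$, and set $\widehat f^{\xi}(x)=\frac1M\sum_{j=1}^M\widetilde f(x;\mathcal{D}_{\mathrm{tr}}^{\xi_1,j},\mathcal{D}_{\mathrm{tr}}^{\xi_2,j})$. Let $\widehat R(\widehat f^{\xi})$ be either the average of $\ell(Y_i,\widehat f^\xi(X_i))$, $i\in\mathcal{I}_{\mathrm{te}}$ (choice $\mathtt{AVG}$), or their median-of-means (choice $\mathtt{MOM}$) with $\eta=n^{-A}/|\Xi_n|$ for a fixed $A>0$, i.e. the median of the averages over $\lceil8\log(1/\eta)\rceil$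 batches of these values. Let $\widehat\xi\in\arg\min_{\xi\in\Xi_n}\widehat R(\widehat f^\xi)$ and $\widehat f^{\mathrm{os}}=\widehat f^{\widehat\xi}$. Definitions: $\widehat\sigma_\xi$ is the conditional norm (given the data) of $\ell(Y_0,\widehat f^\xi(X_0))$: the $\psi_1$ norm $\inf\{C>0:\mathbb{E}[\exp(|\ell(Y_0,\widehat f^\xi(X_0))|/C)\mid\mathcal{D}_n]\le2\}$ if $\mathtt{AVG}$ is used, and either this $\psi_1$ norm or the $L_2$ norm $(\mathbb{E}[\ell(Y_0,\widehat f^\xi(X_0))^2\mid\mathcal{D}_n])^{1/2}$ if $\mathtt{MOM}$ is used. $\widehat\sigma_\Xi=\max_{\xi\in\Xi_n}\widehat\sigma_\xi$ and $\widehat\kappa_\Xi=\max_{\xi\in\Xi_n}\widehat\sigma_\xi/R(\widehat f^\xi)$. *)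

theory Defs
  imports "HOL-Probability.Probability" "Jordan_Normal_Form.Matrix"
begin

text \<open>
  The number of features varies with the sample size, so \<open>\<real>\<^sup>p\<close> is rendered by the extensional
  functions on \<open>{..<p}\<close>. An observation is a pair \<open>(x, y)\<close>, and a dataset is a list of
  observations. A procedure receives the number of features and a dataset, and returns a predictor.
\<close>

type_synonym features = "nat \<Rightarrow> real"
type_synonym observation = "features \<times> real"
type_synonym procedure = "nat \<Rightarrow> observation list \<Rightarrow> features \<Rightarrow> real"

definition feature_space :: "nat \<Rightarrow> features measure" where
  "feature_space p = PiM {..<p} (\<lambda>_. borel)"

definition obs_space :: "nat \<Rightarrow> observation measure" where
  "obs_space p = feature_space p \<Otimes>\<^sub>M borel"

definition data_law :: "observation measure \<Rightarrow> nat \<Rightarrow> (nat \<Rightarrow> observation) measure" where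
  "data_law P k = PiM {..<k} (\<lambda>_. P)"

definition dataset :: "(nat \<Rightarrow> observation) \<Rightarrow> nat set \<Rightarrow> observation list" where
  "dataset z I = map z (sorted_list_of_set I)"

definition measurable_procedure :: "procedure \<Rightarrow> bool" where
  "measurable_procedure f \<longleftrightarrow>
     (\<forall>p k. (\<lambda>(z, x). f p (dataset z {..<k}) x)
        \<in> borel_measurable (PiM {..<k} (\<lambda>_. obs_space p) \<Otimes>\<^sub>M feature_space p))"

text \<open>In the next three definitions \<open>f\<close> is a fixed predictor. Evaluated at a predictor computed
  from the data they are the quantities conditional on the data.\<close>

definition risk ::
  "(real \<Rightarrow> real \<Rightarrow> real) \<Rightarrow> observation measure \<Rightarrow> (features \<Rightarrow> real) \<Rightarrow> ennreal" where
  "risk l P f = (\<integral>\<^sup>+(x, y). ennreal (l y (f x)) \<partial>P)"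

definition psi1_norm ::
  "(real \<Rightarrow> real \<Rightarrow> real) \<Rightarrow> observation measure \<Rightarrow> (features \<Rightarrow> real) \<Rightarrow> ennreal" where
  "psi1_norm l P f =
     Inf {ennreal C | C. C > 0 \<and> (\<integral>\<^sup>+(x, y). ennreal (exp (\<bar>l y (f x)\<bar> / C)) \<partial>P) \<le> 2}"

definition l2_norm ::
  "(real \<Rightarrow> real \<Rightarrow> real) \<Rightarrow> observation measure \<Rightarrow> (features \<Rightarrow> real) \<Rightarrow> ennreal" where
  "l2_norm l P f =
     (let I = \<integral>\<^sup>+(x, y). ennreal ((l y (f x))\<^sup>2) \<partial>P
      in if I = \<infinity> then \<infinity> else ennreal (sqrt (enn2real I)))"

datatype norm_choice = PSI1 | L2

fun loss_norm :: "norm_choice \<Rightarrow> (real \<Rightarrow> real \<Rightarrow> real) \<Rightarrow> observation measure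
    \<Rightarrow> (features \<Rightarrow> real) \<Rightarrow> ennreal" where
  "loss_norm PSI1 = psi1_norm"
| "loss_norm L2 = l2_norm"

definition is_pinv :: "real mat \<Rightarrow> real mat \<Rightarrow> bool" where
  "is_pinv A X \<longleftrightarrow> X \<in> carrier_mat (dim_col A) (dim_row A)
     \<and> A * X * A = A \<and> X * A * X = X
     \<and> transpose_mat (A * X) = A * X \<and> transpose_mat (X * A) = X * A"

text \<open>The Moore--Penrose inverse: the unique matrix satisfying the four Penrose equations.\<close>

definition pinv :: "real mat \<Rightarrow> real mat" where
  "pinv A = (THE X. is_pinv A X)"

definition one_step :: "procedure \<Rightarrow> nat \<Rightarrow> observation list \<Rightarrow> observation list \<Rightarrow> features \<Rightarrow> real"
  where
  "one_step f p D1 D2 x =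
     (let G = mat p p (\<lambda>(a, b). \<Sum>(X, Y)\<leftarrow>D2. X a * X b);
          h = Matrix.vec p (\<lambda>a. \<Sum>(X, Y)\<leftarrow>D2. X a * (Y - f p D1 X))
      in f p D1 x + scalar_prod (Matrix.vec p x) (pinv G *\<^sub>v h))"

text \<open>Below, \<open>n\<close> is the sample size, \<open>ntr\<close> the size of the training set and \<open>nu\<close> the exponent of
  the block length.\<close>

definition block :: "real \<Rightarrow> nat \<Rightarrow> nat" where
  "block nu n = nat \<lfloor>real n powr nu\<rfloor>"

definition Xi :: "real \<Rightarrow> nat \<Rightarrow> nat \<Rightarrow> (nat \<times> nat) set" where
  "Xi nu n ntr = {(\<xi>1, \<xi>2). \<xi>1 \<in> {2..nat \<lceil>real ntr / real (block nu n) - 2\<rceil>}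
                            \<and> \<xi>2 \<in> {1..\<xi>1 - 1}}"

definition size1 :: "real \<Rightarrow> nat \<Rightarrow> nat \<Rightarrow> nat \<times> nat \<Rightarrow> nat" where
  "size1 nu n ntr \<xi> = ntr - fst \<xi> * block nu n"

definition size2 :: "real \<Rightarrow> nat \<Rightarrow> nat \<times> nat \<Rightarrow> nat" where
  "size2 nu n \<xi> = snd \<xi> * block nu n"

definition subsets_of_size :: "nat set \<Rightarrow> nat \<Rightarrow> nat set set" where
  "subsets_of_size T k = {A. A \<subseteq> T \<and> card A = k}"

definition disjoint_pairs :: "nat set \<Rightarrow> nat \<Rightarrow> nat \<Rightarrow> (nat set \<times> nat set) set" where
  "disjoint_pairs T k1 k2 =
     {(A, B). A \<in> subsets_of_size T k1 \<and> B \<in> subsets_of_size T k2 \<and> A \<inter> B = {}}"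

text \<open>
  All sampling decisions are functions of a seed \<open>u\<close> with law \<open>Q\<close>; as they take finitely many
  values, a discrete law suffices. \<open>split u\<close> is the index set of the training data, and
  \<open>draw u \<xi> j\<close> is the \<open>j\<close>-th pair of disjoint subsets for \<open>\<xi>\<close>. The split is uniform, and given the
  split each single pair is uniform. Nothing is assumed on the joint law of the pairs, so that they
  may be drawn with or without replacement in \<open>j\<close>, and independently or not over \<open>\<xi>\<close>. The values are
  required to be admissible for every seed, null ones included, so that the quantities computed from
  data and seed are measurable.
\<close>

definition random_sampling ::
  "real \<Rightarrow> nat \<Rightarrow> nat \<Rightarrow> nat \<Rightarrow> 'u pmf \<Rightarrow> ('u \<Rightarrow> nat set)
     \<Rightarrow> ('u \<Rightarrow> nat \<times> nat \<Rightarrow> nat \<Rightarrow> nat set \<times> nat set) \<Rightarrow> bool" where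
  "random_sampling nu n ntr M Q split draw \<longleftrightarrow>
     (\<forall>u. split u \<in> subsets_of_size {..<n} ntr) \<and>
     map_pmf split Q = pmf_of_set (subsets_of_size {..<n} ntr) \<and>
     (\<forall>\<xi>\<in>Xi nu n ntr. \<forall>j\<in>{1..M}.
        (\<forall>u. draw u \<xi> j \<in> disjoint_pairs (split u) (size1 nu n ntr \<xi>) (size2 nu n \<xi>)) \<and>
        map_pmf (\<lambda>u. (split u, draw u \<xi> j)) Q =
          bind_pmf (pmf_of_set (subsets_of_size {..<n} ntr))
            (\<lambda>T. map_pmf (Pair T)
              (pmf_of_set (disjoint_pairs T (size1 nu n ntr \<xi>) (size2 nu n \<xi>)))))"

definition candidate ::
  "procedure \<Rightarrow> nat \<Rightarrow> nat \<Rightarrow> (nat \<Rightarrow> observation) \<Rightarrow> (nat \<Rightarrow> nat set \<times> nat set) \<Rightarrow> features \<Rightarrow> real"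
  where
  "candidate f p M z d x =
     (\<Sum>j = 1..M. one_step f p (dataset z (fst (d j))) (dataset z (snd (d j))) x) / real M"

definition average_loss ::
  "(real \<Rightarrow> real \<Rightarrow> real) \<Rightarrow> (nat \<Rightarrow> observation) \<Rightarrow> (features \<Rightarrow> real) \<Rightarrow> nat set \<Rightarrow> real" where
  "average_loss l z f I = (\<Sum>i\<in>I. l (snd (z i)) (f (fst (z i)))) / real (card I)"

definition median :: "real list \<Rightarrow> real" where
  "median xs = (sort xs ! ((length xs - 1) div 2) + sort xs ! (length xs div 2)) / 2"

definition num_batches :: "real \<Rightarrow> real \<Rightarrow> nat \<Rightarrow> nat \<Rightarrow> nat" where
  "num_batches A nu n ntr =
     (let \<eta> = real n powr (- A) / real (card (Xi nu n ntr)) in nat \<lceil>8 * ln (1 / \<eta>)\<rceil>)"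

text \<open>Batches of a median of means: a partition of the index set into \<open>B\<close> sets of as equal size as
  possible.\<close>

definition batch_partition :: "nat set \<Rightarrow> nat \<Rightarrow> (nat \<Rightarrow> nat set) \<Rightarrow> bool" where
  "batch_partition I B b \<longleftrightarrow>
     (\<Union>i<B. b i) = I \<and> disjoint_family_on b {..<B} \<and>
     (\<forall>i<B. \<forall>j<B. card (b i) \<le> card (b j) + 1)"

datatype centering = AVG | MOM

fun estimated_risk ::
  "centering \<Rightarrow> (real \<Rightarrow> real \<Rightarrow> real) \<Rightarrow> nat set \<Rightarrow> nat \<Rightarrow> (nat \<Rightarrow> nat set) \<Rightarrow> (nat \<Rightarrow> observation)
     \<Rightarrow> (features \<Rightarrow> real) \<Rightarrow> real" where
  "estimated_risk AVG l I B b z f = average_loss l z f I"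
| "estimated_risk MOM l I B b z f = median (map (\<lambda>i. average_loss l z f (b i)) [0..<B])"

text \<open>The convention \<open>\<infinity> / \<infinity> = 0\<close> of \<^typ>\<open>ennreal\<close> is overridden: an infinite norm gives an
  infinite ratio, so that bounded ratios force finite risks.\<close>

definition norm_risk_ratio :: "ennreal \<Rightarrow> ennreal \<Rightarrow> ennreal" where
  "norm_risk_ratio s r = (if s = \<infinity> then \<infinity> else s / r)"

text \<open>For a finite limit in \<^typ>\<open>ennreal\<close>, \<open>tends_in_prob\<close> is the usual convergence in probability;
  the formulation with neighbourhoods also covers the limit \<open>\<infinity>\<close>. Subtraction on \<^typ>\<open>ennreal\<close> is
  truncated, i.e. \<open>a - b\<close> is the positive part of the difference.\<close>

definition tends_in_prob ::
  "(nat \<Rightarrow> 'a measure) \<Rightarrow> (nat \<Rightarrow> 'a \<Rightarrow> ennreal) \<Rightarrow> ennreal \<Rightarrow> bool" where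
  "tends_in_prob N X c \<longleftrightarrow>
     (\<forall>U. open U \<longrightarrow> c \<in> U \<longrightarrow>
        (\<lambda>n. measure (N n) {w \<in> space (N n). X n w \<notin> U}) \<longlonglongrightarrow> 0)"

abbreviation small_op_one :: "(nat \<Rightarrow> 'a measure) \<Rightarrow> (nat \<Rightarrow> 'a \<Rightarrow> ennreal) \<Rightarrow> bool" where
  "small_op_one N X \<equiv> tends_in_prob N X 0"

definition big_op_one :: "(nat \<Rightarrow> 'a measure) \<Rightarrow> (nat \<Rightarrow> 'a \<Rightarrow> ennreal) \<Rightarrow> bool" where
  "big_op_one N X \<longleftrightarrow>
     (\<forall>\<epsilon>>0. \<exists>K::real. \<forall>\<^sub>F n in sequentially.
        measure (N n) {w \<in> space (N n). X n w > ennreal K} < \<epsilon>)"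

definition lower_semicontinuous_on ::
  "'a::topological_space set \<Rightarrow> ('a \<Rightarrow> 'b::complete_linorder) \<Rightarrow> bool" where
  "lower_semicontinuous_on S f \<longleftrightarrow> (\<forall>x\<in>S. f x \<le> Liminf (at x within S) f)"

text \<open>As \<open>inverse \<infinity> = 0\<close> and \<open>inverse 0 = \<infinity>\<close> on \<^typ>\<open>ennreal\<close>, the constraint forces both
  components into \<open>[\<gamma>, \<infinity>]\<close>; values of \<open>Rdet\<close> at \<open>0\<close> are irrelevant.\<close>

definition aspect_pairs :: "real \<Rightarrow> (ennreal \<times> ennreal) set" where
  "aspect_pairs \<gamma> = {(\<zeta>1, \<zeta>2). inverse \<zeta>1 + inverse \<zeta>2 \<le> inverse (ennreal \<gamma>)}"

definition argmin_set :: "real \<Rightarrow> (ennreal \<times> ennreal \<Rightarrow> ennreal) \<Rightarrow> (ennreal \<times> ennreal) set" where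
  "argmin_set \<gamma> Rdet = {\<zeta>. is_arg_min Rdet (\<lambda>\<zeta>. \<zeta> \<in> aspect_pairs \<gamma>) \<zeta>}"

end

theory Submission
  imports Defs "Jordan_Normal_Form.Determinant" "HOL-Real_Asymp.Real_Asymp"
begin

text \<open>
The selected predictor cannot be much worse than the best point of the limiting risk profile, for
three reasons. Write \<open>R \<xi>\<close> for the conditional risk of the candidate \<open>\<xi>\<close>, \<open>Rhat \<xi>\<close> for its estimate on
the test data, \<open>\<sigma> \<xi>\<close> for the norm of its loss, and \<open>m\<close> for the minimum of \<open>Rdet\<close> over
\<open>1/\<zeta>1 + 1/\<zeta>2 \<le> 1/\<gamma>\<close>.

Some candidate is nearly optimal. The constraint set is compact in \<open>[\<gamma>, \<infinity>]\<^sup>2\<close> and \<open>Rdet\<close> is lower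
semicontinuous, so \<open>m\<close> is attained at some \<open>(\<zeta>1, \<zeta>2)\<close> (\<open>lower_semicontinuous_attains_min\<close>). The
grid of candidates has mesh \<open>block / n\<close>, which tends to \<open>0\<close>, so candidates \<open>\<xi>0 n\<close> exist whose aspect
ratios converge to \<open>(\<zeta>1, \<zeta>2)\<close> (\<open>grid_approximation\<close>, \<open>aspect_ratio_tendsto\<close>). For every value of the
seed, each ingredient of the candidate is fitted to two disjoint parts of an i.i.d. sample, hence has
the law of a predictor fitted to two independent datasets (\<open>measure_risk_one_step_subsamples\<close>), and
its risk tends to \<open>m\<close> in probability. The loss is convex, so the risk of the average of the \<open>M\<close>
ingredients is at most the largest of their risks (\<open>risk_average_le\<close>).

The test data estimate all risks at once. Given the training data and the seed, the losses on the
test data are i.i.d., so for fixed \<open>t\<close> in \<open>(0, 1]\<close> and any \<open>C > \<sigma> \<xi>\<close> the estimate is within \<open>t * C\<close> of the risk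
up to a probability \<open>\<beta> n\<close>: a Chernoff bound for averages, and Chebyshev's inequality on each batch
together with independence of the batches for medians of means (\<open>measure_PiM_test_le\<close>). As
\<open>\<beta> n * card (\<Xi> n)\<close> tends to \<open>0\<close>, a union bound applies (\<open>union_bound_psi1_tendsto_0\<close>,
\<open>union_bound_mom_tendsto_0\<close>). Bounded norms and bounded norm-to-risk ratios both allow the choice
\<open>C = K * (1 + R \<xi>)\<close> with probability close to one (\<open>norm_bound_additive\<close>,
\<open>norm_bound_multiplicative\<close>). With \<open>t \<le> s / K\<close> this gives \<open>\<bar>Rhat \<xi> - R \<xi>\<bar> \<le> s * (1 + R \<xi>)\<close> for all
candidates, with \<open>s\<close> as small as desired.

Minimising the estimate is then nearly minimising the risk: for \<open>c\<close> slightly above \<open>m\<close> with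
\<open>R (\<xi>0 n) \<le> c\<close>, the selected risk \<open>r\<close> satisfies \<open>(1 - s) * r \<le> (1 + s) * c + 2 * s\<close>
(\<open>selection_inequality\<close>). If \<open>m = \<infinity>\<close>, the truncated difference of the
selected risk and \<open>m\<close> vanishes as soon as the risk is finite, which follows from the bound on the norms.

A probability bound on a set that is not measurable carries no information, so the risks, norms
and estimates have to be measurable functions of data and seed. The only obstacle is the
Moore--Penrose inverse, which is shown to be the limit of the matrices
\<open>inverse (A\<^sup>T * A + \<epsilon>) * A\<^sup>T\<close>, whose entries are rational functions of the entries of \<open>A\<close>
(\<open>tikhonov_inverse_tendsto_pinv\<close>).
\<close>

section \<open>The Moore--Penrose inverse is a measurable function of the matrix\<close>

text \<open>
Gram--Schmidt in the form of an induction on the number of vectors: the residual of the new vector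
\<open>a k\<close> against the old ones is a further orthogonal direction, along which the residual of \<open>v\<close> is
projected as well.
\<close>

lemma orthogonal_residual_exists:
  fixes a :: "nat \<Rightarrow> nat \<Rightarrow> real" and v :: "nat \<Rightarrow> real"
  shows "\<exists>c. \<forall>i<k. (\<Sum>r<n. a i r * (v r - (\<Sum>j<k. c j * a j r))) = 0"
proof (induction k arbitrary: v)
  case 0
  show ?case by simp
next
  case (Suc k)
  obtain c where c: "\<And>i. i < k \<Longrightarrow> (\<Sum>r<n. a i r * (v r - (\<Sum>j<k. c j * a j r))) = 0"
    using Suc.IH[of v] by blast
  obtain d where d: "\<And>i. i < k \<Longrightarrow> (\<Sum>r<n. a i r * (a k r - (\<Sum>j<k. d j * a j r))) = 0"
    using Suc.IH[of "a k"] by blast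
  \<comment> \<open>\<open>w\<close> and \<open>e\<close> are the residuals of the new vector and of \<open>v\<close> against the old vectors. If \<open>w\<close> vanishes,
    \<open>s = 0\<close> by the convention on division by zero, and nothing has to be corrected.\<close>
  define w where "w r = a k r - (\<Sum>j<k. d j * a j r)" for r
  define e where "e r = v r - (\<Sum>j<k. c j * a j r)" for r
  define q where "q = (\<Sum>r<n. w r * w r)"
  define s where "s = (\<Sum>r<n. w r * e r) / q"
  define c' where "c' j = (if j < k then c j - s * d j else s)" for j
  have residual: "v r - (\<Sum>j<Suc k. c' j * a j r) = e r - s * w r" for r
  proof -
    have "(\<Sum>j<Suc k. c' j * a j r) = (\<Sum>j<k. (c j - s * d j) * a j r) + s * a k r"
      by (simp add: c'_def)
    also have "(\<Sum>j<k. (c j - s * d j) * a j r) = (\<Sum>j<k. c j * a j r) - s * (\<Sum>j<k. d j * a j r)"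
      by (simp add: left_diff_distrib sum_subtractf sum_distrib_left mult.assoc)
    finally show ?thesis
      by (simp add: e_def w_def algebra_simps)
  qed
  have old: "(\<Sum>r<n. a i r * (e r - s * w r)) = 0" if "i < k" for i
  proof -
    have "(\<Sum>r<n. a i r * (e r - s * w r)) = (\<Sum>r<n. a i r * e r) - s * (\<Sum>r<n. a i r * w r)"
      by (simp add: right_diff_distrib sum_subtractf sum_distrib_left mult.left_commute)
    then show ?thesis
      using c[OF that] d[OF that] by (simp add: e_def w_def)
  qed
  have w_orth: "(\<Sum>r<n. w r * (e r - s * w r)) = 0"
  proof (cases "q = 0")
    case True
    then have "w r = 0" if "r < n" for r
      using that unfolding q_def by (subst (asm) sum_nonneg_eq_0_iff) auto
    then show ?thesis by simp
  next
    case False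
    have "(\<Sum>r<n. w r * (e r - s * w r)) = (\<Sum>r<n. w r * e r) - s * q"
      by (simp add: right_diff_distrib sum_subtractf sum_distrib_left mult.left_commute q_def)
    then show ?thesis using False by (simp add: s_def)
  qed
  have new: "(\<Sum>r<n. a k r * (e r - s * w r)) = 0"
  proof -
    have split: "a k r * t = w r * t + (\<Sum>j<k. d j * (a j r * t))" for r t
      by (simp add: w_def sum_distrib_right left_diff_distrib mult.assoc)
    have "(\<Sum>r<n. a k r * (e r - s * w r)) = (\<Sum>r<n. w r * (e r - s * w r))
        + (\<Sum>r<n. \<Sum>j<k. d j * (a j r * (e r - s * w r)))"
      by (simp only: split sum.distrib)
    also have "(\<Sum>r<n. \<Sum>j<k. d j * (a j r * (e r - s * w r)))
        = (\<Sum>j<k. d j * (\<Sum>r<n. a j r * (e r - s * w r)))"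
      by (subst sum.swap) (simp add: sum_distrib_left)
    finally show ?thesis using w_orth old by simp
  qed
  show ?case
  proof (intro exI[of _ c'] allI impI)
    fix i assume "i < Suc k"
    then show "(\<Sum>r<n. a i r * (v r - (\<Sum>j<Suc k. c' j * a j r))) = 0"
      unfolding residual using old new by (cases "i = k") auto
  qed
qed

text \<open>
Column \<open>r\<close> of \<open>H\<close> consists of the coefficients of the projection of the \<open>r\<close>-th unit vector to the
column space of \<open>A\<close>.
\<close>

lemma normal_equations_solvable:
  fixes A :: "real mat"
  assumes A: "A \<in> carrier_mat n m"
  obtains H where "H \<in> carrier_mat m n" "A\<^sup>T * (A * H) = A\<^sup>T"
proof -
  have "\<forall>r. \<exists>c. \<forall>i<m. (\<Sum>s<n. A $$ (s, i) * ((if s = r then 1 else 0) - (\<Sum>j<m. c j * A $$ (s, j)))) = 0"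
    by (rule allI) (rule orthogonal_residual_exists[where k = m and n = n and a = "\<lambda>i s. A $$ (s, i)"
        and v = "\<lambda>s. if s = r then 1 else 0" for r])
  from choice[OF this] obtain c where c: "\<forall>r. \<forall>i<m.
      (\<Sum>s<n. A $$ (s, i) * ((if s = r then 1 else 0) - (\<Sum>j<m. c r j * A $$ (s, j)))) = 0" ..
  define H where "H = mat m n (\<lambda>(j, r). c r j)"
  have H: "H \<in> carrier_mat m n" by (simp add: H_def)
  have "A\<^sup>T * (A * H) = A\<^sup>T"
  proof (rule eq_matI)
    fix i r assume "i < dim_row A\<^sup>T" "r < dim_col A\<^sup>T"
    then have i: "i < m" and r: "r < n" using A by auto
    have "(A\<^sup>T * (A * H)) $$ (i, r) = (\<Sum>s<n. A $$ (s, i) * (\<Sum>j<m. c r j * A $$ (s, j)))"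
      using A i r by (auto simp: H_def scalar_prod_def lessThan_atLeast0 mult.commute intro!: sum.cong)
    also have "\<dots> = (\<Sum>s<n. A $$ (s, i) * (if s = r then 1 else 0))"
      using c[rule_format, OF i, of r] by (simp add: right_diff_distrib sum_subtractf)
    also have "\<dots> = A\<^sup>T $$ (i, r)"
      using A i r by (simp add: if_distrib[of "(*) _"] sum.delta cong: if_cong)
    finally show "(A\<^sup>T * (A * H)) $$ (i, r) = A\<^sup>T $$ (i, r)" .
  qed (use A H in auto)
  with H show thesis by (rule that)
qed

text \<open>
Solutions \<open>H\<close> and \<open>K\<close> of the normal equations for \<open>A\<close> and for \<open>A\<^sup>T\<close> satisfy \<open>A * H * A = A\<close> with \<open>A * H\<close>
symmetric, and \<open>A * K\<^sup>T * A = A\<close> with \<open>K\<^sup>T * A\<close> symmetric. The product \<open>K\<^sup>T * A * H\<close> inherits both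
symmetries.
\<close>

lemma is_pinv_exists:
  fixes A :: "real mat"
  shows "\<exists>X. is_pinv A X"
proof -
  define n m where "n = dim_row A" and "m = dim_col A"
  have A: "A \<in> carrier_mat n m" by (auto simp: n_def m_def)
  have At: "A\<^sup>T \<in> carrier_mat m n" using A by simp
  obtain H where H: "H \<in> carrier_mat m n" and HA: "A\<^sup>T * (A * H) = A\<^sup>T"
    using normal_equations_solvable[OF A] .
  obtain K where K: "K \<in> carrier_mat n m" and KA: "A * (A\<^sup>T * K) = A"
    using normal_equations_solvable[OF At] by auto
  define L where "L = K\<^sup>T"
  have L: "L \<in> carrier_mat m n" using K by (simp add: L_def)
  have Ht: "H\<^sup>T \<in> carrier_mat n m" using H by simp
  note carr = A At H K L Ht
  have dims: "A * H \<in> carrier_mat n n" "A\<^sup>T * K \<in> carrier_mat m m" "A\<^sup>T * A \<in> carrier_mat m m"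
    "A * A\<^sup>T \<in> carrier_mat n n" "L * A \<in> carrier_mat m m" "H\<^sup>T * A\<^sup>T \<in> carrier_mat n n"
    using carr by auto
  have HA': "H\<^sup>T * (A\<^sup>T * A) = A"
  proof -
    have "(A\<^sup>T * (A * H))\<^sup>T = (A * H)\<^sup>T * A"
      using transpose_mult[of "A\<^sup>T" m n "A * H" n] dims carr by simp
    also have "(A * H)\<^sup>T = H\<^sup>T * A\<^sup>T" using transpose_mult[OF A H] .
    finally show ?thesis using HA assoc_mult_mat[OF Ht At A] by simp
  qed
  have KA': "L * (A * A\<^sup>T) = A\<^sup>T"
  proof -
    have "(A * (A\<^sup>T * K))\<^sup>T = (A\<^sup>T * K)\<^sup>T * A\<^sup>T"
      using transpose_mult[of "A" n m "A\<^sup>T * K" m] dims carr by simp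
    also have "(A\<^sup>T * K)\<^sup>T = L * A" using transpose_mult[OF At K] by (simp add: L_def)
    finally show ?thesis using KA assoc_mult_mat[OF L A At] by simp
  qed
  have AH: "A * H = H\<^sup>T * (A\<^sup>T * (A * H))"
  proof -
    have "A * H = (H\<^sup>T * (A\<^sup>T * A)) * H" unfolding HA' ..
    also have "\<dots> = H\<^sup>T * ((A\<^sup>T * A) * H)" by (rule assoc_mult_mat[OF Ht dims(3) H])
    also have "(A\<^sup>T * A) * H = A\<^sup>T * (A * H)" by (rule assoc_mult_mat[OF At A H])
    finally show ?thesis .
  qed
  have AHs: "(A * H)\<^sup>T = A * H"
  proof -
    have "(A * H)\<^sup>T = H\<^sup>T * A\<^sup>T" using transpose_mult[OF A H] .
    also have "\<dots> = A * H" using AH[unfolded HA] by (rule sym)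
    finally show ?thesis .
  qed
  have LAs: "(L * A)\<^sup>T = L * A"
  proof -
    have "(L * A)\<^sup>T = A\<^sup>T * K" using transpose_mult[OF L A] by (simp add: L_def)
    also have "\<dots> = L * (A * A\<^sup>T) * K" using KA' by simp
    also have "\<dots> = L * ((A * A\<^sup>T) * K)" by (rule assoc_mult_mat[OF L dims(4) K])
    also have "(A * A\<^sup>T) * K = A * (A\<^sup>T * K)" by (rule assoc_mult_mat[OF A At K])
    also have "L * (A * (A\<^sup>T * K)) = L * A" by (simp only: KA)
    finally show ?thesis .
  qed
  have AHA: "A * (H * A) = A"
  proof -
    have "A * (H * A) = (A * H) * A" using assoc_mult_mat[OF A H A] by simp
    also have "\<dots> = (H\<^sup>T * A\<^sup>T) * A" unfolding transpose_mult[OF A H, symmetric] AHs ..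
    also have "\<dots> = A" using HA' assoc_mult_mat[OF Ht At A] by simp
    finally show ?thesis .
  qed
  have ALA: "A * (L * A) = A"
    using KA LAs transpose_mult[OF L A] by (simp add: L_def)
  define X where "X = L * (A * H)"
  have X: "X \<in> carrier_mat m n" using dims carr by (simp add: X_def)
  have AX: "A * X = A * H"
  proof -
    have "A * X = (A * (L * A)) * H"
      unfolding X_def using assoc_mult_mat[OF L A H] assoc_mult_mat[OF A dims(5) H] by simp
    then show ?thesis using ALA by simp
  qed
  have XA: "X * A = L * A"
  proof -
    have "X * A = L * (A * (H * A))"
      unfolding X_def using assoc_mult_mat[OF L _ A, of "A * H"] assoc_mult_mat[OF A H A] dims by simp
    then show ?thesis using AHA by simp
  qed
  have "A * X * A = A" using AX AHA assoc_mult_mat[OF A H A] by simp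
  moreover have "X * A * X = X"
  proof -
    have "X * A * X = L * (A * X)" using XA assoc_mult_mat[OF L A X] by simp
    then show ?thesis by (simp only: AX) (simp add: X_def)
  qed
  moreover have "(A * X)\<^sup>T = A * X" "(X * A)\<^sup>T = X * A"
    by (simp_all only: AX XA AHs LAs)
  moreover have "X \<in> carrier_mat (dim_col A) (dim_row A)"
    using X by (simp only: n_def m_def)
  ultimately have "is_pinv A X"
    unfolding is_pinv_def by (intro conjI)
  then show ?thesis by (rule exI)
qed

text \<open>
Both inverses yield the same projections \<open>A * X\<close> and \<open>X * A\<close>, by transposing products of symmetric
factors.
\<close>

lemma is_pinv_unique:
  assumes "is_pinv A X" "is_pinv A Y"
  shows "X = Y"
proof -
  define n m where "n = dim_row A" and "m = dim_col A"
  have A: "A \<in> carrier_mat n m" by (auto simp: n_def m_def)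
  have X: "X \<in> carrier_mat m n" and Y: "Y \<in> carrier_mat m n"
    using assms unfolding is_pinv_def n_def m_def by blast+
  note x = assms(1)[unfolded is_pinv_def] and y = assms(2)[unfolded is_pinv_def]
  have AXs: "(A * X)\<^sup>T = A * X" and AYs: "(A * Y)\<^sup>T = A * Y"
    and XAs: "(X * A)\<^sup>T = X * A" and YAs: "(Y * A)\<^sup>T = Y * A"
    using x y by auto
  have c: "A * X \<in> carrier_mat n n" "A * Y \<in> carrier_mat n n" "X * A \<in> carrier_mat m m"
    "Y * A \<in> carrier_mat m m" using A X Y by auto
  have AX: "A * X = A * Y"
  proof -
    have "A * X = (A * Y * A) * X" using y by simp
    also have "\<dots> = (A * Y) * (A * X)" using assoc_mult_mat[OF c(2) A X] .
    also have "\<dots> = ((A * X) * (A * Y))\<^sup>T" using transpose_mult[OF c(1,2)] AXs AYs by simp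
    also have "(A * X) * (A * Y) = A * Y" using assoc_mult_mat[OF c(1) A Y] x by simp
    finally show ?thesis using AYs by simp
  qed
  have XA: "X * A = Y * A"
  proof -
    have "X * A = X * (A * (Y * A))" using y assoc_mult_mat[OF A Y A] by simp
    also have "\<dots> = (X * A) * (Y * A)" using assoc_mult_mat[OF X A c(4)] by simp
    also have "\<dots> = ((Y * A) * (X * A))\<^sup>T" using transpose_mult[OF c(4,3)] XAs YAs by simp
    also have "(Y * A) * (X * A) = Y * (A * X * A)"
      using assoc_mult_mat[OF Y A c(3)] assoc_mult_mat[OF A X A] by simp
    finally show ?thesis using YAs x by simp
  qed
  have "X = X * A * X" using x by simp
  also have "\<dots> = Y * A * X" using XA by simp
  also have "\<dots> = Y * (A * X)" using assoc_mult_mat[OF Y A X] .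
  also have "\<dots> = Y * (A * Y)" using AX by simp
  also have "\<dots> = Y" using assoc_mult_mat[OF Y A Y] y by simp
  finally show ?thesis .
qed

lemma is_pinv_pinv: "is_pinv A (pinv A)"
  unfolding pinv_def by (rule theI') (use is_pinv_exists is_pinv_unique in blast)

lemma pinv_carrier: "A \<in> carrier_mat n m \<Longrightarrow> pinv A \<in> carrier_mat m n"
  using is_pinv_pinv[of A] unfolding is_pinv_def by (metis carrier_matD)

text \<open>
Each column of the pseudoinverse lies in the range of \<open>A\<^sup>T * A\<close>, with \<open>Z = X * X\<^sup>T * X\<close> as witness.
This is what makes the regularisation error vanish.
\<close>

lemma pinv_factors:
  assumes A: "A \<in> carrier_mat n m"
  obtains Z where "Z \<in> carrier_mat m n" "A\<^sup>T * (A * Z) = pinv A" "A\<^sup>T * (A * pinv A) = A\<^sup>T"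
proof -
  define X where "X = pinv A"
  have X: "X \<in> carrier_mat m n" unfolding X_def using A by (rule pinv_carrier)
  have Xt: "X\<^sup>T \<in> carrier_mat n m" and At: "A\<^sup>T \<in> carrier_mat m n" using A X by auto
  note x = is_pinv_pinv[of A, folded X_def, unfolded is_pinv_def]
  have AXs: "(A * X)\<^sup>T = A * X" and XAs: "(X * A)\<^sup>T = X * A" and XAX: "X * A * X = X"
    and AXA: "A * X * A = A" using x by auto
  have c: "A * X \<in> carrier_mat n n" "X * A \<in> carrier_mat m m" using A X by auto
  have "A\<^sup>T = (A * X * A)\<^sup>T" using AXA by simp
  also have "\<dots> = A\<^sup>T * (A * X)" using transpose_mult[OF c(1) A] AXs by simp
  finally have 1: "A\<^sup>T * (A * X) = A\<^sup>T" by simp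
  have 2: "X\<^sup>T = A * (X * X\<^sup>T)"
  proof -
    have "X\<^sup>T = (X * (A * X))\<^sup>T" using XAX assoc_mult_mat[OF X A X] by simp
    also have "\<dots> = (A * X) * X\<^sup>T" using transpose_mult[OF X c(1)] AXs by simp
    finally show ?thesis using assoc_mult_mat[OF A X Xt] by simp
  qed
  define Z where "Z = X * X\<^sup>T * X"
  have Z: "Z \<in> carrier_mat m n" using X Xt by (auto simp: Z_def)
  have "A * Z = A * (X * X\<^sup>T) * X"
    unfolding Z_def using assoc_mult_mat[OF A _ X, of "X * X\<^sup>T"] X Xt by simp
  also have "\<dots> = X\<^sup>T * X" by (simp only: 2[symmetric])
  finally have AZ: "A * Z = X\<^sup>T * X" .
  have "X = (X * A)\<^sup>T * X" using XAs XAX by simp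
  also have "\<dots> = A\<^sup>T * (X\<^sup>T * X)"
    using transpose_mult[OF X A] assoc_mult_mat[OF At Xt X] by simp
  finally have "A\<^sup>T * (A * Z) = X" using AZ by simp
  then show thesis using that Z 1 unfolding X_def by blast
qed

definition tikhonov_matrix :: "real \<Rightarrow> real mat \<Rightarrow> real mat" where
  "tikhonov_matrix \<epsilon> A = A\<^sup>T * A + \<epsilon> \<cdot>\<^sub>m 1\<^sub>m (dim_col A)"

text \<open>
For \<open>\<epsilon> > 0\<close> this is the inverse of \<open>A\<^sup>T * A + \<epsilon>\<close> times \<open>A\<^sup>T\<close>, with the inverse written through Cramer's
rule so that its entries are visibly measurable.
\<close>

definition tikhonov_inverse :: "real \<Rightarrow> real mat \<Rightarrow> real mat" where
  "tikhonov_inverse \<epsilon> A =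
     (1 / det (tikhonov_matrix \<epsilon> A)) \<cdot>\<^sub>m (adj_mat (tikhonov_matrix \<epsilon> A) * A\<^sup>T)"

lemma tikhonov_matrix_carrier: "A \<in> carrier_mat n m \<Longrightarrow> tikhonov_matrix \<epsilon> A \<in> carrier_mat m m"
  by (auto simp: tikhonov_matrix_def)

lemma tikhonov_matrix_mult_vec:
  assumes A: "A \<in> carrier_mat n m" and u: "u \<in> carrier_vec m"
  shows "tikhonov_matrix \<epsilon> A *\<^sub>v u = A\<^sup>T *\<^sub>v (A *\<^sub>v u) + \<epsilon> \<cdot>\<^sub>v u"
proof -
  have At: "A\<^sup>T \<in> carrier_mat m n" using A by simp
  have "(\<epsilon> \<cdot>\<^sub>m 1\<^sub>m m) *\<^sub>v u = \<epsilon> \<cdot>\<^sub>v u"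
    using u by (intro eq_vecI) (auto simp: smult_scalar_prod_distrib[of _ m])
  moreover have "dim_col A = m" using A by auto
  ultimately show ?thesis
    unfolding tikhonov_matrix_def using add_mult_distrib_mat_vec[of "A\<^sup>T * A" m m "\<epsilon> \<cdot>\<^sub>m 1\<^sub>m m" u]
      assoc_mult_mat_vec[OF At A u] A At u by auto
qed

lemma tikhonov_energy:
  assumes A: "A \<in> carrier_mat n m" and u: "u \<in> carrier_vec m"
  shows "scalar_prod u (tikhonov_matrix \<epsilon> A *\<^sub>v u)
    = scalar_prod (A *\<^sub>v u) (A *\<^sub>v u) + \<epsilon> * scalar_prod u u"
proof -
  have Au: "A *\<^sub>v u \<in> carrier_vec n" using A u by simp
  have "scalar_prod u (A\<^sup>T *\<^sub>v (A *\<^sub>v u)) = scalar_prod (A *\<^sub>v u) (A *\<^sub>v u)"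
    using transpose_vec_mult_scalar[OF A u Au]
    by (metis A Au comm_scalar_prod mult_mat_vec_carrier transpose_carrier_mat u)
  then show ?thesis
    unfolding tikhonov_matrix_mult_vec[OF A u]
    using scalar_prod_add_distrib[of u m "A\<^sup>T *\<^sub>v (A *\<^sub>v u)" "\<epsilon> \<cdot>\<^sub>v u"] A u Au
    by (auto simp: mult_mat_vec_carrier[of _ m n])
qed

lemma scalar_prod_self_real_nonneg: "0 \<le> scalar_prod u (u :: real Matrix.vec)"
  unfolding scalar_prod_def by (intro sum_nonneg) auto

lemma scalar_prod_self_real_eq_0:
  fixes u :: "real Matrix.vec"
  assumes "u \<in> carrier_vec m" "scalar_prod u u = 0"
  shows "u = 0\<^sub>v m"
proof (rule eq_vecI)
  fix i assume i: "i < dim_vec (0\<^sub>v m :: real Matrix.vec)"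
  have "\<forall>i\<in>{0..<dim_vec u}. vec_index u i * vec_index u i = 0"
    using assms(2) unfolding scalar_prod_def by (subst (asm) sum_nonneg_eq_0_iff) auto
  then show "vec_index u i = vec_index (0\<^sub>v m) i" using i assms(1) by auto
qed (use assms in auto)

lemma det_tikhonov_matrix_nonzero:
  assumes A: "A \<in> carrier_mat n m" and \<epsilon>: "0 < \<epsilon>"
  shows "det (tikhonov_matrix \<epsilon> A) \<noteq> 0"
proof
  assume "det (tikhonov_matrix \<epsilon> A) = 0"
  then obtain u where u: "u \<in> carrier_vec m" "u \<noteq> 0\<^sub>v m" "tikhonov_matrix \<epsilon> A *\<^sub>v u = 0\<^sub>v m"
    using det_0_iff_vec_prod_zero[OF tikhonov_matrix_carrier[OF A]] by blast
  have "scalar_prod (A *\<^sub>v u) (A *\<^sub>v u) + \<epsilon> * scalar_prod u u = 0"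
    using tikhonov_energy[OF A u(1), of \<epsilon>] u by simp
  moreover have "0 \<le> scalar_prod (A *\<^sub>v u) (A *\<^sub>v u)" "0 \<le> scalar_prod u u"
    by (rule scalar_prod_self_real_nonneg)+
  ultimately have "scalar_prod u u = 0" using \<epsilon>
    by (metis add_nonneg_eq_0_iff less_le mult_eq_0_iff mult_nonneg_nonneg)
  then show False using scalar_prod_self_real_eq_0[OF u(1)] u(2) by simp
qed

lemma tikhonov_inverse_carrier:
  assumes A: "A \<in> carrier_mat n m"
  shows "tikhonov_inverse \<epsilon> A \<in> carrier_mat m n"
  unfolding tikhonov_inverse_def
  by (rule smult_carrier_mat, rule mult_carrier_mat[OF adj_mat(1)[OF tikhonov_matrix_carrier[OF A]]])
    (use A in simp)

lemma tikhonov_matrix_times_inverse: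
  assumes A: "A \<in> carrier_mat n m" and \<epsilon>: "0 < \<epsilon>"
  shows "tikhonov_matrix \<epsilon> A * tikhonov_inverse \<epsilon> A = A\<^sup>T"
proof -
  let ?S = "tikhonov_matrix \<epsilon> A"
  have At: "A\<^sup>T \<in> carrier_mat m n" using A by simp
  note S = tikhonov_matrix_carrier[OF A, of \<epsilon>]
  note adj = adj_mat[OF S]
  have "?S * tikhonov_inverse \<epsilon> A = (1 / det ?S) \<cdot>\<^sub>m (?S * (adj_mat ?S * A\<^sup>T))"
    unfolding tikhonov_inverse_def using mult_smult_distrib[OF S, of "adj_mat ?S * A\<^sup>T" n] adj At by simp
  also have "?S * (adj_mat ?S * A\<^sup>T) = det ?S \<cdot>\<^sub>m A\<^sup>T"
    using assoc_mult_mat[OF S adj(1) At] adj(2) mult_smult_assoc_mat[of "1\<^sub>m m" m m "A\<^sup>T" n "det ?S"] At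
    by simp
  finally show ?thesis
    using det_tikhonov_matrix_nonzero[OF A \<epsilon>] by (intro eq_matI) auto
qed

text \<open>
The difference \<open>u\<close> of the \<open>j\<close>-th columns solves \<open>(A\<^sup>T * A + \<epsilon>) u = \<epsilon> * A\<^sup>T * A * z\<close>. Pairing with \<open>u\<close>
gives \<open>\<bar>A u\<bar>\<^sup>2 + \<epsilon> * \<bar>u\<bar>\<^sup>2 = \<epsilon> * \<langle>A u, A z\<rangle>\<close>, and completing the square bounds \<open>\<bar>u\<bar>\<^sup>2\<close> by
\<open>\<epsilon> * \<bar>A z\<bar>\<^sup>2 / 4\<close>.
\<close>

lemma tikhonov_inverse_error:
  assumes A: "A \<in> carrier_mat n m"
  obtains C :: "nat \<Rightarrow> real" where "\<And>\<epsilon> i j. 0 < \<epsilon> \<Longrightarrow> i < m \<Longrightarrow> j < n \<Longrightarrow>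
    (pinv A $$ (i, j) - tikhonov_inverse \<epsilon> A $$ (i, j))\<^sup>2 \<le> \<epsilon> * C j"
proof -
  obtain Z where Z: "Z \<in> carrier_mat m n" and AZ: "A\<^sup>T * (A * Z) = pinv A"
    and AX: "A\<^sup>T * (A * pinv A) = A\<^sup>T"
    using pinv_factors[OF A] .
  have At: "A\<^sup>T \<in> carrier_mat m n" using A by simp
  have X: "pinv A \<in> carrier_mat m n" using pinv_carrier[OF A] .
  define C where "C j = scalar_prod (A *\<^sub>v col Z j) (A *\<^sub>v col Z j) / 4" for j
  have "(pinv A $$ (i, j) - tikhonov_inverse \<epsilon> A $$ (i, j))\<^sup>2 \<le> \<epsilon> * C j"
    if \<epsilon>: "0 < \<epsilon>" and i: "i < m" and j: "j < n" for \<epsilon> i j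
  proof -
    let ?S = "tikhonov_matrix \<epsilon> A" and ?Y = "tikhonov_inverse \<epsilon> A"
    have S: "?S \<in> carrier_mat m m" using tikhonov_matrix_carrier[OF A] .
    have Y: "?Y \<in> carrier_mat m n" using tikhonov_inverse_carrier[OF A] .
    define x y z u where "x = col (pinv A) j" and "y = col ?Y j" and "z = col Z j" and "u = x - y"
    have c: "x \<in> carrier_vec m" "y \<in> carrier_vec m" "z \<in> carrier_vec m" "u \<in> carrier_vec m"
      using X Y Z by (auto simp: x_def y_def z_def u_def intro!: minus_carrier_vec)
    have Az: "A *\<^sub>v z \<in> carrier_vec n" and Au: "A *\<^sub>v u \<in> carrier_vec n" using A c by auto
    have Sx: "?S *\<^sub>v x = col A\<^sup>T j + \<epsilon> \<cdot>\<^sub>v x"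
    proof -
      have "A\<^sup>T *\<^sub>v (A *\<^sub>v x) = col (A\<^sup>T * (A * pinv A)) j"
        unfolding x_def using A X j by (subst col_mult2[OF At _ j]) (auto simp: col_mult2[OF A X j])
      then show ?thesis using tikhonov_matrix_mult_vec[OF A c(1)] AX by simp
    qed
    have Sy: "?S *\<^sub>v y = col A\<^sup>T j"
      unfolding y_def using col_mult2[OF S Y j] tikhonov_matrix_times_inverse[OF A \<epsilon>] by simp
    have x_eq: "x = A\<^sup>T *\<^sub>v (A *\<^sub>v z)"
    proof -
      have "A\<^sup>T *\<^sub>v (A *\<^sub>v z) = col (A\<^sup>T * (A * Z)) j"
        unfolding z_def using A Z j by (subst col_mult2[OF At _ j]) (auto simp: col_mult2[OF A Z j])
      then show ?thesis using AZ by (simp add: x_def)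
    qed
    have "?S *\<^sub>v u = \<epsilon> \<cdot>\<^sub>v x"
      unfolding u_def mult_minus_distrib_mat_vec[OF S c(1,2)] Sx Sy
      using At j c(1) by (intro eq_vecI) auto
    then have "scalar_prod (A *\<^sub>v u) (A *\<^sub>v u) + \<epsilon> * scalar_prod u u = \<epsilon> * scalar_prod u x"
      using tikhonov_energy[OF A c(4), of \<epsilon>] c by simp
    also have "scalar_prod u x = scalar_prod (A *\<^sub>v u) (A *\<^sub>v z)"
      unfolding x_eq using transpose_vec_mult_scalar[OF A c(4) Az]
      by (metis A Az Au c(4) comm_scalar_prod mult_mat_vec_carrier transpose_carrier_mat)
    finally have "\<epsilon> * scalar_prod u u
        = \<epsilon> * scalar_prod (A *\<^sub>v u) (A *\<^sub>v z) - scalar_prod (A *\<^sub>v u) (A *\<^sub>v u)" by simp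
    also have "\<dots> \<le> \<epsilon>\<^sup>2 * C j"
    proof -
      have "\<epsilon> * (a * b) - a * a \<le> \<epsilon>\<^sup>2 * (b * b) / 4" for a b :: real
        using zero_le_power2[of "a - \<epsilon> * b / 2"] by (simp add: power2_eq_square algebra_simps)
      then have "(\<Sum>r<n. \<epsilon> * (vec_index (A *\<^sub>v u) r * vec_index (A *\<^sub>v z) r)
            - vec_index (A *\<^sub>v u) r * vec_index (A *\<^sub>v u) r)
          \<le> (\<Sum>r<n. \<epsilon>\<^sup>2 * (vec_index (A *\<^sub>v z) r * vec_index (A *\<^sub>v z) r) / 4)"
        by (intro sum_mono) auto
      then show ?thesis using Az Au A
        by (simp add: C_def z_def[symmetric] scalar_prod_def lessThan_atLeast0 sum_subtractf
            sum_distrib_left sum_divide_distrib)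
    qed
    finally have "scalar_prod u u \<le> \<epsilon> * C j"
      using \<epsilon> by (simp add: power2_eq_square mult.assoc)
    moreover have "(vec_index u i)\<^sup>2 \<le> scalar_prod u u"
      unfolding scalar_prod_def power2_eq_square using c(4) i
      by (intro member_le_sum) auto
    moreover have "vec_index u i = pinv A $$ (i, j) - ?Y $$ (i, j)"
      unfolding u_def x_def y_def using X Y i j by auto
    ultimately show ?thesis by simp
  qed
  then show thesis by (rule that)
qed

lemma tikhonov_inverse_tendsto_pinv:
  assumes A: "A \<in> carrier_mat n m" and i: "i < m" and j: "j < n"
  shows "(\<lambda>k. tikhonov_inverse (1 / real (Suc k)) A $$ (i, j)) \<longlonglongrightarrow> pinv A $$ (i, j)"
proof -
  obtain C where C: "\<And>\<epsilon> i j. 0 < \<epsilon> \<Longrightarrow> i < m \<Longrightarrow> j < n \<Longrightarrow>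
    (pinv A $$ (i, j) - tikhonov_inverse \<epsilon> A $$ (i, j))\<^sup>2 \<le> \<epsilon> * C j"
    using tikhonov_inverse_error[OF A] by blast
  have "(\<lambda>k. 1 / real (Suc k)) \<longlonglongrightarrow> 0"
    using LIMSEQ_inverse_real_of_nat by (simp add: inverse_eq_divide)
  then have 0: "(\<lambda>k. 1 / real (Suc k) * C j) \<longlonglongrightarrow> 0"
    by (rule tendsto_mult_left_zero)
  define e where "e k = pinv A $$ (i, j) - tikhonov_inverse (1 / real (Suc k)) A $$ (i, j)" for k
  have "(e k)\<^sup>2 \<le> 1 / real (Suc k) * C j" for k
    unfolding e_def by (intro C i j) simp
  then have "(\<lambda>k. (e k)\<^sup>2) \<longlonglongrightarrow> 0"
    by (intro tendsto_sandwich[OF _ _ tendsto_const 0] always_eventually allI zero_le_power2)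
  from tendsto_real_sqrt[OF this] have "e \<longlonglongrightarrow> 0"
    by (simp only: real_sqrt_abs real_sqrt_zero tendsto_rabs_zero_iff)
  from tendsto_diff[OF tendsto_const[of "pinv A $$ (i, j)"] this] show ?thesis
    by (simp only: e_def diff_diff_eq2 add_diff_cancel_left' diff_0_right)
qed

lemma borel_measurable_det:
  fixes F :: "'w \<Rightarrow> real mat"
  assumes dim: "\<And>w. F w \<in> carrier_mat k k"
    and meas: "\<And>i j. i < k \<Longrightarrow> j < k \<Longrightarrow> (\<lambda>w. F w $$ (i, j)) \<in> borel_measurable N"
  shows "(\<lambda>w. det (F w)) \<in> borel_measurable N"
proof -
  have "(\<lambda>w. \<Sum>\<pi> | \<pi> permutes {0..<k}. signof \<pi> * (\<Prod>i = 0..<k. F w $$ (i, \<pi> i))) \<in> borel_measurable N"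
    by (intro borel_measurable_sum borel_measurable_times borel_measurable_const borel_measurable_prod meas)
      (auto simp: permutes_in_image)
  moreover have "det (F w) = (\<Sum>\<pi> | \<pi> permutes {0..<k}. signof \<pi> * (\<Prod>i = 0..<k. F w $$ (i, \<pi> i)))" for w
    using dim[of w] by (simp add: det_def)
  ultimately show ?thesis by simp
qed

lemma borel_measurable_mat_mult:
  fixes F G :: "'w \<Rightarrow> real mat"
  assumes dim: "\<And>w. F w \<in> carrier_mat a b" "\<And>w. G w \<in> carrier_mat b c"
    and meas: "\<And>i j. i < a \<Longrightarrow> j < b \<Longrightarrow> (\<lambda>w. F w $$ (i, j)) \<in> borel_measurable N"
      "\<And>i j. i < b \<Longrightarrow> j < c \<Longrightarrow> (\<lambda>w. G w $$ (i, j)) \<in> borel_measurable N"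
    and ij: "i < a" "j < c"
  shows "(\<lambda>w. (F w * G w) $$ (i, j)) \<in> borel_measurable N"
proof -
  have "(F w * G w) $$ (i, j) = (\<Sum>k<b. F w $$ (i, k) * G w $$ (k, j))" for w
    using dim[of w] ij by (auto simp: scalar_prod_def lessThan_atLeast0)
  then show ?thesis using meas ij by simp
qed

lemma borel_measurable_pinv:
  fixes F :: "'w \<Rightarrow> real mat"
  assumes dim: "\<And>w. F w \<in> carrier_mat n m"
    and meas: "\<And>i j. i < n \<Longrightarrow> j < m \<Longrightarrow> (\<lambda>w. F w $$ (i, j)) \<in> borel_measurable N"
    and ij: "i < m" "j < n"
  shows "(\<lambda>w. pinv (F w) $$ (i, j)) \<in> borel_measurable N"
proof (rule borel_measurable_LIMSEQ_real)
  show "(\<lambda>k. tikhonov_inverse (1 / real (Suc k)) (F w) $$ (i, j)) \<longlonglongrightarrow> pinv (F w) $$ (i, j)" for w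
    using tikhonov_inverse_tendsto_pinv[OF dim ij] .
next
  fix k
  define S where "S w = tikhonov_matrix (1 / real (Suc k)) (F w)" for w
  have dims: "S w \<in> carrier_mat m m" "(F w)\<^sup>T \<in> carrier_mat m n" for w
    using dim[of w] tikhonov_matrix_carrier[OF dim[of w]] by (auto simp: S_def)
  have Ft: "(\<lambda>w. (F w)\<^sup>T $$ (a, b)) \<in> borel_measurable N" if "a < m" "b < n" for a b
  proof -
    have "(F w)\<^sup>T $$ (a, b) = F w $$ (b, a)" for w using dim[of w] that by auto
    then show ?thesis using meas[OF that(2,1)] by simp
  qed
  have S_eq: "S w $$ (a, b) = ((F w)\<^sup>T * F w) $$ (a, b) + (1 / real (Suc k)) * (if a = b then 1 else 0)"
    if "a < m" "b < m" for a b w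
    using that dim[of w] by (auto simp: S_def tikhonov_matrix_def)
  have Sm: "(\<lambda>w. S w $$ (a, b)) \<in> borel_measurable N" if "a < m" "b < m" for a b
    unfolding S_eq[OF that]
    by (intro borel_measurable_add borel_measurable_const
        borel_measurable_mat_mult[OF dims(2) dim Ft meas that])
  have det: "(\<lambda>w. det (S w)) \<in> borel_measurable N"
    by (rule borel_measurable_det[OF dims(1) Sm])
  have cof: "(\<lambda>w. cofactor (S w) b a) \<in> borel_measurable N" if "a < m" "b < m" for a b
    unfolding cofactor_def
  proof (intro borel_measurable_times borel_measurable_const borel_measurable_det)
    show "mat_delete (S w) b a \<in> carrier_mat (m - 1) (m - 1)" for w
      using dims(1)[of w] by (auto simp: mat_delete_def)
    fix i j assume "i < m - 1" "j < m - 1"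
    then have "mat_delete (S w) b a $$ (i, j)
        = S w $$ (if i < b then i else Suc i, if j < a then j else Suc j)" for w
      using dims(1)[of w] by (auto simp: mat_delete_def)
    then show "(\<lambda>w. mat_delete (S w) b a $$ (i, j)) \<in> borel_measurable N"
      using \<open>i < m - 1\<close> \<open>j < m - 1\<close> by (auto intro!: Sm)
  qed
  have adj: "(\<lambda>w. adj_mat (S w) $$ (a, b)) \<in> borel_measurable N" if "a < m" "b < m" for a b
  proof -
    have "adj_mat (S w) $$ (a, b) = cofactor (S w) b a" for w
      using dims(1)[of w] that by (auto simp: adj_mat_def)
    then show ?thesis using cof[OF that] by simp
  qed
  have "(\<lambda>w. (1 / det (S w)) * (adj_mat (S w) * (F w)\<^sup>T) $$ (i, j)) \<in> borel_measurable N"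
    by (intro borel_measurable_times borel_measurable_divide borel_measurable_const det
        borel_measurable_mat_mult[OF adj_mat(1)[OF dims(1)] dims(2) adj Ft ij])
  moreover have "tikhonov_inverse (1 / real (Suc k)) (F w) $$ (i, j)
      = (1 / det (S w)) * (adj_mat (S w) * (F w)\<^sup>T) $$ (i, j)" for w
    unfolding tikhonov_inverse_def S_def[symmetric]
    by (rule index_smult_mat(1)) (use adj_mat(1)[OF dims(1), of w] dims(2)[of w] ij in auto)
  ultimately show "(\<lambda>w. tikhonov_inverse (1 / real (Suc k)) (F w) $$ (i, j)) \<in> borel_measurable N"
    by simp
qed

section \<open>Measurability of predictors, risks and risk estimates\<close>

lemma dataset_lessThan: "dataset z {..<k} = map z [0..<k]"
  by (simp add: dataset_def lessThan_atLeast0)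

lemma dataset_cong:
  assumes "finite A" "\<And>i. i \<in> A \<Longrightarrow> z i = z' i"
  shows "dataset z A = dataset z' A"
  using assms by (simp add: dataset_def)

text \<open>
The observations with indices in \<open>A\<close>, renumbered from \<open>0\<close>, so that a predictor fitted to an arbitrary
part of the data is one fitted to a dataset of standard form.
\<close>

definition subsample :: "nat set \<Rightarrow> (nat \<Rightarrow> observation) \<Rightarrow> nat \<Rightarrow> observation" where
  "subsample A z = (\<lambda>i\<in>{..<card A}. z (sorted_list_of_set A ! i))"

lemma sorted_list_of_set_nth_mem:
  assumes "finite A" "i < card A"
  shows "sorted_list_of_set A ! i \<in> A"
  using assms nth_mem[of i "sorted_list_of_set A"] by simp

lemma dataset_subsample: "finite A \<Longrightarrow> dataset (subsample A z) {..<card A} = dataset z A"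
  by (intro nth_equalityI) (auto simp: dataset_lessThan, auto simp: dataset_def subsample_def)

lemma measurable_subsample:
  assumes Z: "Z \<in> N \<rightarrow>\<^sub>M PiM T (\<lambda>_. S)" and A: "finite A" "A \<subseteq> T"
  shows "(\<lambda>w. subsample A (Z w)) \<in> N \<rightarrow>\<^sub>M PiM {..<card A} (\<lambda>_. S)"
  unfolding subsample_def
proof (rule measurable_restrict)
  fix i assume "i \<in> {..<card A}"
  then have "sorted_list_of_set A ! i \<in> T" using sorted_list_of_set_nth_mem[OF A(1)] A(2) by auto
  from measurable_compose[OF Z measurable_component_singleton[OF this]]
  show "(\<lambda>w. Z w (sorted_list_of_set A ! i)) \<in> N \<rightarrow>\<^sub>M S" .
qed

definition gram :: "nat \<Rightarrow> nat \<Rightarrow> (nat \<Rightarrow> observation) \<Rightarrow> real mat" where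
  "gram p k z = mat p p (\<lambda>(a, b). \<Sum>i<k. fst (z i) a * fst (z i) b)"

lemma sum_list_dataset: "(\<Sum>d\<leftarrow>dataset z {..<k}. h d) = (\<Sum>i<k. h (z i))"
  by (simp add: dataset_lessThan o_def interv_sum_list_conv_sum_set_nat atLeast0LessThan)

lemma one_step_eq_sum:
  "one_step f p D (dataset z {..<k}) x = f p D x
     + (\<Sum>a<p. x a * (\<Sum>b<p. pinv (gram p k z) $$ (a, b)
         * (\<Sum>i<k. fst (z i) b * (snd (z i) - f p D (fst (z i))))))"
proof -
  have gram: "mat p p (\<lambda>(a, b). \<Sum>(X, Y)\<leftarrow>dataset z {..<k}. X a * X b) = gram p k z"
    by (simp add: gram_def sum_list_dataset[where h = "\<lambda>d. fst d a * fst d b" for a b, symmetric]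
        case_prod_unfold)
  have pinv: "pinv (gram p k z) \<in> carrier_mat p p"
    by (rule pinv_carrier) (simp add: gram_def)
  have h: "(\<Sum>(X, Y)\<leftarrow>dataset z {..<k}. X b * (Y - f p D X))
      = (\<Sum>i<k. fst (z i) b * (snd (z i) - f p D (fst (z i))))" for b
    by (simp add: sum_list_dataset[where h = "\<lambda>d. fst d b * (snd d - f p D (fst d))", symmetric]
        case_prod_unfold)
  show ?thesis
    unfolding one_step_def Let_def gram h
    using pinv by (simp add: scalar_prod_def lessThan_atLeast0)
qed

lemma measurable_feature: "a < p \<Longrightarrow> (\<lambda>x. x a) \<in> borel_measurable (feature_space p)"
  unfolding feature_space_def by (rule measurable_component_singleton) simp

lemma measurable_procedureD:
  assumes f: "measurable_procedure f"
    and Z: "Z \<in> N \<rightarrow>\<^sub>M PiM {..<k} (\<lambda>_. obs_space p)" and X: "X \<in> N \<rightarrow>\<^sub>M feature_space p"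
  shows "(\<lambda>w. f p (dataset (Z w) {..<k}) (X w)) \<in> borel_measurable N"
  using measurable_compose[OF measurable_Pair[OF Z X] f[unfolded measurable_procedure_def, rule_format, of p k]]
  by simp

text \<open>
The data and the point of evaluation may all depend on \<open>w\<close>. This covers joint measurability in data
and point, which is what integrating the point out requires.
\<close>

lemma measurable_one_step:
  assumes f: "measurable_procedure f"
    and Z1: "Z1 \<in> N \<rightarrow>\<^sub>M PiM {..<k1} (\<lambda>_. obs_space p)"
    and Z2: "Z2 \<in> N \<rightarrow>\<^sub>M PiM {..<k2} (\<lambda>_. obs_space p)"
    and X: "X \<in> N \<rightarrow>\<^sub>M feature_space p"
  shows "(\<lambda>w. one_step f p (dataset (Z1 w) {..<k1}) (dataset (Z2 w) {..<k2}) (X w)) \<in> borel_measurable N"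
proof -
  have obs: "(\<lambda>w. Z2 w i) \<in> N \<rightarrow>\<^sub>M obs_space p" if "i < k2" for i
    using measurable_compose[OF Z2 measurable_component_singleton[of i "{..<k2}"]] that by simp
  have fst: "(\<lambda>w. fst (Z2 w i)) \<in> N \<rightarrow>\<^sub>M feature_space p" if "i < k2" for i
    using measurable_compose[OF obs[OF that, unfolded obs_space_def] measurable_fst] .
  have snd: "(\<lambda>w. snd (Z2 w i)) \<in> borel_measurable N" if "i < k2" for i
    using measurable_compose[OF obs[OF that, unfolded obs_space_def] measurable_snd] .
  have coord: "(\<lambda>w. fst (Z2 w i) a) \<in> borel_measurable N" if "i < k2" "a < p" for i a
    using measurable_compose[OF fst[OF that(1)] measurable_feature[OF that(2)]] .
  have xcoord: "(\<lambda>w. X w a) \<in> borel_measurable N" if "a < p" for a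
    using measurable_compose[OF X measurable_feature[OF that]] .
  have pinv: "(\<lambda>w. pinv (gram p k2 (Z2 w)) $$ (a, b)) \<in> borel_measurable N" if "a < p" "b < p" for a b
  proof (rule borel_measurable_pinv[OF _ _ that])
    show "gram p k2 (Z2 w) \<in> carrier_mat p p" for w by (simp add: gram_def)
    show "(\<lambda>w. gram p k2 (Z2 w) $$ (i, j)) \<in> borel_measurable N" if "i < p" "j < p" for i j
      using that by (auto simp: gram_def intro!: borel_measurable_sum borel_measurable_times coord)
  qed
  show ?thesis
    unfolding one_step_eq_sum
    by (intro borel_measurable_add borel_measurable_sum borel_measurable_times borel_measurable_diff
        measurable_procedureD[OF f Z1] X xcoord pinv coord fst snd) auto
qed

lemma measurable_one_step_dataset:
  assumes f: "measurable_procedure f"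
    and Z: "Z \<in> N \<rightarrow>\<^sub>M PiM T (\<lambda>_. obs_space p)" and X: "X \<in> N \<rightarrow>\<^sub>M feature_space p"
    and AB: "finite T" "A \<subseteq> T" "B \<subseteq> T"
  shows "(\<lambda>w. one_step f p (dataset (Z w) A) (dataset (Z w) B) (X w)) \<in> borel_measurable N"
proof -
  have fin: "finite A" "finite B" using AB by (auto intro: finite_subset)
  have "(\<lambda>w. one_step f p (dataset (subsample A (Z w)) {..<card A})
      (dataset (subsample B (Z w)) {..<card B}) (X w)) \<in> borel_measurable N"
    by (intro measurable_one_step[OF f] measurable_subsample[OF Z] fin AB X)
  then show ?thesis by (simp only: dataset_subsample[OF fin(1)] dataset_subsample[OF fin(2)])
qed

lemma measurable_candidate:
  assumes f: "measurable_procedure f"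
    and Z: "Z \<in> N \<rightarrow>\<^sub>M PiM T (\<lambda>_. obs_space p)" and X: "X \<in> N \<rightarrow>\<^sub>M feature_space p"
    and d: "finite T" "\<And>j. j \<in> {1..M} \<Longrightarrow> fst (d j) \<subseteq> T \<and> snd (d j) \<subseteq> T"
  shows "(\<lambda>w. candidate f p M (Z w) d (X w)) \<in> borel_measurable N"
  unfolding candidate_def
  by (intro borel_measurable_divide borel_measurable_sum borel_measurable_const
      measurable_one_step_dataset[OF f Z X d(1)]) (use d(2) in auto)

lemma measurable_loss:
  assumes l: "case_prod l \<in> borel_measurable (borel :: (real \<times> real) measure)"
    and Y: "Y \<in> borel_measurable N" and G: "G \<in> borel_measurable N"
  shows "(\<lambda>w. l (Y w) (G w) :: real) \<in> borel_measurable N"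
  using measurable_compose[OF borel_measurable_Pair[OF Y G] l] by simp

lemma measurable_loss_pair:
  assumes l: "case_prod l \<in> borel_measurable (borel :: (real \<times> real) measure)"
    and P: "sets P = sets (obs_space p)"
    and g: "(\<lambda>(w, x). g w x) \<in> borel_measurable (N \<Otimes>\<^sub>M feature_space p)"
  shows "(\<lambda>(w, x, y). l y (g w x) :: real) \<in> borel_measurable (N \<Otimes>\<^sub>M P)"
proof -
  have sets: "sets (N \<Otimes>\<^sub>M P) = sets (N \<Otimes>\<^sub>M (feature_space p \<Otimes>\<^sub>M borel))"
    using P unfolding obs_space_def by (intro sets_pair_measure_cong) auto
  have "(\<lambda>v. l (snd (snd v)) (g (fst v) (fst (snd v))))
      \<in> borel_measurable (N \<Otimes>\<^sub>M (feature_space p \<Otimes>\<^sub>M borel))"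
  proof (rule measurable_loss[OF l])
    show "(\<lambda>v. g (fst v) (fst (snd v))) \<in> borel_measurable (N \<Otimes>\<^sub>M (feature_space p \<Otimes>\<^sub>M borel))"
      using measurable_compose[of "\<lambda>v. (fst v, fst (snd v))" "N \<Otimes>\<^sub>M (feature_space p \<Otimes>\<^sub>M borel)"
          "N \<Otimes>\<^sub>M feature_space p", OF _ g]
      by simp
  qed simp
  then show ?thesis
    by (simp add: measurable_cong_sets[OF sets refl] case_prod_unfold)
qed

lemma measurable_loss_obs:
  assumes l: "case_prod l \<in> borel_measurable (borel :: (real \<times> real) measure)"
    and P: "sets P = sets (obs_space p)" and g: "g \<in> borel_measurable (feature_space p)"
  shows "(\<lambda>(x, y). l y (g x) :: real) \<in> borel_measurable P"
proof -
  have "(\<lambda>v. l (snd v) (g (fst v))) \<in> borel_measurable (feature_space p \<Otimes>\<^sub>M borel)"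
    by (rule measurable_loss[OF l]) (use g in simp_all)
  then show ?thesis
    using P by (simp add: measurable_cong_sets[OF P refl] obs_space_def case_prod_unfold)
qed

lemma measurable_risk:
  assumes l: "case_prod l \<in> borel_measurable (borel :: (real \<times> real) measure)"
    and P: "prob_space P" "sets P = sets (obs_space p)"
    and g: "(\<lambda>(w, x). g w x) \<in> borel_measurable (N \<Otimes>\<^sub>M feature_space p)"
  shows "(\<lambda>w. risk l P (g w)) \<in> borel_measurable N"
proof -
  interpret prob_space P by fact
  show ?thesis
    unfolding risk_def using measurable_loss_pair[OF l P(2) g]
    by (intro borel_measurable_nn_integral) (simp add: case_prod_unfold)
qed

lemma measurable_l2_norm:
  assumes l: "case_prod l \<in> borel_measurable (borel :: (real \<times> real) measure)"
    and P: "prob_space P" "sets P = sets (obs_space p)"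
    and g: "(\<lambda>(w, x). g w x) \<in> borel_measurable (N \<Otimes>\<^sub>M feature_space p)"
  shows "(\<lambda>w. l2_norm l P (g w)) \<in> borel_measurable N"
proof -
  interpret prob_space P by fact
  have "(\<lambda>w. \<integral>\<^sup>+(x, y). ennreal ((l y (g w x))\<^sup>2) \<partial>P) \<in> borel_measurable N"
    using measurable_loss_pair[OF l P(2) g]
    by (intro borel_measurable_nn_integral) (simp add: case_prod_unfold)
  then show ?thesis
    unfolding l2_norm_def Let_def by measurable
qed

text \<open>
The exponential moment decreases in \<open>C\<close>, so rational values of \<open>C\<close> suffice. Sublevel sets of the norm
are thereby countable unions.
\<close>

lemma psi1_norm_less_iff:
  assumes V: "(\<lambda>(x, y). l y (g x)) \<in> borel_measurable P"
  shows "psi1_norm l P g < c \<longleftrightarrow> (\<exists>q::rat. 0 < q \<and> ennreal (real_of_rat q) < c \<and>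
    (\<integral>\<^sup>+(x, y). ennreal (exp (\<bar>l y (g x)\<bar> / real_of_rat q)) \<partial>P) \<le> 2)" (is "_ \<longleftrightarrow> (\<exists>q. ?Q q)")
proof
  assume "psi1_norm l P g < c"
  then obtain C where C: "C > 0" "ennreal C < c"
    and le: "(\<integral>\<^sup>+(x, y). ennreal (exp (\<bar>l y (g x)\<bar> / C)) \<partial>P) \<le> 2"
    unfolding psi1_norm_def Inf_less_iff by auto
  from ennreal_rat_dense[OF C(2)] obtain q :: rat
    where q: "ennreal C < ennreal (real_of_rat q)" "ennreal (real_of_rat q) < c" by blast
  have Cq: "C < real_of_rat q" using q(1) C(1) by (simp add: ennreal_less_iff)
  then have q0: "0 < q" using C(1) by (metis less_trans zero_less_of_rat_iff)
  have "(\<integral>\<^sup>+(x, y). ennreal (exp (\<bar>l y (g x)\<bar> / real_of_rat q)) \<partial>P)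
      \<le> (\<integral>\<^sup>+(x, y). ennreal (exp (\<bar>l y (g x)\<bar> / C)) \<partial>P)"
    using C(1) Cq q0 by (intro nn_integral_mono) (auto intro!: divide_left_mono mult_pos_pos)
  then show "\<exists>q. ?Q q" using le q(2) q0 by (meson order.trans)
next
  assume "\<exists>q. ?Q q"
  then obtain q :: rat where "0 < q" "ennreal (real_of_rat q) < c"
    "(\<integral>\<^sup>+(x, y). ennreal (exp (\<bar>l y (g x)\<bar> / real_of_rat q)) \<partial>P) \<le> 2" by blast
  then show "psi1_norm l P g < c"
    unfolding psi1_norm_def Inf_less_iff
    by (intro bexI[of _ "ennreal (real_of_rat q)"]) auto
qed

lemma measurable_psi1_norm:
  assumes l: "case_prod l \<in> borel_measurable (borel :: (real \<times> real) measure)"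
    and P: "prob_space P" "sets P = sets (obs_space p)"
    and g: "(\<lambda>(w, x). g w x) \<in> borel_measurable (N \<Otimes>\<^sub>M feature_space p)"
  shows "(\<lambda>w. psi1_norm l P (g w)) \<in> borel_measurable N"
proof (rule borel_measurableI_less)
  interpret prob_space P by fact
  fix c :: ennreal
  define I where "I q w = (\<integral>\<^sup>+(x, y). ennreal (exp (\<bar>l y (g w x)\<bar> / real_of_rat q)) \<partial>P)" for q w
  have I [measurable]: "I q \<in> borel_measurable N" for q
    using measurable_loss_pair[OF l P(2) g] unfolding I_def
    by (intro borel_measurable_nn_integral) (simp add: case_prod_unfold)
  have sec: "(\<lambda>(x, y). l y (g w x)) \<in> borel_measurable P" if "w \<in> space N" for w
    using measurable_loss_pair[OF l P(2) g] that by (auto dest: measurable_Pair2)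
  have "{w \<in> space N. psi1_norm l P (g w) < c}
      = {w \<in> space N. \<exists>q::rat. 0 < q \<and> ennreal (real_of_rat q) < c \<and> I q w \<le> 2}"
    using psi1_norm_less_iff[OF sec] by (auto simp: I_def)
  also have "\<dots> \<in> sets N" by measurable
  finally show "{w \<in> space N. psi1_norm l P (g w) < c} \<in> sets N" .
qed

lemma measurable_loss_norm:
  assumes "case_prod l \<in> borel_measurable (borel :: (real \<times> real) measure)"
    and "prob_space P" "sets P = sets (obs_space p)"
    and "(\<lambda>(w, x). g w x) \<in> borel_measurable (N \<Otimes>\<^sub>M feature_space p)"
  shows "(\<lambda>w. loss_norm nrm l P (g w)) \<in> borel_measurable N"
  using measurable_psi1_norm[OF assms] measurable_l2_norm[OF assms] by (cases nrm) simp_all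

lemma sets_PiM_obs:
  assumes P: "sets P = sets (obs_space p)"
  shows "sets (PiM T (\<lambda>_. P)) = sets (PiM T (\<lambda>_. obs_space p))"
  using P by (intro sets_PiM_cong) auto

lemma measurable_candidate_pair:
  assumes f: "measurable_procedure f" and P: "sets P = sets (obs_space p)"
    and T: "finite T" "\<And>j. j \<in> {1..M} \<Longrightarrow> fst (d j) \<subseteq> T \<and> snd (d j) \<subseteq> T"
  shows "(\<lambda>(z, x). candidate f p M z d x) \<in> borel_measurable (PiM T (\<lambda>_. P) \<Otimes>\<^sub>M feature_space p)"
proof -
  have "fst \<in> PiM T (\<lambda>_. P) \<Otimes>\<^sub>M feature_space p \<rightarrow>\<^sub>M PiM T (\<lambda>_. obs_space p)"
    using measurable_fst[of "PiM T (\<lambda>_. P)" "feature_space p"] measurable_cong_sets[OF refl sets_PiM_obs[OF P]]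
    by auto
  from measurable_candidate[OF f this measurable_snd T] show ?thesis
    by (simp add: case_prod_unfold)
qed

lemma measurable_card_Collect:
  assumes "\<And>i. i < B \<Longrightarrow> {z \<in> space N. Q i z} \<in> sets N"
  shows "(\<lambda>z. card {i. i < (B::nat) \<and> Q i z}) \<in> N \<rightarrow>\<^sub>M count_space UNIV"
proof -
  have "(\<lambda>z. \<Sum>i<B. if Q i z then 1 else 0 :: nat) \<in> N \<rightarrow>\<^sub>M count_space UNIV"
    using assms by (intro measurable_sum_nat measurable_If) auto
  moreover have "(\<Sum>i<B. if Q i z then 1 else 0 :: nat) = card {i. i < B \<and> Q i z}" for z
    by (simp add: sum.If_cases Int_def)
  ultimately show ?thesis by (simp only:)
qed

text \<open>
Order statistics are determined by counting, which makes them, and hence medians, measurable.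
\<close>

lemma sort_nth_le_iff:
  assumes k: "k < length xs"
  shows "sort xs ! k \<le> a \<longleftrightarrow> k < card {i. i < length xs \<and> xs ! i \<le> (a :: 'a :: linorder)}"
proof -
  define ys where "ys = sort xs"
  have len: "length ys = length xs" by (simp add: ys_def)
  have mono: "i \<le> j \<Longrightarrow> j < length xs \<Longrightarrow> ys ! i \<le> ys ! j" for i j
    using len by (intro sorted_nth_mono) (auto simp: ys_def)
  have "card {i. i < length xs \<and> xs ! i \<le> a} = length (filter (\<lambda>x. x \<le> a) ys)"
    by (simp add: length_filter_conv_card ys_def filter_sort)
  also have "\<dots> = card {i. i < length xs \<and> ys ! i \<le> a}" by (simp add: length_filter_conv_card len)
  finally have card: "card {i. i < length xs \<and> xs ! i \<le> a} = card {i. i < length xs \<and> ys ! i \<le> a}" .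
  show ?thesis
    unfolding card ys_def[symmetric]
  proof
    assume "ys ! k \<le> a"
    then have "{..k} \<subseteq> {i. i < length xs \<and> ys ! i \<le> a}"
      using mono[OF _ k] k by (auto intro: order.trans)
    then have "card {..k} \<le> card {i. i < length xs \<and> ys ! i \<le> a}" by (intro card_mono) auto
    then show "k < card {i. i < length xs \<and> ys ! i \<le> a}" by simp
  next
    assume less: "k < card {i. i < length xs \<and> ys ! i \<le> a}"
    show "ys ! k \<le> a"
    proof (rule ccontr)
      assume "\<not> ys ! k \<le> a"
      then have "i < k" if "i < length xs" "ys ! i \<le> a" for i
        using mono[of k i] that by (meson not_le order.trans)
      then have "card {i. i < length xs \<and> ys ! i \<le> a} \<le> card {..<k}" by (intro card_mono) auto
      then show False using less by simp
    qed
  qed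
qed

lemma borel_measurable_median:
  assumes h: "\<And>i. i < B \<Longrightarrow> h i \<in> borel_measurable N"
  shows "(\<lambda>z. median (map (\<lambda>i. h i z) [0..<B])) \<in> borel_measurable N"
proof (cases "B = 0")
  case False
  have nth: "(\<lambda>z. sort (map (\<lambda>i. h i z) [0..<B]) ! k) \<in> borel_measurable N" if "k < B" for k
    unfolding borel_measurable_iff_le
  proof
    fix a
    have "{z \<in> space N. sort (map (\<lambda>i. h i z) [0..<B]) ! k \<le> a}
        = {z \<in> space N. k < card {i. i < B \<and> h i z \<le> a}}"
      using that by (auto simp: sort_nth_le_iff cong: conj_cong)
    also have "\<dots> \<in> sets N"
      using measurable_card_Collect[of B N "\<lambda>i z. h i z \<le> a"] h by measurable
    finally show "{z \<in> space N. sort (map (\<lambda>i. h i z) [0..<B]) ! k \<le> a} \<in> sets N" .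
  qed
  show ?thesis
    unfolding median_def using False
    by (auto intro!: borel_measurable_divide borel_measurable_add nth)
qed simp

lemma measurable_estimated_risk:
  assumes l: "case_prod l \<in> borel_measurable (borel :: (real \<times> real) measure)"
    and f: "measurable_procedure f" and P: "sets P = sets (obs_space p)"
    and T: "finite T" "\<And>j. j \<in> {1..M} \<Longrightarrow> fst (d j) \<subseteq> T \<and> snd (d j) \<subseteq> T"
    and I: "I \<subseteq> T" "cen = MOM \<Longrightarrow> batch_partition I B b"
  shows "(\<lambda>z. estimated_risk cen l I B b z (candidate f p M z d)) \<in> borel_measurable (PiM T (\<lambda>_. P))"
proof -
  let ?N = "PiM T (\<lambda>_. P)"
  have id: "(\<lambda>z. z) \<in> ?N \<rightarrow>\<^sub>M PiM T (\<lambda>_. obs_space p)"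
    by (rule measurable_ident_sets[OF sets_PiM_obs[OF P]])
  have loss: "(\<lambda>z. l (snd (z i)) (candidate f p M z d (fst (z i)))) \<in> borel_measurable ?N" if "i \<in> T" for i
  proof -
    have obs: "(\<lambda>z. z i) \<in> ?N \<rightarrow>\<^sub>M feature_space p \<Otimes>\<^sub>M borel"
      using measurable_compose[OF id measurable_component_singleton[OF that]] by (simp add: obs_space_def)
    show ?thesis
      by (intro measurable_loss[OF l] measurable_candidate[OF f id _ T] measurable_compose[OF obs] measurable_fst measurable_snd)
  qed
  have avg: "(\<lambda>z. average_loss l z (candidate f p M z d) J) \<in> borel_measurable ?N" if "J \<subseteq> T" for J
    unfolding average_loss_def using that
    by (intro borel_measurable_divide borel_measurable_sum borel_measurable_const loss) auto
  show ?thesis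
  proof (cases cen)
    case AVG
    then show ?thesis using avg[OF I(1)] by simp
  next
    case MOM
    then have "b i \<subseteq> T" if "i < B" for i using I that by (auto simp: batch_partition_def)
    then show ?thesis using MOM by (auto intro!: borel_measurable_median avg)
  qed
qed

section \<open>Concentration of averages and of medians of means\<close>

lemma indep_vars_PiM_coordinates:
  assumes P: "prob_space P" and ne: "I \<noteq> {}"
  shows "prob_space.indep_vars (PiM I (\<lambda>_. P)) (\<lambda>_. P) (\<lambda>i z. z i) I"
proof -
  interpret prob_space "PiM I (\<lambda>_. P)" by (rule prob_space_PiM) (rule P)
  have "distr (PiM I (\<lambda>_. P)) (PiM I (\<lambda>_. P)) (\<lambda>z. \<lambda>i\<in>I. z i) = PiM I (\<lambda>_. P)"
    using distr_PiM_reindex[of I "\<lambda>_. P" "\<lambda>i. i" I] P by simp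
  moreover have "PiM I (\<lambda>i. distr (PiM I (\<lambda>_. P)) P (\<lambda>z. z i)) = PiM I (\<lambda>_. P)"
    by (intro PiM_cong distr_PiM_component P refl)
  ultimately show ?thesis
    by (subst indep_vars_iff_distr_eq_PiM'[OF ne]) auto
qed

lemma (in prob_space) measure_all_le_power:
  assumes indep: "indep_vars M' X I" and S: "finite S" "S \<subseteq> I"
    and A: "\<And>i. i \<in> S \<Longrightarrow> A i \<in> sets (M' i)"
    and q: "\<And>i. i \<in> S \<Longrightarrow> prob {x \<in> space M. X i x \<in> A i} \<le> q"
  shows "prob {x \<in> space M. \<forall>i\<in>S. X i x \<in> A i} \<le> q ^ card S"
proof (cases "S = {}")
  case False
  have "{x \<in> space M. \<forall>i\<in>S. X i x \<in> A i} = (\<Inter>i\<in>S. X i -` A i \<inter> space M)"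
    using False by auto
  then have "prob {x \<in> space M. \<forall>i\<in>S. X i x \<in> A i} = (\<Prod>i\<in>S. prob (X i -` A i \<inter> space M))"
    using indep_varsD[OF indep False S A] by simp
  also have "\<dots> \<le> (\<Prod>i\<in>S. q)"
    using q by (intro prod_mono) (auto simp: vimage_def Collect_conj_eq Int_commute)
  finally show ?thesis by simp
qed (use prob_le_1 in simp)

text \<open>
If at least half of \<open>B\<close> events occur, then all events of some index set \<open>S\<close> with \<open>2 * card S \<ge> B\<close> do.
There are at most \<open>2 ^ B\<close> such sets, and by independence each contributes at most
\<open>q ^ card S \<le> sqrt q ^ B\<close>.
\<close>

lemma (in prob_space) measure_majority_le:
  assumes indep: "indep_vars M' X {..<B}"
    and A: "\<And>i. i < B \<Longrightarrow> A i \<in> sets (M' i)"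
    and q: "\<And>i. i < B \<Longrightarrow> prob {x \<in> space M. X i x \<in> A i} \<le> q" "0 \<le> q" "q \<le> 1"
  shows "prob {x \<in> space M. B \<le> 2 * card {i. i < B \<and> X i x \<in> A i}} \<le> (2 * sqrt q) ^ B"
proof -
  define F where "F = {S. S \<subseteq> {..<B} \<and> B \<le> 2 * card S}"
  define E where "E S = {x \<in> space M. \<forall>i\<in>S. X i x \<in> A i}" for S
  have finF: "finite F" by (rule finite_subset[of _ "Pow {..<B}"]) (auto simp: F_def)
  have rv: "X i \<in> M \<rightarrow>\<^sub>M M' i" if "i < B" for i
    using indep that by (auto simp: indep_vars_def)
  have E: "E S \<in> events" if "S \<in> F" for S
  proof -
    have "finite S" using that by (auto simp: F_def intro: finite_subset)
    moreover have "{x \<in> space M. X i x \<in> A i} \<in> events" if "i < B" for i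
      using measurable_sets[OF rv[OF that] A[OF that]] by (simp add: vimage_def Collect_conj_eq Int_commute)
    ultimately show ?thesis
      unfolding E_def using that by (intro sets.sets_Collect_finite_All) (auto simp: F_def)
  qed
  have "prob {x \<in> space M. B \<le> 2 * card {i. i < B \<and> X i x \<in> A i}} \<le> prob (\<Union>S\<in>F. E S)"
  proof (rule finite_measure_mono)
    show "{x \<in> space M. B \<le> 2 * card {i. i < B \<and> X i x \<in> A i}} \<subseteq> (\<Union>S\<in>F. E S)"
      by (auto simp: F_def E_def intro!: exI[of _ "{i. i < B \<and> X i _ \<in> A i}"])
    show "(\<Union>S\<in>F. E S) \<in> events" using finF E by (intro sets.finite_UN) auto
  qed
  also have "\<dots> \<le> (\<Sum>S\<in>F. prob (E S))"
    using finF E by (intro finite_measure_subadditive_finite) auto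
  also have "\<dots> \<le> (\<Sum>S\<in>F. sqrt q ^ B)"
  proof (rule sum_mono)
    fix S assume S: "S \<in> F"
    have "prob (E S) \<le> q ^ card S"
      unfolding E_def using S A q(1)
      by (intro measure_all_le_power[OF indep]) (auto simp: F_def intro: finite_subset)
    also have "q ^ card S = sqrt q ^ (2 * card S)" using q(2) by (simp add: power_mult)
    also have "\<dots> \<le> sqrt q ^ B" using S q by (intro power_decreasing) (auto simp: F_def)
    finally show "prob (E S) \<le> sqrt q ^ B" .
  qed
  also have "\<dots> = real (card F) * sqrt q ^ B" by simp
  also have "\<dots> \<le> 2 ^ B * sqrt q ^ B"
  proof -
    have "card F \<le> card (Pow {..<B})" by (intro card_mono) (auto simp: F_def)
    then have "real (card F) \<le> 2 ^ B" by (simp add: card_Pow)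
    then show ?thesis using q(2) by (intro mult_right_mono) auto
  qed
  finally show ?thesis by (simp add: power_mult_distrib)
qed

text \<open>
Markov's inequality for the exponential of the sum, whose expectation factorises.
\<close>

lemma measure_PiM_sum_ge_le:
  fixes W :: "'a \<Rightarrow> real"
  assumes P: "prob_space P" and I: "finite I"
    and W: "integrable P (\<lambda>v. exp (W v))" "(\<integral>v. exp (W v) \<partial>P) \<le> K"
  shows "\<P>(z in PiM I (\<lambda>_. P). a \<le> (\<Sum>i\<in>I. W (z i))) \<le> exp (- a) * K ^ card I"
proof -
  interpret P: prob_space P by fact
  interpret product_sigma_finite "\<lambda>_. P" by standard
  interpret M: prob_space "PiM I (\<lambda>_. P)" by (rule prob_space_PiM) (rule P)
  have int: "integrable (PiM I (\<lambda>_. P)) (\<lambda>z. \<Prod>i\<in>I. exp (W (z i)))"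
    by (rule product_integrable_prod[OF I]) (rule W(1))
  have "\<P>(z in PiM I (\<lambda>_. P). exp a \<le> (\<Prod>i\<in>I. exp (W (z i))))
      \<le> (\<integral>z. (\<Prod>i\<in>I. exp (W (z i))) \<partial>PiM I (\<lambda>_. P)) / exp a"
    by (rule integral_Markov_inequality_measure[OF int sets.empty_sets]) (auto intro!: prod_nonneg)
  also have "(\<integral>z. (\<Prod>i\<in>I. exp (W (z i))) \<partial>PiM I (\<lambda>_. P)) = (\<integral>v. exp (W v) \<partial>P) ^ card I"
    by (subst product_integral_prod[OF I]) (simp_all add: W(1))
  also have "\<dots> / exp a \<le> K ^ card I / exp a"
    by (intro divide_right_mono power_mono W(2)) (auto intro!: integral_nonneg_AE)
  finally show ?thesis
    by (simp add: exp_sum[OF I, symmetric] exp_minus divide_inverse mult.commute)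
qed

lemma exp_le_quadratic: "exp x \<le> 1 + x + x\<^sup>2 / 2 * exp \<bar>x\<bar>" for x :: real
proof -
  obtain t where t: "\<bar>t\<bar> \<le> \<bar>x\<bar>" "exp x = (\<Sum>m<2. x ^ m / fact m) + exp t / fact 2 * x ^ 2"
    using Maclaurin_exp_le[of x 2] by blast
  have "exp t * x\<^sup>2 \<le> exp \<bar>x\<bar> * x\<^sup>2" using t(1) by (intro mult_right_mono) auto
  then show ?thesis using t(2) by (simp add: numeral_2_eq_2 algebra_simps)
qed

lemma square_le_exp_half: "0 \<le> x \<Longrightarrow> x\<^sup>2 \<le> 16 * exp (x / 2)" for x :: real
proof -
  assume x: "0 \<le> x"
  have "x / 4 \<le> exp (x / 4)" using exp_ge_add_one_self[of "x / 4"] by linarith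
  then have "(x / 4)\<^sup>2 \<le> (exp (x / 4))\<^sup>2" using x by (intro power_mono) auto
  also have "(exp (x / 4))\<^sup>2 = exp (x / 2)" by (simp add: exp_double[symmetric])
  finally show ?thesis by (simp add: power_divide)
qed

text \<open>
The second-order remainder of \<open>exp (s * (U v - \<mu>))\<close> carries the factor \<open>exp (\<bar>s\<bar> * \<bar>U v - \<mu>\<bar>)\<close>. Since
\<open>\<bar>s\<bar> \<le> 1/2\<close> and \<open>\<bar>U v - \<mu>\<bar> \<le> U v + 1\<close>, and since \<open>x\<^sup>2\<close> is at most a constant times \<open>exp (x / 2)\<close>, the
remainder is at most a constant times \<open>s\<^sup>2 * exp (U v)\<close>, and \<open>exp (U v)\<close> has expectation at most \<open>2\<close>.
\<close>

lemma mgf_bound: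
  fixes U :: "'a \<Rightarrow> real"
  assumes P: "prob_space P" and U: "U \<in> borel_measurable P" "\<And>v. 0 \<le> U v"
    and two: "integrable P (\<lambda>v. exp (U v))" "(\<integral>v. exp (U v) \<partial>P) \<le> 2" and s: "\<bar>s\<bar> \<le> 1 / 2"
  shows "integrable P U" "0 \<le> (\<integral>v. U v \<partial>P)" "(\<integral>v. U v \<partial>P) \<le> 1"
    "integrable P (\<lambda>v. exp (s * (U v - (\<integral>v. U v \<partial>P))))"
    "(\<integral>v. exp (s * (U v - (\<integral>v. U v \<partial>P))) \<partial>P) \<le> exp (16 * exp 1 * s\<^sup>2)"
proof -
  interpret prob_space P by fact
  define \<mu> where "\<mu> = (\<integral>v. U v \<partial>P)"
  have le_exp: "1 + U v \<le> exp (U v)" for v by (rule exp_ge_add_one_self)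
  have le_exp': "norm (U v) \<le> norm (exp (U v))" for v
  proof -
    have "U v \<le> exp (U v)" using le_exp[of v] by linarith
    then show ?thesis using U(2)[of v] by simp
  qed
  show int: "integrable P U"
    by (rule Bochner_Integration.integrable_bound[OF two(1) U(1)]) (use le_exp' in simp)
  show "0 \<le> (\<integral>v. U v \<partial>P)" using U(2) by (intro integral_nonneg_AE) auto
  then have mu0: "0 \<le> \<mu>" by (simp add: \<mu>_def)
  have "(\<integral>v. 1 + U v \<partial>P) \<le> (\<integral>v. exp (U v) \<partial>P)"
    using int two(1) le_exp by (intro integral_mono) auto
  then show mu1: "(\<integral>v. U v \<partial>P) \<le> 1" using int two(2) by (simp add: prob_space)
  then have mu1: "\<mu> \<le> 1" by (simp add: \<mu>_def)
  have dom: "exp (s * (U v - \<mu>)) \<le> 1 + s * (U v - \<mu>) + 8 * exp 1 * s\<^sup>2 * exp (U v)" for v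
  proof -
    define W where "W = U v - \<mu>"
    have W: "\<bar>W\<bar> \<le> U v + 1" using U(2)[of v] mu0 mu1 by (auto simp: W_def)
    have "W\<^sup>2 \<le> (U v + 1)\<^sup>2" using W by (metis abs_ge_zero power2_abs power_mono)
    also have "\<dots> \<le> 16 * exp ((U v + 1) / 2)" using U(2)[of v] by (intro square_le_exp_half) simp
    finally have W2: "W\<^sup>2 \<le> 16 * exp ((U v + 1) / 2)" .
    have "\<bar>s * W\<bar> \<le> (1 / 2) * (U v + 1)"
      unfolding abs_mult using s W U(2)[of v] by (intro mult_mono) auto
    then have eW: "exp \<bar>s * W\<bar> \<le> exp ((U v + 1) / 2)" by simp
    have "W\<^sup>2 * exp \<bar>s * W\<bar> \<le> (16 * exp ((U v + 1) / 2)) * exp ((U v + 1) / 2)"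
      by (intro mult_mono W2 eW) auto
    also have "\<dots> = 16 * exp 1 * exp (U v)"
      by (simp add: exp_add[symmetric] mult.assoc)
    finally have "s\<^sup>2 / 2 * (W\<^sup>2 * exp \<bar>s * W\<bar>) \<le> s\<^sup>2 / 2 * (16 * exp 1 * exp (U v))"
      by (intro mult_left_mono) auto
    then show ?thesis
      using exp_le_quadratic[of "s * W"] by (simp add: W_def[symmetric] power_mult_distrib algebra_simps)
  qed
  have int_rhs: "integrable P (\<lambda>v. 1 + s * (U v - \<mu>) + 8 * exp 1 * s\<^sup>2 * exp (U v))"
    using int two(1) by auto
  have int_lhs: "integrable P (\<lambda>v. exp (s * (U v - \<mu>)))"
  proof (rule Bochner_Integration.integrable_bound[OF int_rhs])
    show "(\<lambda>v. exp (s * (U v - \<mu>))) \<in> borel_measurable P" using U(1) by measurable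
    have "norm (exp (s * (U v - \<mu>))) \<le> norm (1 + s * (U v - \<mu>) + 8 * exp 1 * s\<^sup>2 * exp (U v))" for v
      using dom[of v] by simp
    then show "AE v in P. norm (exp (s * (U v - \<mu>))) \<le> norm (1 + s * (U v - \<mu>) + 8 * exp 1 * s\<^sup>2 * exp (U v))"
      by simp
  qed
  then show "integrable P (\<lambda>v. exp (s * (U v - (\<integral>v. U v \<partial>P))))" by (simp add: \<mu>_def)
  have "(\<integral>v. exp (s * (U v - \<mu>)) \<partial>P) \<le> (\<integral>v. 1 + s * (U v - \<mu>) + 8 * exp 1 * s\<^sup>2 * exp (U v) \<partial>P)"
    by (intro integral_mono int_lhs int_rhs dom)
  also have "\<dots> = 1 + 8 * exp 1 * s\<^sup>2 * (\<integral>v. exp (U v) \<partial>P)"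
    using int two(1) by (simp add: prob_space \<mu>_def)
  also have "\<dots> \<le> 1 + 16 * exp 1 * s\<^sup>2"
  proof -
    have "8 * exp 1 * s\<^sup>2 * (\<integral>v. exp (U v) \<partial>P) \<le> 8 * exp 1 * s\<^sup>2 * 2"
      by (intro mult_left_mono two(2)) auto
    then show ?thesis by simp
  qed
  also have "\<dots> \<le> exp (16 * exp 1 * s\<^sup>2)" by (rule exp_ge_add_one_self)
  finally show "(\<integral>v. exp (s * (U v - (\<integral>v. U v \<partial>P))) \<partial>P) \<le> exp (16 * exp 1 * s\<^sup>2)"
    by (simp add: \<mu>_def)
qed

text \<open>
Chernoff's bound for both tails, with \<open>s = t / (32 * exp 1)\<close> minimising
\<open>16 * exp 1 * s\<^sup>2 - s * t\<close>.
\<close>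

lemma average_concentration_psi1:
  fixes V :: "'a \<Rightarrow> real"
  assumes P: "prob_space P" and I: "finite I" "I \<noteq> {}"
    and V: "V \<in> borel_measurable P" "\<And>v. 0 \<le> V v" and C: "0 < C"
    and two: "(\<integral>\<^sup>+v. ennreal (exp (V v / C)) \<partial>P) \<le> 2" and t: "0 < t" "t \<le> 1"
  shows "\<P>(z in PiM I (\<lambda>_. P). t * C < \<bar>(\<Sum>i\<in>I. V (z i)) / real (card I) - (\<integral>v. V v \<partial>P)\<bar>)
    \<le> 2 * exp (- real (card I) * t\<^sup>2 / (64 * exp 1))"
proof -
  interpret P: prob_space P by fact
  define N where "N = PiM I (\<lambda>_. P)"
  interpret N: prob_space N unfolding N_def by (rule prob_space_PiM) (rule P)
  define U where "U v = V v / C" for v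
  define \<mu> where "\<mu> = (\<integral>v. U v \<partial>P)"
  define m where "m = real (card I)"
  define s where "s = t / (32 * exp 1)"
  have U: "U \<in> borel_measurable P" "\<And>v. 0 \<le> U v"
    using V C unfolding U_def by auto
  have two': "(\<integral>\<^sup>+v. ennreal (exp (U v)) \<partial>P) \<le> 2" using two by (simp add: U_def)
  then have intU: "integrable P (\<lambda>v. exp (U v))"
    using U by (intro integrableI_nonneg) (auto intro: le_less_trans)
  have "ennreal (\<integral>v. exp (U v) \<partial>P) \<le> ennreal 2"
    using two' nn_integral_eq_integral[OF intU] by simp
  then have le2: "(\<integral>v. exp (U v) \<partial>P) \<le> 2" by (subst (asm) ennreal_le_iff) auto
  have m: "0 < m" using I by (simp add: m_def card_gt_0_iff)
  have e1: "1 \<le> exp (1::real)" by simp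
  have s: "0 < s" "s \<le> 1 / 2"
  proof -
    show "0 < s" using t by (simp add: s_def)
    have "t \<le> 16 * exp 1" using t e1 by linarith
    then show "s \<le> 1 / 2" by (simp add: s_def field_simps)
  qed
  have opt: "exp (- (s * t * m)) * exp (16 * exp 1 * s\<^sup>2) ^ card I = exp (- m * t\<^sup>2 / (64 * exp 1))"
  proof -
    have "- (s * t * m) + m * (16 * exp 1 * s\<^sup>2) = - m * t\<^sup>2 / (64 * exp 1)"
      by (simp add: s_def power2_eq_square field_simps)
    then show ?thesis
      by (simp add: exp_of_nat_mult[symmetric] exp_add[symmetric] m_def)
  qed
  have tail: "N.prob {z \<in> space N. s * t * m \<le> (\<Sum>i\<in>I. \<sigma> * s * (U (z i) - \<mu>))} \<le> exp (- m * t\<^sup>2 / (64 * exp 1))"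
    if "\<bar>\<sigma>\<bar> = 1" for \<sigma>
  proof -
    have "\<bar>\<sigma> * s\<bar> \<le> 1 / 2" using that s by (simp add: abs_mult)
    note mgf = mgf_bound[OF P U intU le2 this]
    have sq: "(\<sigma> * s)\<^sup>2 = s\<^sup>2" using that by (metis abs_mult_self_eq mult_1 power2_eq_square power_mult_distrib)
    show ?thesis
      using measure_PiM_sum_ge_le[OF P I(1) mgf(4,5), of "s * t * m"] opt
      unfolding sq N_def[symmetric] \<mu>_def[symmetric] by simp
  qed
  have meas: "{z \<in> space N. s * t * m \<le> (\<Sum>i\<in>I. \<sigma> * s * (U (z i) - \<mu>))} \<in> N.events" for \<sigma>
  proof -
    have "(\<lambda>z. U (z i)) \<in> borel_measurable N" if "i \<in> I" for i
      unfolding N_def using measurable_compose[OF measurable_component_singleton[OF that] U(1)] by simp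
    then have "(\<lambda>z. \<Sum>i\<in>I. \<sigma> * s * (U (z i) - \<mu>)) \<in> borel_measurable N"
      by (intro borel_measurable_sum borel_measurable_times borel_measurable_diff) auto
    then show ?thesis by (intro borel_measurable_le) auto
  qed
  have "{z \<in> space N. t * C < \<bar>(\<Sum>i\<in>I. V (z i)) / real (card I) - (\<integral>v. V v \<partial>P)\<bar>}
      \<subseteq> {z \<in> space N. s * t * m \<le> (\<Sum>i\<in>I. 1 * s * (U (z i) - \<mu>))}
        \<union> {z \<in> space N. s * t * m \<le> (\<Sum>i\<in>I. (- 1) * s * (U (z i) - \<mu>))}"
  proof
    fix z assume "z \<in> {z \<in> space N. t * C < \<bar>(\<Sum>i\<in>I. V (z i)) / real (card I) - (\<integral>v. V v \<partial>P)\<bar>}"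
    then have z: "z \<in> space N" and dev: "t * C < \<bar>(\<Sum>i\<in>I. V (z i)) / m - (\<integral>v. V v \<partial>P)\<bar>"
      by (auto simp: m_def)
    define D where "D = (\<Sum>i\<in>I. U (z i) - \<mu>)"
    have "(\<Sum>i\<in>I. V (z i)) / m - (\<integral>v. V v \<partial>P) = C / m * D"
      using m C by (simp add: D_def U_def \<mu>_def sum_subtractf sum_divide_distrib[symmetric] m_def field_simps)
    then have "t * C < C / m * \<bar>D\<bar>" using dev m C by (simp add: abs_mult)
    then have "t * m < \<bar>D\<bar>" using m C by (simp add: field_simps)
    then have "s * (t * m) \<le> s * \<bar>D\<bar>" using s by (intro mult_left_mono) auto
    then have "s * t * m \<le> s * D \<or> s * t * m \<le> (- s) * D" by (auto simp: abs_if mult.assoc split: if_splits)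
    then show "z \<in> {z \<in> space N. s * t * m \<le> (\<Sum>i\<in>I. 1 * s * (U (z i) - \<mu>))}
        \<union> {z \<in> space N. s * t * m \<le> (\<Sum>i\<in>I. (- 1) * s * (U (z i) - \<mu>))}"
      using z by (auto simp: D_def sum_distrib_left sum_negf)
  qed
  then have "N.prob {z \<in> space N. t * C < \<bar>(\<Sum>i\<in>I. V (z i)) / real (card I) - (\<integral>v. V v \<partial>P)\<bar>}
      \<le> N.prob ({z \<in> space N. s * t * m \<le> (\<Sum>i\<in>I. 1 * s * (U (z i) - \<mu>))}
        \<union> {z \<in> space N. s * t * m \<le> (\<Sum>i\<in>I. (- 1) * s * (U (z i) - \<mu>))})"
    by (intro N.finite_measure_mono sets.Un meas)
  also have "\<dots> \<le> exp (- m * t\<^sup>2 / (64 * exp 1)) + exp (- m * t\<^sup>2 / (64 * exp 1))"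
    using tail[of 1] tail[of "- 1"] measure_Un_le[OF meas[of 1] meas[of "- 1"]]
    by linarith
  finally show ?thesis unfolding N_def m_def by simp
qed

text \<open>
Chebyshev's inequality. The functions \<open>g i j k\<close> write the product of two centred coordinates as
a product over all coordinates, so that the expectation of every mixed term factorises.
\<close>

lemma average_concentration_l2:
  fixes V :: "'a \<Rightarrow> real"
  assumes P: "prob_space P" and I: "finite I" "I \<noteq> {}"
    and V: "V \<in> borel_measurable P" and C: "0 < C"
    and sq: "integrable P (\<lambda>v. (V v)\<^sup>2)" "(\<integral>v. (V v)\<^sup>2 \<partial>P) \<le> C\<^sup>2" and t: "0 < t"
  shows "\<P>(z in PiM I (\<lambda>_. P). t * C < \<bar>(\<Sum>i\<in>I. V (z i)) / real (card I) - (\<integral>v. V v \<partial>P)\<bar>)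
    \<le> 1 / (t\<^sup>2 * real (card I))"
proof -
  interpret P: prob_space P by fact
  interpret product_sigma_finite "\<lambda>_. P" by standard
  define N where "N = PiM I (\<lambda>_. P)"
  interpret N: prob_space N unfolding N_def by (rule prob_space_PiM) (rule P)
  define \<mu> where "\<mu> = (\<integral>v. V v \<partial>P)"
  define m where "m = real (card I)"
  have m: "0 < m" using I by (simp add: m_def card_gt_0_iff)
  have intV: "integrable P V" using P.square_integrable_imp_integrable[OF V sq(1)] .
  define W where "W v = V v - \<mu>" for v
  have W: "integrable P W" "(\<integral>v. W v \<partial>P) = 0"
    using intV unfolding W_def by (auto simp: \<mu>_def P.prob_space)
  have W2eq: "(W v)\<^sup>2 = (V v)\<^sup>2 - 2 * \<mu> * V v + \<mu>\<^sup>2" for v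
    by (simp add: W_def power2_diff)
  have W2: "integrable P (\<lambda>v. (W v)\<^sup>2)" using sq(1) intV unfolding W2eq by auto
  have "(\<integral>v. (W v)\<^sup>2 \<partial>P) = (\<integral>v. (V v)\<^sup>2 \<partial>P) - \<mu>\<^sup>2"
    unfolding W2eq using sq(1) intV by (simp add: \<mu>_def[symmetric] P.prob_space power2_eq_square)
  then have W2le: "(\<integral>v. (W v)\<^sup>2 \<partial>P) \<le> C\<^sup>2" using sq(2) by (smt (verit) zero_le_power2)
  define g where "g i j k v = (if k = i then W v else 1) * (if k = j then W v else 1)" for i j k :: 'b and v
  have gint: "integrable P (g i j k)" for i j k
    unfolding g_def[abs_def] using W(1) W2
    by (cases "k = i"; cases "k = j") (auto simp: power2_eq_square)
  have gprod: "W (z i) * W (z j) = (\<Prod>k\<in>I. g i j k (z k))" if "i \<in> I" "j \<in> I" for i j z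
    using that I(1) by (simp add: g_def prod.distrib prod.delta)
  have int: "integrable N (\<lambda>z. W (z i) * W (z j))" if "i \<in> I" "j \<in> I" for i j
    unfolding gprod[OF that] N_def by (rule product_integrable_prod[OF I(1) gint])
  have cov: "(\<integral>z. W (z i) * W (z j) \<partial>N) = (if i = j then (\<integral>v. (W v)\<^sup>2 \<partial>P) else 0)"
    if "i \<in> I" "j \<in> I" for i j
  proof -
    have "(\<integral>z. W (z i) * W (z j) \<partial>N) = (\<Prod>k\<in>I. \<integral>v. g i j k v \<partial>P)"
      unfolding gprod[OF that] N_def by (rule product_integral_prod[OF I(1) gint])
    also have "\<dots> = (if i = j then (\<integral>v. (W v)\<^sup>2 \<partial>P) else 0)"
    proof (cases "i = j")
      case True
      then have "(\<Prod>k\<in>I. \<integral>v. g i j k v \<partial>P) = (\<Prod>k\<in>I. if k = i then (\<integral>v. (W v)\<^sup>2 \<partial>P) else 1)"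
        by (intro prod.cong) (auto simp: g_def power2_eq_square P.prob_space)
      then show ?thesis using True that I(1) by simp
    next
      case False
      then have "(\<integral>v. g i j i v \<partial>P) = 0" using W(2) by (simp add: g_def)
      then show ?thesis using False that I(1) by (auto intro!: prod_zero)
    qed
    finally show ?thesis .
  qed
  define D where "D z = (\<Sum>i\<in>I. W (z i))" for z
  have D2: "(D z)\<^sup>2 = (\<Sum>i\<in>I. \<Sum>j\<in>I. W (z i) * W (z j))" for z
    by (simp add: D_def power2_eq_square sum_product)
  have Dint: "integrable N (\<lambda>z. (D z)\<^sup>2)" unfolding D2 using int by auto
  have "(\<integral>z. (D z)\<^sup>2 \<partial>N) = (\<Sum>i\<in>I. \<Sum>j\<in>I. if i = j then (\<integral>v. (W v)\<^sup>2 \<partial>P) else 0)"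
    unfolding D2 using int cov by simp
  also have "\<dots> = m * (\<integral>v. (W v)\<^sup>2 \<partial>P)" using I(1) by (simp add: m_def)
  finally have ED: "(\<integral>z. (D z)\<^sup>2 \<partial>N) \<le> m * C\<^sup>2" using W2le m by simp
  have Dm: "(\<lambda>z. (D z)\<^sup>2) \<in> borel_measurable N" using Dint by auto
  have "{z \<in> space N. t * C < \<bar>(\<Sum>i\<in>I. V (z i)) / real (card I) - (\<integral>v. V v \<partial>P)\<bar>}
      \<subseteq> {z \<in> space N. (t * C * m)\<^sup>2 \<le> (D z)\<^sup>2}"
  proof (safe)
    fix z assume dev: "t * C < \<bar>(\<Sum>i\<in>I. V (z i)) / real (card I) - (\<integral>v. V v \<partial>P)\<bar>"
    have eq: "(\<Sum>i\<in>I. V (z i)) / real (card I) - (\<integral>v. V v \<partial>P) = D z / m"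
      using m by (simp add: D_def W_def \<mu>_def sum_subtractf m_def field_simps)
    have "t * C < \<bar>D z\<bar> / m" using dev m unfolding eq by simp
    then have "t * C * m < \<bar>D z\<bar>" using m by (simp add: field_simps)
    moreover have "0 \<le> t * C * m" using t C m by simp
    ultimately show "(t * C * m)\<^sup>2 \<le> (D z)\<^sup>2"
      by (metis less_imp_le power2_abs power_mono)
  qed
  then have "N.prob {z \<in> space N. t * C < \<bar>(\<Sum>i\<in>I. V (z i)) / real (card I) - (\<integral>v. V v \<partial>P)\<bar>}
      \<le> N.prob {z \<in> space N. (t * C * m)\<^sup>2 \<le> (D z)\<^sup>2}"
    using Dm by (intro N.finite_measure_mono) auto
  also have "\<dots> \<le> (\<integral>z. (D z)\<^sup>2 \<partial>N) / (t * C * m)\<^sup>2"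
    using t C m by (intro integral_Markov_inequality_measure[OF Dint sets.empty_sets]) auto
  also have "\<dots> \<le> m * C\<^sup>2 / (t * C * m)\<^sup>2" by (intro divide_right_mono ED) auto
  also have "\<dots> = 1 / (t\<^sup>2 * m)" using t C m by (simp add: power2_eq_square field_simps)
  finally show ?thesis unfolding N_def m_def .
qed

text \<open>
If a middle order statistic exceeds \<open>\<mu> + d\<close>, so do all later ones, which are at least half of the
entries; the lower side is symmetric. The median is the mean of the two middle order statistics.
\<close>

lemma median_near_if_majority_near:
  assumes "\<not> length xs \<le> 2 * card {i. i < length xs \<and> d < \<bar>xs ! i - \<mu>\<bar>}"
  shows "\<bar>median xs - \<mu>\<bar> \<le> d"
proof -
  define B where "B = length xs"
  define far where "far = {i. i < B \<and> d < \<bar>xs ! i - \<mu>\<bar>}"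
  have few: "2 * card far < B" using assms by (simp add: far_def B_def)
  then have B: "0 < B" by simp
  have "card ({..<B} - far) = B - card far"
    by (subst card_Diff_subset) (auto simp: far_def)
  moreover have "card ({..<B} - far) \<le> card {i. i < B \<and> xs ! i \<le> \<mu> + d}"
    by (intro card_mono) (auto simp: far_def)
  ultimately have "B div 2 < card {i. i < B \<and> xs ! i \<le> \<mu> + d}" using few by linarith
  then have upper: "sort xs ! (B div 2) \<le> \<mu> + d"
    using sort_nth_le_iff[of "B div 2" xs "\<mu> + d"] B by (simp add: B_def)
  have lower: "\<mu> - d \<le> sort xs ! ((B - 1) div 2)"
  proof (rule ccontr)
    define a where "a = sort xs ! ((B - 1) div 2)"
    assume "\<not> \<mu> - d \<le> sort xs ! ((B - 1) div 2)"
    then have "card {i. i < B \<and> xs ! i \<le> a} \<le> card far"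
      by (intro card_mono) (auto simp: far_def a_def)
    moreover have "(B - 1) div 2 < card {i. i < B \<and> xs ! i \<le> a}"
    proof -
      have "(B - 1) div 2 < length xs" using B unfolding B_def by linarith
      from sort_nth_le_iff[OF this, of a] show ?thesis by (simp add: B_def a_def)
    qed
    ultimately show False using few by linarith
  qed
  have "sort xs ! ((B - 1) div 2) \<le> sort xs ! (B div 2)"
    using B by (intro sorted_nth_mono) (auto simp: B_def)
  then show ?thesis
    using upper lower by (auto simp: median_def B_def[symmetric] abs_le_iff field_simps)
qed

text \<open>
A median of means is far from the mean only if at least half of the batch averages are. These are
independent, and each is far from the mean with probability at most \<open>1 / (t\<^sup>2 * k)\<close>.
\<close>

lemma median_of_means_concentration:
  fixes V :: "'a \<Rightarrow> real"
  assumes P: "prob_space P" and I: "finite I" "I \<noteq> {}"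
    and b: "\<And>i. i < B \<Longrightarrow> b i \<subseteq> I" "disjoint_family_on b {..<B}"
      "\<And>i. i < B \<Longrightarrow> real (card (b i)) \<ge> k" "0 < k"
    and V: "V \<in> borel_measurable P" and C: "0 < C"
    and sq: "integrable P (\<lambda>v. (V v)\<^sup>2)" "(\<integral>v. (V v)\<^sup>2 \<partial>P) \<le> C\<^sup>2"
    and t: "0 < t" "1 \<le> t\<^sup>2 * k"
  shows "\<P>(z in PiM I (\<lambda>_. P). t * C < \<bar>median (map (\<lambda>i. (\<Sum>j\<in>b i. V (z j)) / real (card (b i))) [0..<B]) - (\<integral>v. V v \<partial>P)\<bar>)
    \<le> (2 * sqrt (1 / (t\<^sup>2 * k))) ^ B"
proof -
  define N where "N = PiM I (\<lambda>_. P)"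
  interpret P: prob_space P by fact
  interpret N: prob_space N unfolding N_def by (rule prob_space_PiM) (rule P)
  define A where "A i = {y \<in> space (PiM (b i) (\<lambda>_. P)).
    t * C < \<bar>(\<Sum>j\<in>b i. V (y j)) / real (card (b i)) - (\<integral>v. V v \<partial>P)\<bar>}" for i
  have bne: "b i \<noteq> {}" and bfin: "finite (b i)" if "i < B" for i
    using b(3)[OF that] b(4) finite_subset[OF b(1)[OF that] I(1)] by auto
  have A: "A i \<in> sets (PiM (b i) (\<lambda>_. P))" if "i < B" for i
  proof -
    have "(\<lambda>y. V (y j)) \<in> borel_measurable (PiM (b i) (\<lambda>_. P))" if "j \<in> b i" for j
      using measurable_compose[OF measurable_component_singleton[OF that] V] by simp
    then have "(\<lambda>y. \<bar>(\<Sum>j\<in>b i. V (y j)) / real (card (b i)) - (\<integral>v. V v \<partial>P)\<bar>)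
        \<in> borel_measurable (PiM (b i) (\<lambda>_. P))"
      by (intro borel_measurable_abs borel_measurable_diff borel_measurable_divide borel_measurable_sum) auto
    then show ?thesis unfolding A_def by (intro borel_measurable_less) auto
  qed
  have indep: "N.indep_vars (\<lambda>i. PiM (b i) (\<lambda>_. P)) (\<lambda>i z. restrict z (b i)) {..<B}"
    using N.indep_vars_restrict[OF indep_vars_PiM_coordinates[OF P I(2), folded N_def], of "{..<B}" b] b
    by auto
  have bad: "N.prob {z \<in> space N. restrict z (b i) \<in> A i} \<le> 1 / (t\<^sup>2 * k)" if i: "i < B" for i
  proof -
    have dist: "distr N (PiM (b i) (\<lambda>_. P)) (\<lambda>z. restrict z (b i)) = PiM (b i) (\<lambda>_. P)"
      unfolding N_def using distr_PiM_reindex[of I "\<lambda>_. P" "\<lambda>i. i" "b i"] P b(1)[OF i] by auto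
    have rm: "(\<lambda>z. restrict z (b i)) \<in> N \<rightarrow>\<^sub>M PiM (b i) (\<lambda>_. P)"
      unfolding N_def by (rule measurable_restrict_subset) (rule b(1)[OF i])
    have "N.prob {z \<in> space N. restrict z (b i) \<in> A i}
        = measure (distr N (PiM (b i) (\<lambda>_. P)) (\<lambda>z. restrict z (b i))) (A i)"
      by (subst measure_distr[OF rm A[OF i]]) (auto intro!: arg_cong[of _ _ N.prob])
    also have "\<dots> \<le> 1 / (t\<^sup>2 * real (card (b i)))"
      unfolding dist A_def
      by (rule average_concentration_l2[OF P bfin[OF i] bne[OF i] V C sq t(1)])
    also have "\<dots> \<le> 1 / (t\<^sup>2 * k)"
      using t(1) b(3)[OF i] b(4) by (intro divide_left_mono mult_left_mono mult_pos_pos) auto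
    finally show ?thesis .
  qed
  have rm: "(\<lambda>z. restrict z (b i)) \<in> N \<rightarrow>\<^sub>M PiM (b i) (\<lambda>_. P)" if "i < B" for i
    unfolding N_def by (rule measurable_restrict_subset) (rule b(1)[OF that])
  have maj: "N.prob {z \<in> space N. B \<le> 2 * card {i. i < B \<and> restrict z (b i) \<in> A i}}
      \<le> (2 * sqrt (1 / (t\<^sup>2 * k))) ^ B"
    using t b(4) by (intro N.measure_majority_le[OF indep A bad]) (auto simp: divide_le_eq_1)
  have "{z \<in> space N. t * C < \<bar>median (map (\<lambda>i. (\<Sum>j\<in>b i. V (z j)) / real (card (b i))) [0..<B]) - (\<integral>v. V v \<partial>P)\<bar>}
    \<subseteq> {z \<in> space N. B \<le> 2 * card {i. i < B \<and> restrict z (b i) \<in> A i}}"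
  proof (intro subsetI CollectI conjI)
    fix z assume "z \<in> {z \<in> space N. t * C < \<bar>median (map (\<lambda>i. (\<Sum>j\<in>b i. V (z j)) / real (card (b i))) [0..<B]) - (\<integral>v. V v \<partial>P)\<bar>}"
    then have z: "z \<in> space N"
      and dev: "\<not> \<bar>median (map (\<lambda>i. (\<Sum>j\<in>b i. V (z j)) / real (card (b i))) [0..<B]) - (\<integral>v. V v \<partial>P)\<bar> \<le> t * C"
      by auto
    show "z \<in> space N" by fact
    have "restrict z (b i) \<in> A i \<longleftrightarrow>
        t * C < \<bar>(\<Sum>j\<in>b i. V (z j)) / real (card (b i)) - (\<integral>v. V v \<partial>P)\<bar>" if "i < B" for i
      using measurable_space[OF rm[OF that] z] by (simp add: A_def)
    then have "{i. i < B \<and> restrict z (b i) \<in> A i} = {i. i < B \<and>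
        t * C < \<bar>(\<Sum>j\<in>b i. V (z j)) / real (card (b i)) - (\<integral>v. V v \<partial>P)\<bar>}"
      by auto
    then show "B \<le> 2 * card {i. i < B \<and> restrict z (b i) \<in> A i}"
      using median_near_if_majority_near[of "map (\<lambda>i. (\<Sum>j\<in>b i. V (z j)) / real (card (b i))) [0..<B]"
          "t * C" "\<integral>v. V v \<partial>P"] dev by (auto cong: conj_cong)
  qed
  moreover have "{z \<in> space N. B \<le> 2 * card {i. i < B \<and> restrict z (b i) \<in> A i}} \<in> N.events"
  proof -
    have "{z \<in> space N. restrict z (b i) \<in> A i} \<in> N.events" if "i < B" for i
      using measurable_sets[OF rm[OF that] A[OF that]] by (simp add: vimage_def Collect_conj_eq Int_commute)
    from measurable_card_Collect[of B N "\<lambda>i z. restrict z (b i) \<in> A i", OF this]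
    show ?thesis by measurable
  qed
  ultimately show ?thesis
    unfolding N_def[symmetric] by (rule order.trans[OF N.finite_measure_mono maj])
qed

section \<open>Laws of disjoint subsamples and of seeds\<close>

lemma prob_space_data_law: "prob_space P \<Longrightarrow> prob_space (data_law P k)"
  unfolding data_law_def by (rule prob_space_PiM)

lemma distr_subsample:
  assumes P: "prob_space P" and A: "A \<subseteq> {..<n}"
  shows "distr (data_law P n) (data_law P (card A)) (subsample A) = data_law P (card A)"
proof -
  have fin: "finite A" using A by (rule finite_subset) simp
  have "inj_on (\<lambda>i. sorted_list_of_set A ! i) {..<card A}"
    by (rule inj_onI) (use fin in \<open>simp add: nth_eq_iff_index_eq\<close>)
  moreover have "(\<lambda>i. sorted_list_of_set A ! i) \<in> {..<card A} \<rightarrow> {..<n}"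
    using sorted_list_of_set_nth_mem[OF fin] A by auto
  ultimately show ?thesis
    using distr_PiM_reindex[of "{..<n}" "\<lambda>_. P" "\<lambda>i. sorted_list_of_set A ! i" "{..<card A}"] P
    by (simp add: data_law_def subsample_def[abs_def])
qed

text \<open>
Restrictions of independent coordinates to disjoint index sets are independent, and renumbering
i.i.d. coordinates does not change their law.
\<close>

lemma distr_subsample_pair:
  assumes P: "prob_space P" and A: "A \<subseteq> {..<n}" and B: "B \<subseteq> {..<n}" and disj: "A \<inter> B = {}"
    and ne: "A \<noteq> {}"
  shows "distr (data_law P n) (data_law P (card A) \<Otimes>\<^sub>M data_law P (card B))
      (\<lambda>z. (subsample A z, subsample B z)) = data_law P (card A) \<Otimes>\<^sub>M data_law P (card B)"
proof -
  interpret N: prob_space "data_law P n" using P by (rule prob_space_data_law)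
  have fin: "finite A" "finite B" using A B by (auto intro: finite_subset)
  define F where "F C y = (\<lambda>i\<in>{..<card C}. (y :: nat \<Rightarrow> observation) (sorted_list_of_set C ! i))" for C y
  have F: "F C \<in> PiM C (\<lambda>_. P) \<rightarrow>\<^sub>M data_law P (card C)" if "finite C" for C
    using measurable_subsample[of "\<lambda>y. y" "PiM C (\<lambda>_. P)" C P C] that
    by (simp add: F_def[abs_def] subsample_def[abs_def] data_law_def)
  have sub: "subsample C = F C \<circ> (\<lambda>z. \<lambda>i\<in>C. z i)" if "finite C" for C
    using sorted_list_of_set_nth_mem[OF that] by (auto simp: subsample_def F_def fun_eq_iff)
  have "N.indep_var (data_law P (card A)) (subsample A) (data_law P (card B)) (subsample B)"
  proof -
    have "{..<n} \<noteq> {}" using A ne by auto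
    note ind = N.indep_var_restrict[OF indep_vars_PiM_coordinates[OF P this, folded data_law_def] disj A B]
    show ?thesis
      unfolding sub[OF fin(1)] sub[OF fin(2)]
      by (rule N.indep_var_compose[OF ind F[OF fin(1)] F[OF fin(2)]])
  qed
  then show ?thesis
    unfolding N.indep_var_distribution_eq distr_subsample[OF P A] distr_subsample[OF P B] by simp
qed

lemma measure_disjoint_subsamples:
  assumes P: "prob_space P" and A: "A \<subseteq> {..<n}" and B: "B \<subseteq> {..<n}" and disj: "A \<inter> B = {}"
    and ne: "A \<noteq> {}" and S: "S \<in> sets (data_law P (card A) \<Otimes>\<^sub>M data_law P (card B))"
  shows "\<P>(z in data_law P n. (subsample A z, subsample B z) \<in> S)
    = measure (data_law P (card A) \<Otimes>\<^sub>M data_law P (card B)) S"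
proof -
  have fin: "finite A" "finite B" using A B by (auto intro: finite_subset)
  have sub: "subsample C \<in> data_law P n \<rightarrow>\<^sub>M data_law P (card C)" if "finite C" "C \<subseteq> {..<n}" for C
    using measurable_subsample[of "\<lambda>y. y" "data_law P n" "{..<n}" P C] that by (simp add: data_law_def)
  have m: "(\<lambda>z. (subsample A z, subsample B z)) \<in> data_law P n \<rightarrow>\<^sub>M
      data_law P (card A) \<Otimes>\<^sub>M data_law P (card B)"
    by (intro measurable_Pair sub fin A B)
  show ?thesis
    by (subst distr_subsample_pair[OF P A B disj ne, symmetric], subst measure_distr[OF m S])
      (auto intro!: arg_cong[of _ _ "measure _"])
qed

text \<open>
Fubini for the splitting of the data into a training and a test part: a bound for the test part that
is uniform in the training part is a bound for the whole.
\<close>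

lemma measure_PiM_split_le:
  assumes P: "prob_space P" and fin: "finite T" "finite I" and disj: "T \<inter> I = {}"
    and le: "\<And>x. x \<in> space (PiM T (\<lambda>_. P)) \<Longrightarrow>
      \<P>(y in PiM I (\<lambda>_. P). merge T I (x, y) \<in> S) \<le> \<beta>" and \<beta>: "0 \<le> \<beta>"
  shows "measure (PiM (T \<union> I) (\<lambda>_. P)) S \<le> \<beta>"
proof (cases "S \<in> sets (PiM (T \<union> I) (\<lambda>_. P))")
  case True
  interpret P: prob_space P by fact
  interpret product_sigma_finite "\<lambda>_. P" by standard
  interpret I: prob_space "PiM I (\<lambda>_. P)" by (rule prob_space_PiM) (rule P)
  interpret T: prob_space "PiM T (\<lambda>_. P)" by (rule prob_space_PiM) (rule P)
  interpret TI: prob_space "PiM (T \<union> I) (\<lambda>_. P)" by (rule prob_space_PiM) (rule P)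
  have "emeasure (PiM (T \<union> I) (\<lambda>_. P)) S = (\<integral>\<^sup>+z. indicator S z \<partial>PiM (T \<union> I) (\<lambda>_. P))"
    using True by simp
  also have "\<dots> = (\<integral>\<^sup>+x. \<integral>\<^sup>+y. indicator S (merge T I (x, y)) \<partial>PiM I (\<lambda>_. P) \<partial>PiM T (\<lambda>_. P))"
    using True by (intro product_nn_integral_fold disj fin) auto
  also have "\<dots> \<le> (\<integral>\<^sup>+x. ennreal \<beta> \<partial>PiM T (\<lambda>_. P))"
  proof (rule nn_integral_mono)
    fix x assume x: "x \<in> space (PiM T (\<lambda>_. P))"
    have ev: "{y \<in> space (PiM I (\<lambda>_. P)). merge T I (x, y) \<in> S} \<in> sets (PiM I (\<lambda>_. P))"
    proof -
      have "(\<lambda>y. merge T I (x, y)) \<in> PiM I (\<lambda>_. P) \<rightarrow>\<^sub>M PiM (T \<union> I) (\<lambda>_. P)"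
        by (intro measurable_compose[OF _ measurable_merge] measurable_Pair1' x)
      from measurable_sets[OF this True] show ?thesis
        by (simp add: vimage_def Collect_conj_eq Int_commute)
    qed
    have "(\<integral>\<^sup>+y. indicator S (merge T I (x, y)) \<partial>PiM I (\<lambda>_. P))
        = (\<integral>\<^sup>+y. indicator {y \<in> space (PiM I (\<lambda>_. P)). merge T I (x, y) \<in> S} y \<partial>PiM I (\<lambda>_. P))"
      by (intro nn_integral_cong) (auto simp: indicator_def)
    also have "\<dots> \<le> ennreal \<beta>"
      using ev le[OF x] by (simp add: I.emeasure_eq_measure ennreal_leI)
    finally show "(\<integral>\<^sup>+y. indicator S (merge T I (x, y)) \<partial>PiM I (\<lambda>_. P)) \<le> ennreal \<beta>" .
  qed
  also have "\<dots> = ennreal \<beta>" by (simp add: T.emeasure_space_1)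
  finally show ?thesis using \<beta> by (simp add: TI.emeasure_eq_measure)
qed (simp add: measure_notin_sets \<beta>)

lemma measurable_seeded:
  fixes Q :: "'u::countable pmf"
  assumes "\<And>u. (\<lambda>z. h (z, u)) \<in> N \<rightarrow>\<^sub>M K"
  shows "h \<in> N \<Otimes>\<^sub>M measure_pmf Q \<rightarrow>\<^sub>M K"
proof -
  have snd: "snd \<in> N \<Otimes>\<^sub>M measure_pmf Q \<rightarrow>\<^sub>M count_space UNIV"
    using measurable_snd[of N "measure_pmf Q"] by simp
  have "(\<lambda>w. h (fst w, snd w)) \<in> N \<Otimes>\<^sub>M measure_pmf Q \<rightarrow>\<^sub>M K"
    by (rule measurable_compose_countable'[OF _ snd, where f = "\<lambda>u w. h (fst w, u)"])
      (auto intro: measurable_compose[OF measurable_fst assms])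
  then show ?thesis by simp
qed

text \<open>
Fubini: a bound that holds for every value of the seed survives integration over the seed.
\<close>

lemma measure_seeded_le:
  assumes N: "prob_space N"
    and le: "\<And>u. \<P>(z in N. (z, u) \<in> S) \<le> \<beta>"
  shows "measure (N \<Otimes>\<^sub>M measure_pmf Q) S \<le> \<beta>"
proof (cases "S \<in> sets (N \<Otimes>\<^sub>M measure_pmf Q)")
  case True
  interpret N: prob_space N by fact
  interpret pair_prob_space N "measure_pmf Q" by standard
  have \<beta>: "0 \<le> \<beta>" using le[of undefined] measure_nonneg order.trans by blast
  have "emeasure (N \<Otimes>\<^sub>M measure_pmf Q) S = (\<integral>\<^sup>+u. emeasure N ((\<lambda>z. (z, u)) -` S) \<partial>measure_pmf Q)"
    by (rule emeasure_pair_measure_alt2[OF True])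
  also have "\<dots> \<le> (\<integral>\<^sup>+u. ennreal \<beta> \<partial>measure_pmf Q)"
  proof (rule nn_integral_mono)
    fix u
    have "(\<lambda>z. (z, u)) -` S = {z \<in> space N. (z, u) \<in> S}"
      using sets.sets_into_space[OF True] by (auto simp: space_pair_measure)
    then show "emeasure N ((\<lambda>z. (z, u)) -` S) \<le> ennreal \<beta>"
      using le[of u] by (simp add: N.emeasure_eq_measure ennreal_leI)
  qed
  also have "\<dots> = ennreal \<beta>" by simp
  finally show ?thesis using \<beta> by (simp add: emeasure_eq_measure)
next
  case False
  then show ?thesis using le[of undefined] measure_nonneg[of N]
    by (metis measure_notin_sets order.trans)
qed

lemma measurable_risk_one_step_pair:
  assumes l: "case_prod l \<in> borel_measurable (borel :: (real \<times> real) measure)"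
    and P: "prob_space P" "sets P = sets (obs_space p)"
    and f: "measurable_procedure f"
  shows "(\<lambda>(z1, z2). risk l P (one_step f p (dataset z1 {..<k1}) (dataset z2 {..<k2})))
    \<in> borel_measurable (data_law P k1 \<Otimes>\<^sub>M data_law P k2)"
proof -
  have d: "sets (data_law P k) = sets (PiM {..<k} (\<lambda>_. obs_space p))" for k
    unfolding data_law_def by (rule sets_PiM_obs[OF P(2)])
  let ?N = "data_law P k1 \<Otimes>\<^sub>M data_law P k2"
  have z1: "(\<lambda>v. fst (fst v)) \<in> ?N \<Otimes>\<^sub>M feature_space p \<rightarrow>\<^sub>M PiM {..<k1} (\<lambda>_. obs_space p)"
    and z2: "(\<lambda>v. snd (fst v)) \<in> ?N \<Otimes>\<^sub>M feature_space p \<rightarrow>\<^sub>M PiM {..<k2} (\<lambda>_. obs_space p)"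
    unfolding measurable_cong_sets[OF refl d, symmetric] by measurable
  have "(\<lambda>(w, x). one_step f p (dataset (fst w) {..<k1}) (dataset (snd w) {..<k2}) x)
      \<in> borel_measurable (?N \<Otimes>\<^sub>M feature_space p)"
    using measurable_one_step[OF f z1 z2 measurable_snd] by (simp add: case_prod_unfold)
  from measurable_risk[OF l P this] show ?thesis by (simp add: case_prod_unfold)
qed

text \<open>
This transfers the convergence of risks for two independent datasets to datasets drawn from disjoint
parts of one sample.
\<close>

lemma measure_risk_one_step_subsamples:
  assumes l: "case_prod l \<in> borel_measurable (borel :: (real \<times> real) measure)"
    and P: "prob_space P" "sets P = sets (obs_space p)"
    and f: "measurable_procedure f"
    and A: "A \<subseteq> {..<n}" and B: "B \<subseteq> {..<n}" and disj: "A \<inter> B = {}" and ne: "A \<noteq> {}"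
  shows "\<P>(z in data_law P n. \<not> risk l P (one_step f p (dataset z A) (dataset z B)) < c)
    = measure (data_law P (card A) \<Otimes>\<^sub>M data_law P (card B))
      {w \<in> space (data_law P (card A) \<Otimes>\<^sub>M data_law P (card B)).
        (case w of (z1, z2) \<Rightarrow> risk l P (one_step f p (dataset z1 {..<card A}) (dataset z2 {..<card B}))) \<notin> {..<c}}"
    (is "_ = measure ?N ?S")
proof -
  have fin: "finite A" "finite B" using A B by (auto intro: finite_subset)
  have S: "?S \<in> sets ?N"
    using measurable_risk_one_step_pair[OF l P f, of "card A" "card B"] by measurable
  have mem: "(subsample A z, subsample B z) \<in> space ?N" if "z \<in> space (data_law P n)" for z
  proof -
    have "subsample C \<in> data_law P n \<rightarrow>\<^sub>M data_law P (card C)" if "finite C" "C \<subseteq> {..<n}" for C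
      using measurable_subsample[of "\<lambda>y. y" "data_law P n" "{..<n}" P C] that by (simp add: data_law_def)
    from measurable_space[OF this that] show ?thesis using fin A B by (simp add: space_pair_measure)
  qed
  have "{z \<in> space (data_law P n). \<not> risk l P (one_step f p (dataset z A) (dataset z B)) < c}
      = {z \<in> space (data_law P n). (subsample A z, subsample B z) \<in> ?S}"
    using mem by (auto simp: dataset_subsample[OF fin(1)] dataset_subsample[OF fin(2)])
  then show ?thesis using measure_disjoint_subsamples[OF P(1) A B disj ne S] by simp
qed

section \<open>Concentration of the estimated risk\<close>

lemma psi1_norm_less_exp_moment:
  assumes V: "(\<lambda>(x, y). l y (g x)) \<in> borel_measurable P" and l0: "\<And>y t. 0 \<le> l y t"
    and C: "0 < C" and less: "psi1_norm l P g < ennreal C"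
  shows "(\<integral>\<^sup>+(x, y). ennreal (exp (l y (g x) / C)) \<partial>P) \<le> 2"
proof -
  obtain C' where C': "0 < C'" "ennreal C' < ennreal C"
    "(\<integral>\<^sup>+(x, y). ennreal (exp (\<bar>l y (g x)\<bar> / C')) \<partial>P) \<le> 2"
    using less unfolding psi1_norm_def Inf_less_iff by auto
  then have "C' \<le> C" by (simp add: ennreal_less_iff)
  then have "(\<integral>\<^sup>+(x, y). ennreal (exp (l y (g x) / C)) \<partial>P)
      \<le> (\<integral>\<^sup>+(x, y). ennreal (exp (\<bar>l y (g x)\<bar> / C')) \<partial>P)"
    using C C'(1) l0 by (intro nn_integral_mono) (auto intro!: frac_le simp: abs_of_nonneg)
  with C'(3) show ?thesis by (rule order.trans[rotated])
qed

text \<open>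
Medians of means need a second moment only. For the exponential norm it comes from
\<open>1 + x\<^sup>2 / 2 \<le> exp x\<close>; the factor \<open>2\<close> covers that case.
\<close>

lemma loss_norm_less_second_moment:
  fixes l :: "real \<Rightarrow> real \<Rightarrow> real"
  assumes P: "prob_space P"
    and V: "(\<lambda>(x, y). l y (g x)) \<in> borel_measurable P" and l0: "\<And>y t. 0 \<le> l y t"
    and C: "0 < C" and less: "loss_norm nrm l P g < ennreal C"
  shows "(\<integral>\<^sup>+(x, y). ennreal ((l y (g x))\<^sup>2) \<partial>P) \<le> ennreal (2 * C\<^sup>2)"
proof (cases nrm)
  case L2
  define I where "I = (\<integral>\<^sup>+(x, y). ennreal ((l y (g x))\<^sup>2) \<partial>P)"
  have "I \<noteq> \<infinity>" "sqrt (enn2real I) < C"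
    using less L2 C by (auto simp: l2_norm_def I_def[symmetric] Let_def ennreal_less_iff split: if_splits)
  then have "enn2real I \<le> C\<^sup>2"
    using C real_less_rsqrt real_sqrt_less_iff by (metis enn2real_nonneg less_imp_le real_sqrt_le_iff real_sqrt_pow2 real_sqrt_abs abs_of_pos)
  then have "I \<le> ennreal (C\<^sup>2)"
    using \<open>I \<noteq> \<infinity>\<close> by (cases I rule: ennreal_cases) (auto simp: ennreal_leI)
  also have "\<dots> \<le> ennreal (2 * C\<^sup>2)" by (intro ennreal_leI) simp
  finally show ?thesis by (simp add: I_def)
next
  case PSI1
  interpret prob_space P by fact
  have two: "(\<integral>\<^sup>+(x, y). ennreal (exp (l y (g x) / C)) \<partial>P) \<le> 2"
    using less PSI1 by (intro psi1_norm_less_exp_moment[OF V l0 C]) auto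
  have "(\<integral>\<^sup>+(x, y). ennreal (1 + (l y (g x))\<^sup>2 / (2 * C\<^sup>2)) \<partial>P)
      \<le> (\<integral>\<^sup>+(x, y). ennreal (exp (l y (g x) / C)) \<partial>P)"
  proof (intro nn_integral_mono, clarify, intro ennreal_leI)
    fix x y
    have "0 \<le> l y (g x) / C" using l0 C by simp
    from exp_lower_Taylor_quadratic[OF this] this
    show "1 + (l y (g x))\<^sup>2 / (2 * C\<^sup>2) \<le> exp (l y (g x) / C)"
      by (simp add: power_divide mult.commute)
  qed
  also note two
  also have "(\<integral>\<^sup>+(x, y). ennreal (1 + (l y (g x))\<^sup>2 / (2 * C\<^sup>2)) \<partial>P)
      = 1 + ennreal (1 / (2 * C\<^sup>2)) * (\<integral>\<^sup>+(x, y). ennreal ((l y (g x))\<^sup>2) \<partial>P)"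
  proof -
    have eq: "ennreal (1 + (l y t)\<^sup>2 / (2 * C\<^sup>2)) = 1 + ennreal (1 / (2 * C\<^sup>2)) * ennreal ((l y t)\<^sup>2)" for y t
      by (subst ennreal_plus) (auto simp: ennreal_mult[symmetric])
    show ?thesis
      using V unfolding case_prod_unfold eq
      by (subst nn_integral_add) (auto simp: nn_integral_cmult emeasure_space_1)
  qed
  finally have "1 + ennreal (1 / (2 * C\<^sup>2)) * (\<integral>\<^sup>+(x, y). ennreal ((l y (g x))\<^sup>2) \<partial>P) \<le> 1 + 1" by simp
  then have le1: "ennreal (1 / (2 * C\<^sup>2)) * (\<integral>\<^sup>+(x, y). ennreal ((l y (g x))\<^sup>2) \<partial>P) \<le> 1"
    by (subst (asm) ennreal_add_left_cancel_le) auto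
  have "(\<integral>\<^sup>+(x, y). ennreal ((l y (g x))\<^sup>2) \<partial>P)
      = ennreal (2 * C\<^sup>2) * (ennreal (1 / (2 * C\<^sup>2)) * (\<integral>\<^sup>+(x, y). ennreal ((l y (g x))\<^sup>2) \<partial>P))"
    using C by (simp add: mult.assoc[symmetric] ennreal_mult[symmetric])
  also have "\<dots> \<le> ennreal (2 * C\<^sup>2) * 1" by (intro mult_left_mono le1) simp
  finally show ?thesis by simp
qed

lemma loss_norm_less_moments:
  fixes l :: "real \<Rightarrow> real \<Rightarrow> real"
  assumes P: "prob_space P"
    and V: "(\<lambda>(x, y). l y (g x)) \<in> borel_measurable P" and l0: "\<And>y t. 0 \<le> l y t"
    and C: "0 < C" and less: "loss_norm nrm l P g < ennreal C"
  shows "integrable P (\<lambda>v. (l (snd v) (g (fst v)))\<^sup>2)" "(\<integral>v. (l (snd v) (g (fst v)))\<^sup>2 \<partial>P) \<le> 2 * C\<^sup>2"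
    "risk l P g = ennreal (\<integral>v. l (snd v) (g (fst v)) \<partial>P)" "0 \<le> (\<integral>v. l (snd v) (g (fst v)) \<partial>P)"
proof -
  interpret prob_space P by fact
  define W where "W v = l (snd v) (g (fst v))" for v
  have W: "W \<in> borel_measurable P" "\<And>v. 0 \<le> W v"
    using V l0 by (simp_all add: W_def[abs_def] case_prod_unfold)
  have le: "(\<integral>\<^sup>+v. ennreal ((W v)\<^sup>2) \<partial>P) \<le> ennreal (2 * C\<^sup>2)"
    using loss_norm_less_second_moment[OF assms] by (simp add: W_def case_prod_unfold)
  have int2: "integrable P (\<lambda>v. (W v)\<^sup>2)"
    using W le by (intro integrableI_nonneg) (auto intro: le_less_trans)
  then show "integrable P (\<lambda>v. (l (snd v) (g (fst v)))\<^sup>2)" by (simp add: W_def)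
  have "ennreal (\<integral>v. (W v)\<^sup>2 \<partial>P) \<le> ennreal (2 * C\<^sup>2)"
    using le nn_integral_eq_integral[OF int2] by simp
  then show "(\<integral>v. (l (snd v) (g (fst v)))\<^sup>2 \<partial>P) \<le> 2 * C\<^sup>2"
    by (subst (asm) ennreal_le_iff) (auto simp: W_def)
  have int: "integrable P W" using square_integrable_imp_integrable[OF W(1) int2] .
  have "risk l P g = ennreal (\<integral>v. W v \<partial>P)"
    using nn_integral_eq_integral[OF int] W(2) by (simp add: risk_def W_def[abs_def] case_prod_unfold)
  then show "risk l P g = ennreal (\<integral>v. l (snd v) (g (fst v)) \<partial>P)" by (simp add: W_def)
  show "0 \<le> (\<integral>v. l (snd v) (g (fst v)) \<partial>P)" using l0 by (intro integral_nonneg_AE) auto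
qed

lemma AVG_concentration:
  fixes l :: "real \<Rightarrow> real \<Rightarrow> real"
  assumes P: "prob_space P"
    and V: "(\<lambda>(x, y). l y (g x)) \<in> borel_measurable P" and l0: "\<And>y t. 0 \<le> l y t"
    and C: "0 < C" and less: "loss_norm PSI1 l P g < ennreal C"
    and I: "finite I" "I \<noteq> {}" and t: "0 < t" "t \<le> 1"
  shows "\<P>(z in PiM I (\<lambda>_. P). t * C < \<bar>estimated_risk AVG l I B b z g - enn2real (risk l P g)\<bar>)
    \<le> 2 * exp (- real (card I) * (t\<^sup>2 / (64 * exp 1)))"
proof -
  have two: "(\<integral>\<^sup>+v. ennreal (exp (l (snd v) (g (fst v)) / C)) \<partial>P) \<le> 2"
    using psi1_norm_less_exp_moment[OF V l0 C] less by (simp add: case_prod_unfold)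
  have W: "(\<lambda>v. l (snd v) (g (fst v))) \<in> borel_measurable P" using V by (simp add: case_prod_unfold)
  show ?thesis
    using average_concentration_psi1[OF P I W l0 C two t] loss_norm_less_moments(3,4)[OF P V l0 C less]
    by (simp add: average_loss_def)
qed

lemma batch_size_ge:
  assumes b: "batch_partition I B b" and I: "finite I" and i: "i < B"
  shows "real (card I) / real B - 1 \<le> real (card (b i))"
proof -
  have Un: "(\<Union>j<B. b j) = I" and disj: "disjoint_family_on b {..<B}"
    and eq: "\<forall>i<B. \<forall>j<B. card (b i) \<le> card (b j) + 1" using b by (auto simp: batch_partition_def)
  have "finite (b j)" if "j < B" for j using Un I that by (auto intro: finite_subset)
  then have "card I = (\<Sum>j<B. card (b j))"
    unfolding Un[symmetric] using disj by (intro card_UN_disjoint) (auto simp: disjoint_family_on_def)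
  also have "\<dots> \<le> (\<Sum>j<B. card (b i) + 1)" using eq i by (intro sum_mono) auto
  finally have "card I \<le> B * (card (b i) + 1)" by simp
  then have "real (card I) \<le> real B * (real (card (b i)) + 1)"
    by (metis of_nat_1 of_nat_add of_nat_le_iff of_nat_mult)
  then show ?thesis using i by (simp add: field_simps)
qed

text \<open>
The second moment is at most \<open>2 * C\<^sup>2 \<le> (2 * C)\<^sup>2\<close>, so the bound for medians of means is used with \<open>2 * C\<close>
in place of \<open>C\<close> and \<open>t / 2\<close> in place of \<open>t\<close>.
\<close>

lemma MOM_concentration:
  fixes l :: "real \<Rightarrow> real \<Rightarrow> real"
  assumes P: "prob_space P"
    and V: "(\<lambda>(x, y). l y (g x)) \<in> borel_measurable P" and l0: "\<And>y t. 0 \<le> l y t"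
    and C: "0 < C" and less: "loss_norm nrm l P g < ennreal C"
    and I: "finite I" "I \<noteq> {}" and b: "batch_partition I B b"
    and k: "k = real (card I) / real B - 1" "0 < k" and t: "0 < t" "4 \<le> t\<^sup>2 * k"
  shows "\<P>(z in PiM I (\<lambda>_. P). t * C < \<bar>estimated_risk MOM l I B b z g - enn2real (risk l P g)\<bar>)
    \<le> (2 * sqrt (4 / (t\<^sup>2 * k))) ^ B"
proof -
  have W: "(\<lambda>v. l (snd v) (g (fst v))) \<in> borel_measurable P" using V by (simp add: case_prod_unfold)
  have sub: "b i \<subseteq> I" if "i < B" for i using b that by (auto simp: batch_partition_def)
  have disj: "disjoint_family_on b {..<B}" using b by (auto simp: batch_partition_def)
  have size: "real (card (b i)) \<ge> k" if "i < B" for i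
    unfolding k(1) by (rule batch_size_ge[OF b I(1) that])
  note mom = loss_norm_less_moments[OF P V l0 C less]
  have sq: "(\<integral>v. (l (snd v) (g (fst v)))\<^sup>2 \<partial>P) \<le> (2 * C)\<^sup>2"
    using mom(2) by (rule order.trans) (simp add: power_mult_distrib)
  have t2: "0 < t / 2" "1 \<le> (t / 2)\<^sup>2 * k" and C2: "0 < 2 * C" using t C by (auto simp: power_divide)
  have "1 / ((t / 2)\<^sup>2 * k) = 4 / (t\<^sup>2 * k)" by (simp add: power_divide)
  moreover have "t / 2 * (2 * C) = t * C" by simp
  moreover have "estimated_risk MOM l I B b z g
      = median (map (\<lambda>i. (\<Sum>j\<in>b i. l (snd (z j)) (g (fst (z j)))) / real (card (b i))) [0..<B])" for z
    by (simp add: average_loss_def)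
  moreover have "enn2real (risk l P g) = (\<integral>v. l (snd v) (g (fst v)) \<partial>P)" using mom(3,4) by simp
  ultimately show ?thesis
    using median_of_means_concentration[OF P I sub disj size k(2) W C2 mom(1) sq t2] by simp
qed

lemma norm_bound_additive:
  fixes l :: "real \<Rightarrow> real \<Rightarrow> real"
  assumes P: "prob_space P" and V: "(\<lambda>(x, y). l y (g x)) \<in> borel_measurable P"
    and l0: "\<And>y t. 0 \<le> l y t"
    and K: "0 \<le> K" "loss_norm nrm l P g \<le> ennreal K"
  shows "loss_norm nrm l P g < ennreal ((K + 1) * (1 + enn2real (risk l P g)))" "risk l P g < \<infinity>"
proof -
  have "ennreal K < ennreal (K + 1)" using K(1) by (simp add: ennreal_less_iff)
  then have less: "loss_norm nrm l P g < ennreal (K + 1)" using K(2) by (rule le_less_trans[rotated])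
  also have "\<dots> \<le> ennreal ((K + 1) * (1 + enn2real (risk l P g)))"
    using K(1) by (intro ennreal_leI) (simp add: distrib_left)
  finally show "loss_norm nrm l P g < ennreal ((K + 1) * (1 + enn2real (risk l P g)))" .
  have "0 < K + 1" using K(1) by simp
  from loss_norm_less_moments(3)[OF P V l0 this less] show "risk l P g < \<infinity>"
    by (simp add: less_top[symmetric] infinity_ennreal_def)
qed

text \<open>
A bounded ratio makes the norm finite by the convention on \<open>\<infinity> / \<infinity>\<close>, and with it the risk. If the risk
vanishes, so does the norm, since a positive number divided by \<open>0\<close> is \<open>\<infinity>\<close>.
\<close>

lemma norm_bound_multiplicative:
  fixes l :: "real \<Rightarrow> real \<Rightarrow> real"
  assumes P: "prob_space P" and V: "(\<lambda>(x, y). l y (g x)) \<in> borel_measurable P"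
    and l0: "\<And>y t. 0 \<le> l y t"
    and K: "0 \<le> K" "norm_risk_ratio (loss_norm nrm l P g) (risk l P g) \<le> ennreal K"
  shows "loss_norm nrm l P g < ennreal ((K + 1) * (1 + enn2real (risk l P g)))" "risk l P g < \<infinity>"
proof -
  define N R where "N = loss_norm nrm l P g" and "R = risk l P g"
  have N: "N \<noteq> \<infinity>" using K(2) by (auto simp: norm_risk_ratio_def N_def top_unique infinity_ennreal_def split: if_splits)
  then obtain a where a: "N = ennreal a" "0 \<le> a" by (cases N rule: ennreal_cases) (auto simp: infinity_ennreal_def)
  from norm_bound_additive(2)[OF P V l0 a(2), of nrm] a(1) show R: "risk l P g < \<infinity>" by (simp add: N_def)
  then obtain r where r: "R = ennreal r" "0 \<le> r" unfolding R_def
    by (cases "risk l P g" rule: ennreal_cases) (auto simp: infinity_ennreal_def)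
  have ratio: "N / R \<le> ennreal K" using K(2) N by (simp add: norm_risk_ratio_def N_def R_def)
  have "a \<le> K * r"
  proof (cases "r = 0")
    case True
    then have "N / 0 \<le> ennreal K" using ratio r by simp
    then have "N = 0" by (cases "N = 0") (auto simp: divide_ennreal_def ennreal_mult_top top_unique)
    then show ?thesis using a True by simp
  next
    case False
    then have "ennreal (a / r) \<le> ennreal K" using ratio a r by (simp add: divide_ennreal)
    then have "a / r \<le> K" using K(1) by simp
    then show ?thesis using False r by (simp add: field_simps)
  qed
  also have "K * r < (K + 1) * (1 + r)" using K(1) r(2) by (simp add: algebra_simps add_pos_nonneg)
  finally show "loss_norm nrm l P g < ennreal ((K + 1) * (1 + enn2real (risk l P g)))"
    using a r by (simp add: N_def[symmetric] R_def[symmetric] ennreal_less_iff)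
qed

lemma measure_PiM_test_le:
  fixes l :: "real \<Rightarrow> real \<Rightarrow> real"
  assumes P: "prob_space P" and V: "(\<lambda>(x, y). l y (g x)) \<in> borel_measurable P"
    and l0: "\<And>y t. 0 \<le> l y t" and C: "0 < C" and less: "loss_norm nrm l P g < ennreal C"
    and I: "finite I" "I \<noteq> {}" and t: "0 < t" "t \<le> 1"
    and nrm: "cen = AVG \<Longrightarrow> nrm = PSI1" and batch: "cen = MOM \<Longrightarrow> batch_partition I B b"
    and k: "cen = MOM \<Longrightarrow> 4 \<le> t\<^sup>2 * (real (card I) / real B - 1)"
  shows "\<P>(y in PiM I (\<lambda>_. P). t * C < \<bar>estimated_risk cen l I B b y g - enn2real (risk l P g)\<bar>)
    \<le> (case cen of AVG \<Rightarrow> 2 * exp (- real (card I) * (t\<^sup>2 / (64 * exp 1)))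
        | MOM \<Rightarrow> (2 * sqrt (4 / (t\<^sup>2 * (real (card I) / real B - 1)))) ^ B)"
proof (cases cen)
  case AVG
  then show ?thesis using AVG_concentration[OF P V l0 C _ I t, of B b] less nrm by simp
next
  case MOM
  have "0 < t\<^sup>2 * (real (card I) / real B - 1)" using k[OF MOM] by simp
  then have "0 < real (card I) / real B - 1" using t(1) by (simp add: zero_less_mult_iff)
  from MOM_concentration[OF P V l0 C less I batch[OF MOM] refl this t(1) k[OF MOM]] MOM
  show ?thesis by simp
qed

lemma estimated_risk_cong:
  assumes "\<And>i. i \<in> I \<Longrightarrow> z i = z' i" "cen = MOM \<Longrightarrow> batch_partition I B b"
  shows "estimated_risk cen l I B b z g = estimated_risk cen l I B b z' g"
proof (cases cen)
  case AVG
  then show ?thesis using assms(1) by (simp add: average_loss_def)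
next
  case MOM
  then have sub: "b i \<subseteq> I" if "i < B" for i using assms(2) that by (auto simp: batch_partition_def)
  have "average_loss l z g (b i) = average_loss l z' g (b i)" if "i < B" for i
    using assms(1) sub[OF that] by (auto simp: average_loss_def intro!: sum.cong arg_cong2[of _ _ _ _ "(/)"])
  then show ?thesis using MOM by (auto intro!: arg_cong[of _ _ median])
qed

text \<open>
The failure that the union bound has to exclude. The scale \<open>K * (1 + risk)\<close> is the common form of the
bounds on the norm in the additive and in the multiplicative case. Where the norm is not below this
scale nothing is claimed, so that the bound holds for every value of the training data.
\<close>

definition deviates ::
  "(real \<Rightarrow> real \<Rightarrow> real) \<Rightarrow> observation measure \<Rightarrow> norm_choice \<Rightarrow> real \<Rightarrow> real \<Rightarrow> (features \<Rightarrow> real) \<Rightarrow> real \<Rightarrow> bool" where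
  "deviates l P nrm K t g r \<longleftrightarrow> (let C = K * (1 + enn2real (risk l P g)) in
     loss_norm nrm l P g < ennreal C \<and> t * C < \<bar>r - enn2real (risk l P g)\<bar>)"

text \<open>
Once the training data are fixed the candidate is a fixed predictor, to which the bound for fixed
predictors applies; the estimated risk reads the test data only.
\<close>

lemma measure_candidate_deviates_le:
  assumes l: "case_prod l \<in> borel_measurable (borel :: (real \<times> real) measure)"
    and P: "prob_space P" "sets P = sets (obs_space p)"
    and f: "measurable_procedure f"
    and T: "T \<subseteq> {..<n}" "\<And>j. j \<in> {1..M} \<Longrightarrow> fst (d j) \<subseteq> T \<and> snd (d j) \<subseteq> T"
    and batch: "cen = MOM \<Longrightarrow> batch_partition ({..<n} - T) B b" and K: "0 < K" and \<beta>: "0 \<le> \<beta>"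
    and conc: "\<And>g C. (\<lambda>(x, y). l y (g x)) \<in> borel_measurable P \<Longrightarrow> 0 < C \<Longrightarrow>
      loss_norm nrm l P g < ennreal C \<Longrightarrow>
      \<P>(y in PiM ({..<n} - T) (\<lambda>_. P). t * C < \<bar>estimated_risk cen l ({..<n} - T) B b y g - enn2real (risk l P g)\<bar>) \<le> \<beta>"
  shows "\<P>(z in data_law P n. deviates l P nrm K t (candidate f p M z d)
      (estimated_risk cen l ({..<n} - T) B b z (candidate f p M z d))) \<le> \<beta>"
proof -
  define I where "I = {..<n} - T"
  have fin: "finite T" "finite I" and disj: "T \<inter> I = {}" and Un: "T \<union> I = {..<n}"
    using T(1) by (auto simp: I_def intro: finite_subset)
  have "measure (PiM (T \<union> I) (\<lambda>_. P)) {z \<in> space (data_law P n). deviates l P nrm K t (candidate f p M z d)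
      (estimated_risk cen l I B b z (candidate f p M z d))} \<le> \<beta>"
  proof (rule measure_PiM_split_le[OF P(1) fin disj _ \<beta>])
    fix x assume x: "x \<in> space (PiM T (\<lambda>_. P))"
    interpret I: prob_space "PiM I (\<lambda>_. P)" by (rule prob_space_PiM) (rule P)
    define g where "g = candidate f p M x d"
    define C where "C = K * (1 + enn2real (risk l P g))"
    have C: "0 < C" using K by (simp add: C_def add_pos_nonneg)
    have cand: "candidate f p M (merge T I (x, y)) d = g" for y
    proof -
      have "dataset (merge T I (x, y)) A = dataset x A" if "A \<subseteq> T" for A
        using that fin(1) by (intro dataset_cong) (auto simp: merge_def intro: finite_subset)
      then show ?thesis using T(2) by (auto simp: candidate_def g_def fun_eq_iff)
    qed
    have est: "estimated_risk cen l I B b (merge T I (x, y)) h = estimated_risk cen l I B b y h" for y h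
      using batch disj by (intro estimated_risk_cong) (auto simp: merge_def I_def)
    have g: "g \<in> borel_measurable (feature_space p)"
      using measurable_Pair2[OF measurable_candidate_pair[OF f P(2) fin(1) T(2)] x] by (simp add: g_def)
    show "\<P>(y in PiM I (\<lambda>_. P). merge T I (x, y)
        \<in> {z \<in> space (data_law P n). deviates l P nrm K t (candidate f p M z d)
          (estimated_risk cen l I B b z (candidate f p M z d))}) \<le> \<beta>"
    proof (cases "loss_norm nrm l P g < ennreal C")
      case True
      have space: "merge T I (x, y) \<in> space (data_law P n)" if "y \<in> space (PiM I (\<lambda>_. P))" for y
        using measurable_space[OF measurable_merge[of T I "\<lambda>_. P"], of "(x, y)"] x that
        by (simp add: data_law_def Un space_pair_measure)
      have "{y \<in> space (PiM I (\<lambda>_. P)). merge T I (x, y)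
          \<in> {z \<in> space (data_law P n). deviates l P nrm K t (candidate f p M z d)
            (estimated_risk cen l I B b z (candidate f p M z d))}}
        = {y \<in> space (PiM I (\<lambda>_. P)). t * C < \<bar>estimated_risk cen l I B b y g - enn2real (risk l P g)\<bar>}"
        using True space by (auto simp: cand est deviates_def C_def[symmetric] Let_def)
      then show ?thesis
        using conc[OF measurable_loss_obs[OF l P(2) g] C True] by (simp only: I_def)
    next
      case False
      then show ?thesis using \<beta> by (simp add: cand deviates_def C_def[symmetric] Let_def)
    qed
  qed
  then show ?thesis unfolding Un by (simp only: I_def data_law_def)
qed

section \<open>The grid of candidates and the union bound\<close>

lemma Xi_bounds:
  assumes "\<xi> \<in> Xi nu n k"
  shows "0 < block nu n" "2 \<le> fst \<xi>" "1 \<le> snd \<xi>" "snd \<xi> < fst \<xi>" "fst \<xi> * block nu n + block nu n \<le> k"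
proof -
  define b where "b = block nu n"
  obtain i j where \<xi>: "\<xi> = (i, j)" and i: "2 \<le> i" "i \<le> nat \<lceil>real k / real b - 2\<rceil>"
    and j: "1 \<le> j" "j \<le> i - 1"
    using assms by (auto simp: Xi_def b_def)
  have b: "0 < b"
  proof (rule ccontr)
    assume "\<not> 0 < b"
    then have "nat \<lceil>real k / real b - 2\<rceil> = 0" by simp
    then show False using i by simp
  qed
  have "real i < real k / real b - 1" using i by linarith
  then have "real i * real b + real b < real k" using b by (simp add: field_simps)
  then have "i * b + b \<le> k" by (metis less_imp_le of_nat_add of_nat_le_iff of_nat_mult)
  then show "0 < block nu n" "2 \<le> fst \<xi>" "1 \<le> snd \<xi>" "snd \<xi> < fst \<xi>" "fst \<xi> * block nu n + block nu n \<le> k"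
    using b i j \<xi> by (auto simp: b_def)
qed

lemma block_le_sizes:
  assumes "\<xi> \<in> Xi nu n k"
  shows "block nu n \<le> size1 nu n k \<xi>" "block nu n \<le> size2 nu n \<xi>"
  using Xi_bounds[OF assms] by (auto simp: size1_def size2_def)

lemma Xi_subset: "Xi nu n k \<subseteq> {..k} \<times> {..k}"
proof
  fix \<xi> assume "\<xi> \<in> Xi nu n k"
  note x = Xi_bounds[OF this]
  have "fst \<xi> * 1 \<le> fst \<xi> * block nu n" using x(1) by (intro mult_left_mono) auto
  then have "fst \<xi> \<le> k" using x(5) by linarith
  then show "\<xi> \<in> {..k} \<times> {..k}" using x(4) by (cases \<xi>) auto
qed

lemma finite_Xi: "finite (Xi nu n k)"
  by (rule finite_subset[OF Xi_subset]) simp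

lemma card_Xi_le:
  assumes "k \<le> n"
  shows "real (card (Xi nu n k)) \<le> (real n + 1)\<^sup>2"
proof -
  have "card (Xi nu n k) \<le> card ({..k} \<times> {..k})" by (intro card_mono Xi_subset) auto
  also have "\<dots> = (k + 1) * (k + 1)" by (simp add: card_cartesian_product)
  also have "\<dots> \<le> (n + 1) * (n + 1)" using assms by (intro mult_mono) auto
  finally have "real (card (Xi nu n k)) \<le> real ((n + 1) * (n + 1))" by (rule of_nat_mono)
  then show ?thesis by (simp add: power2_eq_square algebra_simps)
qed

lemma block_at_top:
  assumes "0 < nu"
  shows "filterlim (block nu) at_top sequentially"
proof -
  have "filterlim (\<lambda>n. real n powr nu) at_top sequentially" using assms by real_asymp
  then have "filterlim (\<lambda>n. \<lfloor>real n powr nu\<rfloor>) at_top sequentially"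
    by (rule filterlim_compose[OF filterlim_floor_sequentially])
  from filterlim_compose[OF filterlim_nat_sequentially this]
  show ?thesis by (simp add: block_def[abs_def])
qed

lemma block_over_n_tendsto_0:
  assumes "0 < nu" "nu < 1"
  shows "(\<lambda>n. real (block nu n) / real n) \<longlonglongrightarrow> 0"
proof (rule tendsto_sandwich[OF _ _ tendsto_const])
  show "(\<lambda>n. real n powr nu / real n) \<longlonglongrightarrow> 0" using assms by real_asymp
  show "\<forall>\<^sub>F n in sequentially. real (block nu n) / real n \<le> real n powr nu / real n"
    by (intro always_eventually allI divide_right_mono) (auto simp: block_def of_nat_nat)
qed auto

lemma max_scaled: "0 \<le> (u::real) \<Longrightarrow> max x y * u = max (x * u) (y * u)"
  by (metis max_mult_distrib_right not_less)

lemma min_scaled: "0 \<le> (u::real) \<Longrightarrow> min x y * u = min (x * u) (y * u)"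
  by (metis min_mult_distrib_right not_less)

text \<open>
Rounding \<open>x n / u n\<close> to a natural number costs at most \<open>2 * u n\<close> after multiplication by \<open>u n\<close>.
\<close>

lemma rounded_multiple_tendsto:
  fixes u x :: "nat \<Rightarrow> real"
  assumes x: "x \<longlonglongrightarrow> a" and u: "u \<longlonglongrightarrow> 0"
    and r: "\<forall>\<^sub>F n in sequentially. 0 < u n \<and> \<bar>real (r n) - x n / u n\<bar> \<le> 2"
  shows "(\<lambda>n. real (r n) * u n) \<longlonglongrightarrow> a"
proof -
  have "(\<lambda>n. real (r n) * u n - x n) \<longlonglongrightarrow> 0"
  proof (rule Lim_null_comparison)
    show "\<forall>\<^sub>F n in sequentially. norm (real (r n) * u n - x n) \<le> 2 * u n"
      using r
    proof eventually_elim
      case (elim n)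
      then have "real (r n) * u n - x n = (real (r n) - x n / u n) * u n" by (simp add: field_simps)
      then show ?case using elim by (simp add: abs_mult mult_right_mono)
    qed
    show "(\<lambda>n. 2 * u n) \<longlonglongrightarrow> 0" using tendsto_mult[OF tendsto_const u, of 2] by simp
  qed
  from tendsto_add[OF this x] show ?thesis by simp
qed

text \<open>
Multiples of the block length approximate the proportions \<open>1 - a1\<close> and \<open>a2\<close> of \<open>n\<close> up to one block, a
vanishing fraction of \<open>n\<close>, as is the test set. The truncations that keep \<open>\<xi>\<close> inside the grid do not
change the limits, since \<open>0 \<le> a2 \<le> 1 - a1 \<le> 1\<close>.
\<close>

lemma grid_approximation:
  fixes nte :: "nat \<Rightarrow> nat"
  assumes nu: "0 < nu" "nu < 1" and nte: "(\<lambda>n. real (nte n) / real n) \<longlonglongrightarrow> 0"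
    "\<And>n. 2 \<le> n \<Longrightarrow> nte n < n"
    and a: "0 \<le> a1" "0 \<le> a2" "a1 + a2 \<le> 1"
  obtains \<xi> where "\<forall>\<^sub>F n in sequentially. \<xi> n \<in> Xi nu n (n - nte n)"
    "(\<lambda>n. real (size1 nu n (n - nte n) (\<xi> n)) / real n) \<longlonglongrightarrow> a1"
    "(\<lambda>n. real (size2 nu n (\<xi> n)) / real n) \<longlonglongrightarrow> a2"
proof -
  define u where "u n = real (block nu n) / real n" for n
  define \<tau> where "\<tau> n = real (n - nte n)" for n
  define K where "K n = nat \<lceil>real (n - nte n) / real (block nu n) - 2\<rceil>" for n
  define i where "i n = max 2 (min (K n) (nat \<lceil>(1 - a1) * real n / real (block nu n)\<rceil>))" for n
  define j where "j n = max 1 (min (i n - 1) (nat \<lfloor>a2 * real n / real (block nu n)\<rfloor>))" for n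
  have u: "u \<longlonglongrightarrow> 0" using block_over_n_tendsto_0[OF nu] by (simp add: u_def[abs_def])
  have u0: "0 \<le> u n" for n by (simp add: u_def)
  have pos: "\<forall>\<^sub>F n in sequentially. 2 \<le> n \<and> 0 < block nu n"
    using eventually_ge_at_top[of 2] block_at_top[OF nu(1), unfolded filterlim_at_top, rule_format, of 1]
    by (eventually_elim) auto
  have \<tau>n: "(\<lambda>n. \<tau> n / real n) \<longlonglongrightarrow> 1"
  proof (rule Lim_transform_eventually)
    show "(\<lambda>n. 1 - real (nte n) / real n) \<longlonglongrightarrow> 1" using tendsto_diff[OF tendsto_const nte(1), of 1] by simp
    show "\<forall>\<^sub>F n in sequentially. 1 - real (nte n) / real n = \<tau> n / real n"
      using pos by eventually_elim (use nte(2) in \<open>auto simp: \<tau>_def of_nat_diff less_imp_le field_simps\<close>)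
  qed
  have K: "(\<lambda>n. real (K n) * u n) \<longlonglongrightarrow> 1"
  proof (rule rounded_multiple_tendsto[OF \<tau>n u])
    show "\<forall>\<^sub>F n in sequentially. 0 < u n \<and> \<bar>real (K n) - \<tau> n / real n / u n\<bar> \<le> 2"
      using pos
    proof eventually_elim
      case (elim n)
      have "0 \<le> real (n - nte n) / real (block nu n)" by simp
      then have "\<bar>real (K n) - real (n - nte n) / real (block nu n)\<bar> \<le> 2" unfolding K_def by linarith
      then show ?case using elim by (simp add: u_def \<tau>_def)
    qed
  qed
  have ceil: "(\<lambda>n. real (nat \<lceil>(1 - a1) * real n / real (block nu n)\<rceil>) * u n) \<longlonglongrightarrow> 1 - a1"
  proof (rule rounded_multiple_tendsto[OF tendsto_const u])
    show "\<forall>\<^sub>F n in sequentially. 0 < u n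
        \<and> \<bar>real (nat \<lceil>(1 - a1) * real n / real (block nu n)\<rceil>) - (1 - a1) / u n\<bar> \<le> 2"
      using pos
    proof eventually_elim
      case (elim n)
      have "0 \<le> (1 - a1) * real n / real (block nu n)" using a by simp
      then show ?case using elim by (simp add: u_def) linarith
    qed
  qed
  have floor: "(\<lambda>n. real (nat \<lfloor>a2 * real n / real (block nu n)\<rfloor>) * u n) \<longlonglongrightarrow> a2"
  proof (rule rounded_multiple_tendsto[OF tendsto_const u])
    show "\<forall>\<^sub>F n in sequentially. 0 < u n
        \<and> \<bar>real (nat \<lfloor>a2 * real n / real (block nu n)\<rfloor>) - a2 / u n\<bar> \<le> 2"
      using pos
    proof eventually_elim
      case (elim n)
      have "0 \<le> a2 * real n / real (block nu n)" using a by simp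
      then show ?case using elim by (simp add: u_def) linarith
    qed
  qed
  have i_lim: "(\<lambda>n. real (i n) * u n) \<longlonglongrightarrow> 1 - a1"
  proof -
    have "(\<lambda>n. max (2 * u n) (min (real (K n) * u n)
        (real (nat \<lceil>(1 - a1) * real n / real (block nu n)\<rceil>) * u n))) \<longlonglongrightarrow> max (2 * 0) (min 1 (1 - a1))"
      by (intro tendsto_max tendsto_min tendsto_mult tendsto_const u K ceil)
    moreover have "max (2 * 0) (min 1 (1 - a1)) = 1 - a1" using a by auto
    ultimately show ?thesis
      by (simp add: i_def of_nat_max of_nat_min max_scaled[OF u0] min_scaled[OF u0])
  qed
  have i1_lim: "(\<lambda>n. real (i n - 1) * u n) \<longlonglongrightarrow> 1 - a1"
  proof -
    have "real (i n - 1) = real (i n) - 1" for n by (simp add: i_def of_nat_diff)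
    then show ?thesis
      using tendsto_diff[OF i_lim u] by (simp add: left_diff_distrib)
  qed
  have j_lim: "(\<lambda>n. real (j n) * u n) \<longlonglongrightarrow> a2"
  proof -
    have "(\<lambda>n. max (1 * u n) (min (real (i n - 1) * u n)
        (real (nat \<lfloor>a2 * real n / real (block nu n)\<rfloor>) * u n))) \<longlonglongrightarrow> max (1 * 0) (min (1 - a1) a2)"
      by (intro tendsto_max tendsto_min tendsto_mult tendsto_const u i1_lim floor)
    moreover have "max (1 * 0) (min (1 - a1) a2) = a2" using a by auto
    ultimately show ?thesis
      by (simp only: j_def of_nat_max of_nat_min max_scaled[OF u0] min_scaled[OF u0] of_nat_1)
  qed
  have K2: "\<forall>\<^sub>F n in sequentially. 2 \<le> K n"
  proof -
    have "\<forall>\<^sub>F n in sequentially. 1 / 2 < real (K n) * u n" "\<forall>\<^sub>F n in sequentially. u n < 1 / 4"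
      by (rule order_tendstoD(1)[OF K], simp, rule order_tendstoD(2)[OF u], simp)
    then show ?thesis
    proof eventually_elim
      case (elim n)
      show ?case
      proof (rule ccontr)
        assume "\<not> 2 \<le> K n"
        then have "real (K n) * u n \<le> 1 * u n" using u0 by (intro mult_right_mono) auto
        then show False using elim by simp
      qed
    qed
  qed
  have mem: "\<forall>\<^sub>F n in sequentially. (i n, j n) \<in> Xi nu n (n - nte n)"
    using K2
  proof eventually_elim
    case (elim n)
    then have i: "2 \<le> i n" "i n \<le> K n" unfolding i_def by linarith+
    then have j: "1 \<le> j n" "j n \<le> i n - 1" unfolding j_def by linarith+
    show ?case using i j by (simp add: Xi_def K_def)
  qed
  have s1: "(\<lambda>n. real (size1 nu n (n - nte n) (i n, j n)) / real n) \<longlonglongrightarrow> a1"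
  proof (rule Lim_transform_eventually)
    show "(\<lambda>n. \<tau> n / real n - real (i n) * u n) \<longlonglongrightarrow> a1"
      using tendsto_diff[OF \<tau>n i_lim] by simp
    show "\<forall>\<^sub>F n in sequentially. \<tau> n / real n - real (i n) * u n
        = real (size1 nu n (n - nte n) (i n, j n)) / real n"
      using mem pos
    proof eventually_elim
      case (elim n)
      have "i n * block nu n \<le> n - nte n" using Xi_bounds(5)[OF elim(1)] by simp
      then have "real (n - nte n - i n * block nu n) = real (n - nte n) - real (i n * block nu n)"
        by (rule of_nat_diff)
      then show ?case unfolding size1_def \<tau>_def u_def fst_conv by (simp only: of_nat_mult diff_divide_distrib times_divide_eq_right)
    qed
  qed
  have s2: "(\<lambda>n. real (size2 nu n (i n, j n)) / real n) \<longlonglongrightarrow> a2"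
    using j_lim by (simp add: size2_def u_def)
  show thesis by (rule that[OF mem s1 s2])
qed

text \<open>
The claim is about reciprocals: \<open>k n / p n\<close> tends to \<open>inverse \<phi>\<close>, and inversion is continuous on
\<open>[0, \<infinity>]\<close>. This treats \<open>\<phi> = \<infinity>\<close> together with finite limits.
\<close>

lemma aspect_ratio_tendsto:
  assumes \<gamma>: "0 < \<gamma>" and p: "(\<lambda>n. real (p n) / real n) \<longlonglongrightarrow> \<gamma>"
    and \<phi>: "ennreal \<gamma> \<le> \<phi>"
    and k: "(\<lambda>n. real (k n) / real n) \<longlonglongrightarrow> \<gamma> * enn2real (inverse \<phi>)"
    and pos: "\<forall>\<^sub>F n in sequentially. 0 < k n"
  shows "(\<lambda>n. ennreal (real (p n) / real (k n))) \<longlonglongrightarrow> \<phi>"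
proof -
  have fin: "inverse \<phi> \<noteq> \<infinity>"
    using \<gamma> \<phi> by (auto simp: infinity_ennreal_def)
  have "(\<lambda>n. (real (k n) / real n) / (real (p n) / real n)) \<longlonglongrightarrow> \<gamma> * enn2real (inverse \<phi>) / \<gamma>"
    using \<gamma> by (intro tendsto_divide k p) auto
  then have "(\<lambda>n. ennreal ((real (k n) / real n) / (real (p n) / real n))) \<longlonglongrightarrow> ennreal (enn2real (inverse \<phi>))"
    using \<gamma> by (intro tendsto_ennrealI) simp
  then have lim: "(\<lambda>n. ennreal ((real (k n) / real n) / (real (p n) / real n))) \<longlonglongrightarrow> inverse \<phi>"
    using fin by (simp add: ennreal_enn2real_if infinity_ennreal_def)
  have inv_inv: "inverse (inverse \<phi>) = \<phi>"
  proof (cases \<phi> rule: ennreal_cases)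
    case (real r)
    then have "0 < r" using \<gamma> \<phi> by (simp add: ennreal_le_iff2)
    then show ?thesis using real by (simp add: inverse_ennreal)
  qed simp
  have inv: "isCont inverse (x::ennreal)" for x
    using continuous_on_inverse_ennreal[OF continuous_on_id, of UNIV] by (simp add: continuous_on_eq_continuous_at)
  have "(\<lambda>n. inverse (ennreal ((real (k n) / real n) / (real (p n) / real n)))) \<longlonglongrightarrow> \<phi>"
    using isCont_tendsto_compose[OF inv lim] unfolding inv_inv .
  then show ?thesis
  proof (rule Lim_transform_eventually)
    show "\<forall>\<^sub>F n in sequentially. inverse (ennreal ((real (k n) / real n) / (real (p n) / real n)))
        = ennreal (real (p n) / real (k n))"
      using pos order_tendstoD(1)[OF p \<gamma>] eventually_gt_at_top[of 0]
    proof eventually_elim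
      case (elim n)
      then have "0 < real (p n)" by (simp add: zero_less_divide_iff)
      then show ?case using elim by (simp add: inverse_ennreal)
    qed
  qed
qed

text \<open>
As \<open>ln n\<close> is negligible against \<open>nte n\<close>, the exponential is eventually below \<open>n\<close> to the power \<open>-3\<close>,
while there are at most \<open>(n + 1)\<^sup>2\<close> events.
\<close>

lemma union_bound_psi1_tendsto_0:
  fixes nte N :: "nat \<Rightarrow> nat"
  assumes nte: "\<And>n. 2 \<le> n \<Longrightarrow> 0 < nte n" "(\<lambda>n. ln (real n) / real (nte n)) \<longlonglongrightarrow> 0"
    and N: "\<And>n. real (N n) \<le> (real n + 1)\<^sup>2" and c: "0 < c"
  shows "(\<lambda>n. real (N n) * (2 * exp (- real (nte n) * c))) \<longlonglongrightarrow> 0"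
proof (rule tendsto_sandwich[OF _ _ tendsto_const])
  have c3: "0 < c / 3" using c by simp
  show "(\<lambda>n. (real n + 1)\<^sup>2 * (2 * exp (- 3 * ln (real n)))) \<longlonglongrightarrow> 0" by real_asymp
  show "\<forall>\<^sub>F n in sequentially. real (N n) * (2 * exp (- real (nte n) * c))
      \<le> (real n + 1)\<^sup>2 * (2 * exp (- 3 * ln (real n)))"
    using order_tendstoD(2)[OF nte(2) c3] eventually_ge_at_top[of 2]
  proof eventually_elim
    case (elim n)
    have "3 * ln (real n) \<le> real (nte n) * c" using elim nte(1)[of n] by (simp add: field_simps)
    then show ?case using N[of n] by (intro mult_mono) auto
  qed
qed simp

lemma num_batches_bounds:
  assumes "2 \<le> n" "Xi nu n k \<noteq> {}" "0 < A"
  shows "8 * (A * ln (real n) + ln (real (card (Xi nu n k)))) \<le> real (num_batches A nu n k)"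
    "real (num_batches A nu n k) \<le> 8 * (A * ln (real n) + ln (real (card (Xi nu n k)))) + 1"
    "0 < num_batches A nu n k"
proof -
  have c: "1 \<le> real (card (Xi nu n k))"
    using assms(2) finite_Xi[of nu n k] by (simp add: Suc_le_eq card_gt_0_iff)
  define L where "L = A * ln (real n) + ln (real (card (Xi nu n k)))"
  have L: "ln (1 / (real n powr (- A) / real (card (Xi nu n k)))) = L"
    using assms(1) c by (simp add: L_def ln_div ln_mult ln_powr)
  have "0 < A * ln (real n)" using assms by simp
  then have L0: "0 < L" using c unfolding L_def by (intro add_pos_nonneg) auto
  have B: "num_batches A nu n k = nat \<lceil>8 * L\<rceil>" unfolding num_batches_def Let_def L ..
  show "8 * (A * ln (real n) + ln (real (card (Xi nu n k)))) \<le> real (num_batches A nu n k)"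
    "real (num_batches A nu n k) \<le> 8 * (A * ln (real n) + ln (real (card (Xi nu n k)))) + 1"
    "0 < num_batches A nu n k"
    unfolding B L_def[symmetric] using L0 by linarith+
qed

text \<open>
Once \<open>2 * sqrt (q n) \<le> exp (-1)\<close>, the failure probability of one event is at most \<open>exp (- B)\<close>, and the
number of batches \<open>B\<close> is so large that the number of candidates times \<open>exp (- B)\<close> is at most \<open>n\<close> to the
power \<open>- 8 * A\<close>.
\<close>

lemma union_bound_mom_tendsto_0:
  fixes nte :: "nat \<Rightarrow> nat"
  assumes A: "0 < A" and ne: "\<forall>\<^sub>F n in sequentially. Xi nu n (n - nte n) \<noteq> {}"
    and q: "q \<longlonglongrightarrow> 0" "\<And>n. 0 \<le> q n"
  shows "(\<lambda>n. real (card (Xi nu n (n - nte n))) * (2 * sqrt (q n)) ^ num_batches A nu n (n - nte n)) \<longlonglongrightarrow> 0"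
proof -
  define B where "B n = num_batches A nu n (n - nte n)" for n
  have "(\<lambda>n. 2 * sqrt (q n)) \<longlonglongrightarrow> 2 * sqrt 0" by (intro tendsto_intros q)
  then have small: "\<forall>\<^sub>F n in sequentially. 2 * sqrt (q n) < exp (-1)"
    by (rule order_tendstoD) simp
  have lim: "(\<lambda>n. exp (- 8 * A * ln (real n))) \<longlonglongrightarrow> 0" using A by real_asymp
  have le: "\<forall>\<^sub>F n in sequentially. real (card (Xi nu n (n - nte n))) * (2 * sqrt (q n)) ^ B n
      \<le> exp (- 8 * A * ln (real n))"
    using small ne eventually_ge_at_top[of 2]
  proof eventually_elim
    case (elim n)
    define c where "c = real (card (Xi nu n (n - nte n)))"
    have c: "1 \<le> c"
      using elim(2) finite_Xi[of nu n "n - nte n"] by (simp add: c_def Suc_le_eq card_gt_0_iff)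
    have "(2 * sqrt (q n)) ^ B n \<le> exp (-1) ^ B n"
      using elim(1) q(2)[of n] by (intro power_mono) auto
    also have "\<dots> = exp (- real (B n))" by (simp add: exp_of_nat_mult[symmetric])
    also have "\<dots> \<le> exp (- 8 * A * ln (real n) - ln c)"
    proof -
      have "8 * (A * ln (real n) + ln c) \<le> real (B n)"
        unfolding B_def c_def by (rule num_batches_bounds[OF elim(3,2) A])
      moreover have "0 \<le> ln c" using c by simp
      ultimately show ?thesis by simp
    qed
    also have "\<dots> = exp (- 8 * A * ln (real n)) / c" using c by (simp add: exp_diff)
    finally show ?case using c by (simp add: c_def[symmetric] field_simps)
  qed
  show ?thesis
    unfolding B_def[symmetric]
    by (rule tendsto_sandwich[OF _ le tendsto_const lim]) (use q(2) in simp)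
qed

text \<open>
The number of batches is logarithmic in \<open>n\<close>, so the batches become large.
\<close>

lemma num_batches_over_nte_tendsto_0:
  fixes nte :: "nat \<Rightarrow> nat"
  assumes A: "0 < A" and ne: "\<forall>\<^sub>F n in sequentially. Xi nu n (n - nte n) \<noteq> {}"
    and nte: "\<And>n. 2 \<le> n \<Longrightarrow> 0 < nte n" "(\<lambda>n. ln (real n) / real (nte n)) \<longlonglongrightarrow> 0"
  shows "(\<lambda>n. real (num_batches A nu n (n - nte n)) / real (nte n)) \<longlonglongrightarrow> 0"
proof (rule tendsto_sandwich[OF _ _ tendsto_const])
  show "(\<lambda>n. (8 * A + 34) * (ln (real n) / real (nte n))) \<longlonglongrightarrow> 0"
    using tendsto_mult[OF tendsto_const nte(2)] by simp
  have log: "\<forall>\<^sub>F n in sequentially. 16 * ln (real n + 1) + 1 \<le> 34 * ln (real n)" by real_asymp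
  show "\<forall>\<^sub>F n in sequentially. real (num_batches A nu n (n - nte n)) / real (nte n)
      \<le> (8 * A + 34) * (ln (real n) / real (nte n))"
    using log ne eventually_ge_at_top[of 2]
  proof eventually_elim
    case (elim n)
    define c where "c = real (card (Xi nu n (n - nte n)))"
    have c: "1 \<le> c"
      using elim(2) finite_Xi[of nu n "n - nte n"] by (simp add: c_def Suc_le_eq card_gt_0_iff)
    have "ln c \<le> ln ((real n + 1)\<^sup>2)" using c card_Xi_le[of "n - nte n" n nu] by (simp add: c_def)
    also have "\<dots> = 2 * ln (real n + 1)" by (simp add: ln_realpow)
    finally have "real (num_batches A nu n (n - nte n)) \<le> (8 * A + 34) * ln (real n)"
      using num_batches_bounds(2)[OF elim(3,2) A] elim(1) by (simp add: c_def algebra_simps)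
    then have "real (num_batches A nu n (n - nte n)) / real (nte n) \<le> (8 * A + 34) * ln (real n) / real (nte n)"
      by (rule divide_right_mono) simp
    then show ?case by simp
  qed
qed auto

lemma filterlim_at_top_of_ratio:
  fixes p :: "nat \<Rightarrow> nat"
  assumes p: "(\<lambda>n. real (p n) / real n) \<longlonglongrightarrow> \<gamma>" and \<gamma>: "0 < \<gamma>"
  shows "filterlim p at_top sequentially"
proof -
  have scaled: "filterlim (\<lambda>n. real (p n) / real n * real n) at_top sequentially"
    by (rule filterlim_tendsto_pos_mult_at_top[OF p \<gamma> filterlim_real_sequentially])
  have ev: "\<forall>\<^sub>F n in sequentially. real (p n) / real n * real n = real (p n)"
    using eventually_gt_at_top[of 0] by eventually_elim simp
  have lim: "filterlim (\<lambda>n. real (p n)) at_top sequentially"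
    by (rule iffD1[OF filterlim_cong[OF refl refl ev] scaled])
  show ?thesis
    unfolding filterlim_at_top
  proof
    fix Z
    show "\<forall>\<^sub>F n in sequentially. Z \<le> p n"
      using lim[unfolded filterlim_at_top, rule_format, of "real Z"] by simp
  qed
qed

section \<open>Existence of a minimiser and convexity of the loss\<close>

lemma closed_aspect_pairs:
  assumes "\<And>k. \<zeta> k \<in> aspect_pairs \<gamma>" "(\<lambda>k. fst (\<zeta> k)) \<longlonglongrightarrow> l1" "(\<lambda>k. snd (\<zeta> k)) \<longlonglongrightarrow> l2"
  shows "(l1, l2) \<in> aspect_pairs \<gamma>"
proof -
  have inv: "isCont inverse (x::ennreal)" for x
    using continuous_on_inverse_ennreal[OF continuous_on_id, of UNIV] by (simp add: continuous_on_eq_continuous_at)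
  have "(\<lambda>k. inverse (fst (\<zeta> k)) + inverse (snd (\<zeta> k))) \<longlonglongrightarrow> inverse l1 + inverse l2"
    by (intro tendsto_add isCont_tendsto_compose[OF inv] assms)
  moreover have "inverse (fst (\<zeta> k)) + inverse (snd (\<zeta> k)) \<le> inverse (ennreal \<gamma>)" for k
    using assms(1)[of k] by (auto simp: aspect_pairs_def)
  ultimately have "inverse l1 + inverse l2 \<le> inverse (ennreal \<gamma>)"
    by (intro LIMSEQ_le_const2) auto
  then show ?thesis by (simp add: aspect_pairs_def)
qed

lemma ennreal_inverse_antimono_iff:
  fixes x y :: ennreal
  shows "inverse x \<le> inverse y \<longleftrightarrow> y \<le> x"
proof (cases x rule: ennreal_cases; cases y rule: ennreal_cases)
  fix r s :: real assume rs: "0 \<le> r" "x = ennreal r" "0 \<le> s" "y = ennreal s"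
  show ?thesis
  proof (cases "r = 0 \<or> s = 0")
    case True
    then show ?thesis using rs by (auto simp: inverse_ennreal top_unique ennreal_le_iff2)
  next
    case False
    then show ?thesis using rs by (simp add: inverse_ennreal)
  qed
qed (auto simp: top_unique)

lemma aspect_pairs_ge:
  assumes "(\<zeta>1, \<zeta>2) \<in> aspect_pairs \<gamma>"
  shows "ennreal \<gamma> \<le> \<zeta>1" "ennreal \<gamma> \<le> \<zeta>2"
proof -
  have "inverse \<zeta>1 \<le> inverse \<zeta>1 + inverse \<zeta>2" "inverse \<zeta>2 \<le> inverse \<zeta>1 + inverse \<zeta>2"
    by simp_all
  moreover have "inverse \<zeta>1 + inverse \<zeta>2 \<le> inverse (ennreal \<gamma>)"
    using assms by (simp add: aspect_pairs_def)
  ultimately have "inverse \<zeta>1 \<le> inverse (ennreal \<gamma>)" "inverse \<zeta>2 \<le> inverse (ennreal \<gamma>)"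
    by (blast intro: order.trans)+
  then show "ennreal \<gamma> \<le> \<zeta>1" "ennreal \<gamma> \<le> \<zeta>2"
    by (simp_all add: ennreal_inverse_antimono_iff)
qed

text \<open>
A minimising sequence has a convergent subsequence, because \<open>[0, \<infinity>]\<close> is compact. Its limit satisfies
the constraint by continuity of inversion, and lower semicontinuity bounds the value at the limit.
\<close>

lemma lower_semicontinuous_attains_min:
  assumes lsc: "lower_semicontinuous_on ({ennreal \<gamma>..} \<times> {ennreal \<gamma>..}) Rdet"
  obtains \<zeta>1 \<zeta>2 where "(\<zeta>1, \<zeta>2) \<in> argmin_set \<gamma> Rdet"
    "Rdet (\<zeta>1, \<zeta>2) = (INF \<zeta>\<in>aspect_pairs \<gamma>. Rdet \<zeta>)"
proof -
  define m where "m = (INF \<zeta>\<in>aspect_pairs \<gamma>. Rdet \<zeta>)"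
  have "(\<infinity>, \<infinity>) \<in> aspect_pairs \<gamma>" by (simp add: aspect_pairs_def infinity_ennreal_def)
  then have "Rdet ` aspect_pairs \<gamma> \<noteq> {}" by auto
  from ennreal_Inf_countable_INF[OF this] obtain g where g: "decseq g"
    "range g \<subseteq> Rdet ` aspect_pairs \<gamma>" "m = (INF i. g i)" unfolding m_def by auto
  have "\<exists>\<zeta>. \<zeta> \<in> aspect_pairs \<gamma> \<and> Rdet \<zeta> = g k" for k
  proof -
    have "g k \<in> Rdet ` aspect_pairs \<gamma>" using g(2) by blast
    then obtain x where "g k = Rdet x" "x \<in> aspect_pairs \<gamma>" by (rule imageE)
    then show ?thesis by metis
  qed
  then obtain \<zeta> where \<zeta>: "\<And>k. \<zeta> k \<in> aspect_pairs \<gamma>" "\<And>k. Rdet (\<zeta> k) = g k" by metis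
  have "g \<longlonglongrightarrow> m" using LIMSEQ_INF[OF g(1)] g(3) by simp
  then have lim: "(\<lambda>k. Rdet (\<zeta> k)) \<longlonglongrightarrow> m" by (simp add: \<zeta>(2))
  obtain l1 r1 where r1: "strict_mono r1" "((\<lambda>k. fst (\<zeta> k)) \<circ> r1) \<longlonglongrightarrow> l1"
    using compact_complete_linorder[of "\<lambda>k. fst (\<zeta> k)"] by blast
  obtain l2 r2 where r2: "strict_mono r2" "(((\<lambda>k. snd (\<zeta> k)) \<circ> r1) \<circ> r2) \<longlonglongrightarrow> l2"
    using compact_complete_linorder[of "(\<lambda>k. snd (\<zeta> k)) \<circ> r1"] by blast
  define r where "r = r1 \<circ> r2"
  have r: "strict_mono r" unfolding r_def by (rule strict_mono_o[OF r1(1) r2(1)])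
  have l1: "(\<lambda>k. fst (\<zeta> (r k))) \<longlonglongrightarrow> l1"
    using LIMSEQ_subseq_LIMSEQ[OF r1(2) r2(1)] by (simp add: o_def r_def)
  have l2: "(\<lambda>k. snd (\<zeta> (r k))) \<longlonglongrightarrow> l2"
    using r2(2) by (simp add: o_def r_def)
  have l: "(\<lambda>k. \<zeta> (r k)) \<longlonglongrightarrow> (l1, l2)"
    using tendsto_Pair[OF l1 l2] by simp
  have mem: "(l1, l2) \<in> aspect_pairs \<gamma>" by (rule closed_aspect_pairs[OF \<zeta>(1) l1 l2])
  define S where "S = {ennreal \<gamma>..} \<times> {ennreal \<gamma>..}"
  have sub: "aspect_pairs \<gamma> \<subseteq> S" using aspect_pairs_ge by (auto simp: S_def)
  have "\<not> m < Rdet (l1, l2)"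
  proof
    assume "m < Rdet (l1, l2)"
    then obtain c where c: "m < c" "c < Rdet (l1, l2)" using dense by blast
    have "c < Liminf (at (l1, l2) within S) Rdet"
      using lsc mem sub c(2) unfolding lower_semicontinuous_on_def S_def[symmetric]
      by (auto intro: less_le_trans)
    then have "\<forall>\<^sub>F x in at (l1, l2) within S. c < Rdet x" by (rule less_LiminfD)
    then obtain T where T: "open T" "(l1, l2) \<in> T" "\<And>x. x \<in> T \<Longrightarrow> x \<in> S \<Longrightarrow> x \<noteq> (l1, l2) \<Longrightarrow> c < Rdet x"
      unfolding eventually_at_topological by blast
    have "\<forall>\<^sub>F k in sequentially. \<zeta> (r k) \<in> T" using l T(1,2) by (rule topological_tendstoD)
    then have "\<forall>\<^sub>F k in sequentially. c \<le> Rdet (\<zeta> (r k))"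
    proof eventually_elim
      case (elim k)
      then show ?case using T(3)[of "\<zeta> (r k)"] \<zeta>(1)[of "r k"] sub c(2)
        by (cases "\<zeta> (r k) = (l1, l2)") (auto intro: less_imp_le)
    qed
    moreover have "(\<lambda>k. Rdet (\<zeta> (r k))) \<longlonglongrightarrow> m"
      using LIMSEQ_subseq_LIMSEQ[OF lim r] by (simp add: o_def)
    ultimately have "c \<le> m" by (intro tendsto_lowerbound[of _ m sequentially c]) auto
    then show False using c(1) by simp
  qed
  moreover have lower: "m \<le> Rdet \<zeta>" if "\<zeta> \<in> aspect_pairs \<gamma>" for \<zeta>
    unfolding m_def using that by (rule INF_lower)
  ultimately have eq: "Rdet (l1, l2) = m" using mem by (metis le_less)
  then have "(l1, l2) \<in> argmin_set \<gamma> Rdet"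
    using lower mem by (auto simp: argmin_set_def is_arg_min_def not_less)
  with eq show thesis using that unfolding m_def by blast
qed

text \<open>
The asymptotic proportions of the sample that the two datasets take up fit into one sample.
\<close>

lemma aspect_pairs_fractions:
  assumes \<gamma>: "0 < \<gamma>" and \<zeta>: "(\<zeta>1, \<zeta>2) \<in> aspect_pairs \<gamma>"
  shows "\<gamma> * enn2real (inverse \<zeta>1) + \<gamma> * enn2real (inverse \<zeta>2) \<le> 1"
proof -
  have sum: "inverse \<zeta>1 + inverse \<zeta>2 \<le> ennreal (1 / \<gamma>)"
    using \<zeta> \<gamma> by (simp add: aspect_pairs_def inverse_ennreal inverse_eq_divide)
  have "inverse \<zeta>1 \<noteq> \<infinity>" "inverse \<zeta>2 \<noteq> \<infinity>"
    using aspect_pairs_ge[OF \<zeta>] \<gamma> by (auto simp: infinity_ennreal_def)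
  then obtain r1 r2 where r: "inverse \<zeta>1 = ennreal r1" "0 \<le> r1" "inverse \<zeta>2 = ennreal r2" "0 \<le> r2"
    by (cases "inverse \<zeta>1" rule: ennreal_cases; cases "inverse \<zeta>2" rule: ennreal_cases)
      (auto simp: infinity_ennreal_def)
  then have "r1 + r2 \<le> 1 / \<gamma>" using sum \<gamma> by (simp add: ennreal_plus[symmetric] del: ennreal_plus)
  then show ?thesis using \<gamma> r by (simp add: field_simps)
qed

text \<open>
Jensen's inequality for the empirical mean of the \<open>M\<close> predictions, integrated.
\<close>

lemma risk_average_le:
  assumes l: "case_prod l \<in> borel_measurable (borel :: (real \<times> real) measure)"
      "\<And>y t. 0 \<le> l y t" "\<And>y. convex_on UNIV (l y)"
    and P: "sets P = sets (obs_space p)" and M: "1 \<le> M"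
    and g: "\<And>j. j \<in> {1..M} \<Longrightarrow> g j \<in> borel_measurable (feature_space p)"
    and c: "\<And>j. j \<in> {1..M} \<Longrightarrow> risk l P (g j) \<le> c"
  shows "risk l P (\<lambda>x. (\<Sum>j = 1..M. g j x) / real M) \<le> c"
proof -
  have convex: "l y ((\<Sum>j = 1..M. g j x) / real M) \<le> (\<Sum>j = 1..M. l y (g j x) / real M)" for x y
    using convex_on_sum[of "{1..M}" UNIV "l y" "\<lambda>_. 1 / real M" "\<lambda>j. g j x"] l(3)[of y] M
    by (simp add: sum_divide_distrib)
  have "risk l P (\<lambda>x. (\<Sum>j = 1..M. g j x) / real M)
      \<le> (\<integral>\<^sup>+(x, y). (\<Sum>j = 1..M. ennreal (1 / real M) * ennreal (l y (g j x))) \<partial>P)"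
    unfolding risk_def
  proof (intro nn_integral_mono, clarify)
    fix x y
    have "ennreal (l y ((\<Sum>j = 1..M. g j x) / real M)) \<le> ennreal (\<Sum>j = 1..M. l y (g j x) / real M)"
      by (rule ennreal_leI[OF convex])
    also have "\<dots> = (\<Sum>j = 1..M. ennreal (1 / real M) * ennreal (l y (g j x)))"
      by (subst sum_ennreal[symmetric]) (auto simp: l(2) ennreal_mult[symmetric])
    finally show "ennreal (l y ((\<Sum>j = 1..M. g j x) / real M))
      \<le> (\<Sum>j = 1..M. ennreal (1 / real M) * ennreal (l y (g j x)))" .
  qed
  also have "\<dots> = (\<Sum>j = 1..M. ennreal (1 / real M) * risk l P (g j))"
  proof -
    have "(\<lambda>v. ennreal (l (snd v) (g j (fst v)))) \<in> borel_measurable P" if "j \<in> {1..M}" for j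
      using measurable_loss_obs[OF l(1) P g[OF that]] by (simp add: case_prod_unfold)
    then show ?thesis
      unfolding risk_def case_prod_unfold
      by (subst nn_integral_sum) (auto simp: nn_integral_cmult)
  qed
  also have "\<dots> \<le> (\<Sum>j = 1..M. ennreal (1 / real M) * c)"
    by (intro sum_mono mult_left_mono c) auto
  also have "\<dots> = c"
    using M by (simp add: mult.assoc[symmetric] ennreal_of_nat_eq_real_of_nat ennreal_mult[symmetric])
  finally show ?thesis .
qed

text \<open>
The only place where the minimality of the estimated risk enters. As \<open>R x0\<close> occurs with a positive
coefficient on the right of the resulting inequality, an upper bound \<open>c\<close> for it is enough.
\<close>

lemma selection_inequality:
  fixes R Rh :: "'x \<Rightarrow> real"
  assumes "\<bar>Rh x - R x\<bar> \<le> s * (1 + R x)" "\<bar>Rh x0 - R x0\<bar> \<le> s * (1 + R x0)" "Rh x \<le> Rh x0"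
    and "R x0 \<le> c" "0 \<le> s"
  shows "(1 - s) * R x \<le> (1 + s) * c + 2 * s"
proof -
  have "(1 - s) * R x \<le> (1 + s) * R x0 + 2 * s"
    using assms(1,2,3) by (simp add: abs_le_iff algebra_simps)
  also have "(1 + s) * R x0 \<le> (1 + s) * c" using assms(4,5) by (intro mult_left_mono) auto
  finally show ?thesis by simp
qed

lemma open_ennreal_0_contains_segment:
  assumes U: "open U" "(0::ennreal) \<in> U"
  shows "\<exists>\<epsilon>>0. \<forall>x<ennreal \<epsilon>. x \<in> U"
proof -
  obtain b where b: "0 < b" "{0..<b} \<subseteq> U" using open_right[OF U, of 1] by auto
  obtain q :: rat where q: "0 < ennreal (real_of_rat q)" "ennreal (real_of_rat q) < b"
    using ennreal_rat_dense[OF b(1)] by blast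
  then have "\<forall>x<ennreal (real_of_rat q). x \<in> U" using b(2) by auto
  then show ?thesis using q(1) by (intro exI[of _ "real_of_rat q"]) auto
qed

section \<open>Optimality of the selected one-step predictor\<close>

theorem theorem4p4:
  fixes \<gamma> nu A :: real
    and p nte :: "nat \<Rightarrow> nat"
    and M :: nat
    and P :: "nat \<Rightarrow> observation measure"
    and l :: "real \<Rightarrow> real \<Rightarrow> real"
    and f :: procedure
    and Rdet :: "ennreal \<times> ennreal \<Rightarrow> ennreal"
    and cen :: centering
    and nrm :: norm_choice
    and Q :: "nat \<Rightarrow> 'u::countable pmf"
    and split :: "nat \<Rightarrow> 'u \<Rightarrow> nat set"
    and draw :: "nat \<Rightarrow> 'u \<Rightarrow> nat \<times> nat \<Rightarrow> nat \<Rightarrow> nat set \<times> nat set"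
    and batch :: "nat \<Rightarrow> 'u \<Rightarrow> nat \<Rightarrow> nat set"
    and xihat :: "nat \<Rightarrow> (nat \<Rightarrow> observation) \<times> 'u \<Rightarrow> nat \<times> nat"
  defines "ntr \<equiv> \<lambda>n. n - nte n"
    and "\<Xi> \<equiv> \<lambda>n. Xi nu n (n - nte n)"
    and "\<Omega> \<equiv> \<lambda>n. data_law (P n) n \<Otimes>\<^sub>M measure_pmf (Q n)"
    and "fhat \<equiv> \<lambda>n (z, u) \<xi>. candidate f (p n) M z (draw n u \<xi>)"
    and "Rhat \<equiv> \<lambda>n (z, u) \<xi>. estimated_risk cen l ({..<n} - split n u)
           (num_batches A nu n (n - nte n)) (batch n u) z (candidate f (p n) M z (draw n u \<xi>))"
  assumes \<gamma>: "0 < \<gamma>" and p: "(\<lambda>n. real (p n) / real n) \<longlonglongrightarrow> \<gamma>"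
    and nu: "0 < nu" "nu < 1" and A: "0 < A" and M: "1 \<le> M"
    and nte: "\<And>n. 2 \<le> n \<Longrightarrow> 0 < nte n \<and> nte n < n"
      "(\<lambda>n. real (nte n) / real n) \<longlonglongrightarrow> 0" "(\<lambda>n. ln (real n) / real (nte n)) \<longlonglongrightarrow> 0"
    and P: "\<And>n. prob_space (P n)" "\<And>n. sets (P n) = sets (obs_space (p n))"
    and loss: "\<And>y t. 0 \<le> l y t" "\<And>y. convex_on UNIV (l y)"
      "case_prod l \<in> borel_measurable borel"
    and f: "measurable_procedure f"
    and sampling: "\<And>n. random_sampling nu n (ntr n) M (Q n) (split n) (draw n)"
    and batches: "\<And>n u. cen = MOM \<Longrightarrow> \<Xi> n \<noteq> {} \<Longrightarrow>
      batch_partition ({..<n} - split n u) (num_batches A nu n (ntr n)) (batch n u)"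
    and xihat: "\<And>n. xihat n \<in> measurable (\<Omega> n) (count_space UNIV)"
      "\<And>n w. \<Xi> n \<noteq> {} \<Longrightarrow> w \<in> space (\<Omega> n) \<Longrightarrow>
        is_arg_min (Rhat n w) (\<lambda>\<xi>. \<xi> \<in> \<Xi> n) (xihat n w)"
    and nrm: "cen = AVG \<Longrightarrow> nrm = PSI1"
    and proper: "\<exists>\<zeta>\<in>{ennreal \<gamma>..} \<times> {ennreal \<gamma>..}. Rdet \<zeta> \<noteq> \<infinity>"
    and lsc: "lower_semicontinuous_on ({ennreal \<gamma>..} \<times> {ennreal \<gamma>..}) Rdet"
    and a: "\<exists>c>0. \<forall>n k1 k2. 0 < k1 \<longrightarrow> 0 < k2 \<longrightarrow>
      (AE (z1, z2) in data_law (P n) k1 \<Otimes>\<^sub>M data_law (P n) k2.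
         ennreal c \<le> risk l (P n) (one_step f (p n) (dataset z1 {..<k1}) (dataset z2 {..<k2})))"
    and b: "\<And>(r :: nat \<Rightarrow> nat) k1 k2 \<phi>1 \<phi>2.
      filterlim k1 at_top sequentially \<Longrightarrow> filterlim k2 at_top sequentially \<Longrightarrow>
      filterlim (\<lambda>m. p (r m)) at_top sequentially \<Longrightarrow>
      (\<lambda>m. ennreal (real (p (r m)) / real (k1 m))) \<longlonglongrightarrow> \<phi>1 \<Longrightarrow>
      (\<lambda>m. ennreal (real (p (r m)) / real (k2 m))) \<longlonglongrightarrow> \<phi>2 \<Longrightarrow>
      (\<phi>1, \<phi>2) \<in> argmin_set \<gamma> Rdet \<Longrightarrow>
      tends_in_prob (\<lambda>m. data_law (P (r m)) (k1 m) \<Otimes>\<^sub>M data_law (P (r m)) (k2 m))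
        (\<lambda>m (z1, z2). risk l (P (r m))
           (one_step f (p (r m)) (dataset z1 {..<k1 m}) (dataset z2 {..<k2 m})))
        (Rdet (\<phi>1, \<phi>2))"
    and c: "\<And>\<zeta>. \<zeta> \<in> argmin_set \<gamma> Rdet \<Longrightarrow>
      continuous (at \<zeta> within {ennreal \<gamma>..} \<times> {ennreal \<gamma>..}) Rdet"
    and d: "(big_op_one \<Omega> (\<lambda>n w. SUP \<xi>\<in>\<Xi> n. loss_norm nrm l (P n) (fhat n w \<xi>)) \<and>
        ((\<lambda>n. (INF \<xi>\<in>\<Xi> n. Rdet (ennreal (real (p n) / real (size1 nu n (ntr n) \<xi>)),
                                 ennreal (real (p n) / real (size2 nu n \<xi>))))
              * ennreal (sqrt (real (nte n) / ln (real n)))) \<longlonglongrightarrow> \<infinity>)) \<or>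
      big_op_one \<Omega> (\<lambda>n w. SUP \<xi>\<in>\<Xi> n.
        norm_risk_ratio (loss_norm nrm l (P n) (fhat n w \<xi>)) (risk l (P n) (fhat n w \<xi>)))"
  shows "small_op_one \<Omega> (\<lambda>n w. risk l (P n) (fhat n w (xihat n w))
           - (INF \<zeta>\<in>aspect_pairs \<gamma>. Rdet \<zeta>))"
proof -
  note l_meas = loss(3) and l0 = loss(1)
  have split: "split n u \<subseteq> {..<n}" "card ({..<n} - split n u) = nte n" if "2 \<le> n" for n u
  proof -
    have s: "split n u \<subseteq> {..<n}" "card (split n u) = n - nte n"
      using sampling[of n] by (auto simp: random_sampling_def subsets_of_size_def ntr_def)
    show "split n u \<subseteq> {..<n}" by (fact s)
    show "card ({..<n} - split n u) = nte n"
      using s nte(1)[OF that] by (subst card_Diff_subset) (auto intro: finite_subset)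
  qed
  have split_sub: "split n u \<subseteq> {..<n}" for n u
    using sampling[of n] by (auto simp: random_sampling_def subsets_of_size_def)
  have draw: "fst (draw n u \<xi> j) \<subseteq> split n u" "snd (draw n u \<xi> j) \<subseteq> split n u"
    "card (fst (draw n u \<xi> j)) = size1 nu n (n - nte n) \<xi>" "card (snd (draw n u \<xi> j)) = size2 nu n \<xi>"
    "fst (draw n u \<xi> j) \<inter> snd (draw n u \<xi> j) = {}"
    if "\<xi> \<in> \<Xi> n" "j \<in> {1..M}" for n u \<xi> j
  proof -
    have "draw n u \<xi> j \<in> disjoint_pairs (split n u) (size1 nu n (n - nte n) \<xi>) (size2 nu n \<xi>)"
      using sampling[of n] that unfolding random_sampling_def ntr_def \<Xi>_def by blast
    then show "fst (draw n u \<xi> j) \<subseteq> split n u" "snd (draw n u \<xi> j) \<subseteq> split n u"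
      "card (fst (draw n u \<xi> j)) = size1 nu n (n - nte n) \<xi>" "card (snd (draw n u \<xi> j)) = size2 nu n \<xi>"
      "fst (draw n u \<xi> j) \<inter> snd (draw n u \<xi> j) = {}"
      by (auto simp: disjoint_pairs_def subsets_of_size_def)
  qed
  have draw_sub: "fst (draw n u \<xi> j) \<subseteq> {..<n} \<and> snd (draw n u \<xi> j) \<subseteq> {..<n}"
    if "\<xi> \<in> \<Xi> n" "j \<in> {1..M}" for n u \<xi> j
    using draw(1,2)[OF that, of u] split_sub[of n u] by blast
  have fhat_eq: "fhat n w \<xi> = candidate f (p n) M (fst w) (draw n (snd w) \<xi>)" for n w \<xi>
    by (simp add: fhat_def case_prod_unfold)
  have Rhat_eq: "Rhat n w \<xi> = estimated_risk cen l ({..<n} - split n (snd w))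
      (num_batches A nu n (n - nte n)) (batch n (snd w)) (fst w) (candidate f (p n) M (fst w) (draw n (snd w) \<xi>))" for n w \<xi>
    by (simp add: Rhat_def case_prod_unfold)
  have prob_data: "prob_space (data_law (P n) n)" for n by (rule prob_space_data_law[OF P(1)])
  have prob: "prob_space (\<Omega> n)" for n
  proof -
    interpret N: prob_space "data_law (P n) n" by (rule prob_data)
    interpret pair_prob_space "data_law (P n) n" "measure_pmf (Q n)" by standard
    show ?thesis unfolding \<Omega>_def by (rule prob_space_axioms)
  qed
  have space: "w \<in> space (\<Omega> n) \<longleftrightarrow> fst w \<in> space (data_law (P n) n)" for w n
    by (cases w) (simp add: \<Omega>_def space_pair_measure)
  have pair: "(\<lambda>(z, x). candidate f (p n) M z (draw n u \<xi>) x)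
      \<in> borel_measurable (data_law (P n) n \<Otimes>\<^sub>M feature_space (p n))" if "\<xi> \<in> \<Xi> n" for n u \<xi>
    unfolding data_law_def
    by (rule measurable_candidate_pair[OF f P(2)]) (use draw_sub[OF that] in auto)
  have V: "(\<lambda>(x, y). l y (fhat n w \<xi> x)) \<in> borel_measurable (P n)" if "\<xi> \<in> \<Xi> n" "w \<in> space (\<Omega> n)" for n w \<xi>
    unfolding fhat_eq
    by (rule measurable_loss_obs[OF l_meas P(2)])
      (use measurable_Pair2[OF pair[OF that(1)]] that(2) space in auto)
  have R_meas: "(\<lambda>w. risk l (P n) (fhat n w \<xi>)) \<in> borel_measurable (\<Omega> n)" if "\<xi> \<in> \<Xi> n" for n \<xi>
    unfolding \<Omega>_def fhat_eq
    by (rule measurable_seeded) (use measurable_risk[OF l_meas P pair[OF that]] in simp)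
  have N_meas: "(\<lambda>w. loss_norm nrm l (P n) (fhat n w \<xi>)) \<in> borel_measurable (\<Omega> n)" if "\<xi> \<in> \<Xi> n" for n \<xi>
    unfolding \<Omega>_def fhat_eq
    by (rule measurable_seeded) (use measurable_loss_norm[OF l_meas P pair[OF that]] in simp)
  have Rhat_meas: "(\<lambda>w. Rhat n w \<xi>) \<in> borel_measurable (\<Omega> n)" if "\<xi> \<in> \<Xi> n" for n \<xi>
  proof -
    have "cen = MOM \<Longrightarrow> batch_partition ({..<n} - split n u) (num_batches A nu n (n - nte n)) (batch n u)" for u
      using batches[of n u] that by (auto simp: ntr_def)
    then show ?thesis
      unfolding \<Omega>_def Rhat_eq data_law_def fst_conv snd_conv
      by (intro measurable_seeded, unfold fst_conv snd_conv,
          intro measurable_estimated_risk[OF l_meas f P(2)] draw_sub[OF that]) auto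
  qed

  \<comment> \<open>With probability close to one, all norms lie below a multiple of \<open>1 + risk\<close>, whichever of the two
    growth conditions holds. The random variables \<open>Y\<close> stand for the quantity that is bounded in
    probability.\<close>

  define good where "good K n w \<xi> \<longleftrightarrow>
    loss_norm nrm l (P n) (fhat n w \<xi>) < ennreal (K * (1 + enn2real (risk l (P n) (fhat n w \<xi>))))
    \<and> risk l (P n) (fhat n w \<xi>) < \<infinity>" for K n w \<xi>
  define E1 where "E1 K n = {w \<in> space (\<Omega> n). \<exists>\<xi>\<in>\<Xi> n. \<not> good K n w \<xi>}" for K n
  have fin: "finite (\<Xi> n)" for n by (simp add: \<Xi>_def finite_Xi)
  have E1_sets: "E1 K n \<in> sets (\<Omega> n)" for K n
  proof -
    have "{w \<in> space (\<Omega> n). \<not> good K n w \<xi>} \<in> sets (\<Omega> n)" if "\<xi> \<in> \<Xi> n" for \<xi>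
    proof -
      note [measurable] = N_meas[OF that] R_meas[OF that]
      show ?thesis unfolding good_def by measurable
    qed
    then show ?thesis unfolding E1_def using fin by (intro sets.sets_Collect_finite_Ex) auto
  qed
  obtain Y where Y: "\<And>n \<xi>. \<xi> \<in> \<Xi> n \<Longrightarrow> Y n \<xi> \<in> borel_measurable (\<Omega> n)"
    "big_op_one \<Omega> (\<lambda>n w. SUP \<xi>\<in>\<Xi> n. Y n \<xi> w)"
    "\<And>n w \<xi> K. w \<in> space (\<Omega> n) \<Longrightarrow> \<xi> \<in> \<Xi> n \<Longrightarrow> 0 \<le> K \<Longrightarrow> Y n \<xi> w \<le> ennreal K \<Longrightarrow> good (K + 1) n w \<xi>"
  proof -
    consider "big_op_one \<Omega> (\<lambda>n w. SUP \<xi>\<in>\<Xi> n. loss_norm nrm l (P n) (fhat n w \<xi>))"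
      | "big_op_one \<Omega> (\<lambda>n w. SUP \<xi>\<in>\<Xi> n.
          norm_risk_ratio (loss_norm nrm l (P n) (fhat n w \<xi>)) (risk l (P n) (fhat n w \<xi>)))"
      using d by blast
    then show thesis
    proof cases
      case 1
      show thesis
      proof (rule that[OF N_meas 1])
        fix n w \<xi> K
        assume "w \<in> space (\<Omega> n)" "\<xi> \<in> \<Xi> n" "0 \<le> K" "loss_norm nrm l (P n) (fhat n w \<xi>) \<le> ennreal K"
        then show "good (K + 1) n w \<xi>"
          unfolding good_def by (intro conjI norm_bound_additive[OF P(1) V l0])
      qed
    next
      case 2
      have "(\<lambda>w. norm_risk_ratio (loss_norm nrm l (P n) (fhat n w \<xi>)) (risk l (P n) (fhat n w \<xi>)))
          \<in> borel_measurable (\<Omega> n)" if "\<xi> \<in> \<Xi> n" for n \<xi>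
      proof -
        note [measurable] = N_meas[OF that] R_meas[OF that]
        show ?thesis unfolding norm_risk_ratio_def by measurable
      qed
      then show thesis
      proof (rule that[OF _ 2])
        fix n w \<xi> K
        assume "w \<in> space (\<Omega> n)" "\<xi> \<in> \<Xi> n" "0 \<le> K"
          "norm_risk_ratio (loss_norm nrm l (P n) (fhat n w \<xi>)) (risk l (P n) (fhat n w \<xi>)) \<le> ennreal K"
        then show "good (K + 1) n w \<xi>"
          unfolding good_def by (intro conjI norm_bound_multiplicative[OF P(1) V l0])
      qed
    qed
  qed
  have norm_bound: "\<exists>K>0. \<forall>\<^sub>F n in sequentially. measure (\<Omega> n) (E1 K n) < \<delta>" if \<delta>: "0 < \<delta>" for \<delta>
  proof -
    obtain K where K: "\<forall>\<^sub>F n in sequentially.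
        measure (\<Omega> n) {w \<in> space (\<Omega> n). (SUP \<xi>\<in>\<Xi> n. Y n \<xi> w) > ennreal K} < \<delta>"
      using Y(2) \<delta> unfolding big_op_one_def by blast
    define K0 where "K0 = max K 0"
    have K0: "ennreal K \<le> ennreal K0" "0 \<le> K0" unfolding K0_def by (auto intro: ennreal_leI)
    have "measure (\<Omega> n) (E1 (K0 + 1) n)
        \<le> measure (\<Omega> n) {w \<in> space (\<Omega> n). (SUP \<xi>\<in>\<Xi> n. Y n \<xi> w) > ennreal K}" for n
    proof -
      interpret prob_space "\<Omega> n" by (rule prob)
      have "(\<lambda>w. SUP \<xi>\<in>\<Xi> n. Y n \<xi> w) \<in> borel_measurable (\<Omega> n)"
        using Y(1) fin by (intro borel_measurable_SUP countable_finite) auto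
      then have "{w \<in> space (\<Omega> n). (SUP \<xi>\<in>\<Xi> n. Y n \<xi> w) > ennreal K} \<in> events"
        by measurable
      then show ?thesis
      proof (rule finite_measure_mono[rotated], intro subsetI)
        fix w assume "w \<in> E1 (K0 + 1) n"
        then obtain \<xi> where w: "w \<in> space (\<Omega> n)" "\<xi> \<in> \<Xi> n" "\<not> good (K0 + 1) n w \<xi>"
          by (auto simp: E1_def)
        then have "ennreal K0 < Y n \<xi> w" using Y(3)[OF w(1,2) K0(2)] by (meson not_le)
        also have "Y n \<xi> w \<le> (SUP \<xi>\<in>\<Xi> n. Y n \<xi> w)" by (rule SUP_upper[OF w(2)])
        finally show "w \<in> {w \<in> space (\<Omega> n). (SUP \<xi>\<in>\<Xi> n. Y n \<xi> w) > ennreal K}"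
          using w(1) K0(1) by (auto intro: le_less_trans)
      qed
    qed
    then have "\<forall>\<^sub>F n in sequentially. measure (\<Omega> n) (E1 (K0 + 1) n) < \<delta>"
      using K by (auto elim!: eventually_mono intro: le_less_trans)
    then show ?thesis using K0(2) by (intro exI[of _ "K0 + 1"]) auto
  qed

  obtain \<zeta>1 \<zeta>2 where arg: "(\<zeta>1, \<zeta>2) \<in> argmin_set \<gamma> Rdet"
    and Rdet_min: "Rdet (\<zeta>1, \<zeta>2) = (INF \<zeta>\<in>aspect_pairs \<gamma>. Rdet \<zeta>)"
    using lower_semicontinuous_attains_min[OF lsc] .
  then have \<zeta>: "(\<zeta>1, \<zeta>2) \<in> aspect_pairs \<gamma>" by (simp add: argmin_set_def is_arg_min_def)
  note \<zeta>_ge = aspect_pairs_ge[OF \<zeta>]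
  define m where "m = (INF \<zeta>\<in>aspect_pairs \<gamma>. Rdet \<zeta>)"
  \<comment> \<open>\<open>a1\<close> and \<open>a2\<close> are the proportions of the sample that correspond to the aspect ratios \<open>\<zeta>1\<close> and \<open>\<zeta>2\<close>.\<close>
  define a1 a2 where "a1 = \<gamma> * enn2real (inverse \<zeta>1)" and "a2 = \<gamma> * enn2real (inverse \<zeta>2)"
  have a_le: "a1 + a2 \<le> 1" unfolding a1_def a2_def by (rule aspect_pairs_fractions[OF \<gamma> \<zeta>])
  have a_nonneg: "0 \<le> a1" "0 \<le> a2" using \<gamma> by (auto simp: a1_def a2_def)
  have nte_less: "2 \<le> n \<Longrightarrow> nte n < n" and nte_pos: "2 \<le> n \<Longrightarrow> 0 < nte n" for n using nte(1) by auto
  obtain \<xi>0 where \<xi>0: "\<forall>\<^sub>F n in sequentially. \<xi>0 n \<in> Xi nu n (n - nte n)"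
    "(\<lambda>n. real (size1 nu n (n - nte n) (\<xi>0 n)) / real n) \<longlonglongrightarrow> a1"
    "(\<lambda>n. real (size2 nu n (\<xi>0 n)) / real n) \<longlonglongrightarrow> a2"
    using grid_approximation[OF nu nte(2) nte_less a_nonneg a_le] by blast
  define k1 k2 where "k1 n = size1 nu n (n - nte n) (\<xi>0 n)" and "k2 n = size2 nu n (\<xi>0 n)" for n
  have k_top: "filterlim k1 at_top sequentially" "filterlim k2 at_top sequentially"
  proof -
    have "\<forall>\<^sub>F n in sequentially. block nu n \<le> k1 n" "\<forall>\<^sub>F n in sequentially. block nu n \<le> k2 n"
      using \<xi>0(1) by (auto elim!: eventually_mono simp: k1_def k2_def block_le_sizes)
    then show "filterlim k1 at_top sequentially" "filterlim k2 at_top sequentially"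
      using filterlim_at_top_mono[OF block_at_top[OF nu(1)]] by auto
  qed
  have k_pos: "\<forall>\<^sub>F n in sequentially. 0 < k1 n" "\<forall>\<^sub>F n in sequentially. 0 < k2 n"
    using k_top[unfolded filterlim_at_top] by (auto simp: Suc_le_eq dest: spec[of _ "Suc 0"])
  have p_top: "filterlim p at_top sequentially" by (rule filterlim_at_top_of_ratio[OF p \<gamma>])
  have \<zeta>_lim: "(\<lambda>n. ennreal (real (p n) / real (k1 n))) \<longlonglongrightarrow> \<zeta>1" "(\<lambda>n. ennreal (real (p n) / real (k2 n))) \<longlonglongrightarrow> \<zeta>2"
    using \<xi>0(2,3) k_pos unfolding k1_def[symmetric] k2_def[symmetric] a1_def a2_def
    by (auto intro!: aspect_ratio_tendsto[OF \<gamma> p] \<zeta>_ge)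
  have det: "tends_in_prob (\<lambda>n. data_law (P n) (k1 n) \<Otimes>\<^sub>M data_law (P n) (k2 n))
      (\<lambda>n (z1, z2). risk l (P n) (one_step f (p n) (dataset z1 {..<k1 n}) (dataset z2 {..<k2 n}))) m"
    using b[of k1 k2 "\<lambda>n. n", OF k_top p_top \<zeta>_lim arg] by (simp add: m_def Rdet_min)

  define ingredient where "ingredient n w \<xi> j = one_step f (p n) (dataset (fst w) (fst (draw n (snd w) \<xi> j)))
    (dataset (fst w) (snd (draw n (snd w) \<xi> j)))" for n w \<xi> j
  \<comment> \<open>Outside \<open>E3 c n\<close> all ingredients of the candidate \<open>\<xi>0 n\<close> have risk below \<open>c\<close>.\<close>
  define E3 where "E3 c n = {w \<in> space (\<Omega> n). \<exists>j\<in>{1..M}. \<not> risk l (P n)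
    (ingredient n w (\<xi>0 n) j) < c}" for c n
  have os_pair: "(\<lambda>(z, x). one_step f (p n) (dataset z B1) (dataset z B2) x)
      \<in> borel_measurable (data_law (P n) n \<Otimes>\<^sub>M feature_space (p n))"
    if "B1 \<subseteq> {..<n}" "B2 \<subseteq> {..<n}" for n B1 B2
  proof -
    have "(\<lambda>(z, x). candidate f (p n) 1 z (\<lambda>_. (B1, B2)) x)
        \<in> borel_measurable (PiM {..<n} (\<lambda>_. P n) \<Otimes>\<^sub>M feature_space (p n))"
      using that by (intro measurable_candidate_pair[OF f P(2)]) auto
    then show ?thesis by (simp add: candidate_def data_law_def)
  qed
  have E3j_sets: "{w \<in> space (\<Omega> n). \<not> risk l (P n) (ingredient n w \<xi> j) < c} \<in> sets (\<Omega> n)"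
    if "\<xi> \<in> \<Xi> n" "j \<in> {1..M}" for n \<xi> j c
  proof -
    have "(\<lambda>w. risk l (P n) (ingredient n w \<xi> j)) \<in> borel_measurable (\<Omega> n)"
      unfolding \<Omega>_def ingredient_def
    proof (rule measurable_seeded)
      fix u
      have "fst (draw n u \<xi> j) \<subseteq> {..<n}" "snd (draw n u \<xi> j) \<subseteq> {..<n}"
        using draw_sub[OF that] by blast+
      from measurable_risk[OF l_meas P os_pair[OF this]]
      show "(\<lambda>z. risk l (P n) (one_step f (p n) (dataset (fst (z, u)) (fst (draw n (snd (z, u)) \<xi> j)))
          (dataset (fst (z, u)) (snd (draw n (snd (z, u)) \<xi> j))))) \<in> borel_measurable (data_law (P n) n)"
        by simp
    qed
    then show ?thesis by measurable
  qed
  have E3: "(\<lambda>n. measure (\<Omega> n) (E3 c n)) \<longlonglongrightarrow> 0" and E3_sets: "\<forall>\<^sub>F n in sequentially. E3 c n \<in> sets (\<Omega> n)"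
    if c: "m < c" for c
  proof -
    define \<mu> where "\<mu> n = measure (data_law (P n) (k1 n) \<Otimes>\<^sub>M data_law (P n) (k2 n))
      {w \<in> space (data_law (P n) (k1 n) \<Otimes>\<^sub>M data_law (P n) (k2 n)).
        (case w of (z1, z2) \<Rightarrow> risk l (P n) (one_step f (p n) (dataset z1 {..<k1 n}) (dataset z2 {..<k2 n})))
        \<notin> {..<c}}" for n
    have \<mu>: "\<mu> \<longlonglongrightarrow> 0"
      using det c unfolding tends_in_prob_def \<mu>_def[abs_def] by (auto dest: spec[of _ "{..<c}"])
    show sets: "\<forall>\<^sub>F n in sequentially. E3 c n \<in> sets (\<Omega> n)"
      using \<xi>0(1)
    proof eventually_elim
      case (elim n)
      then show ?case
        unfolding E3_def using E3j_sets[of "\<xi>0 n" n] by (intro sets.sets_Collect_finite_Ex) (auto simp: \<Xi>_def)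
    qed
    have le: "\<forall>\<^sub>F n in sequentially. measure (\<Omega> n) (E3 c n) \<le> real M * \<mu> n"
      using \<xi>0(1) k_pos(1)
    proof eventually_elim
      case (elim n)
      interpret prob_space "\<Omega> n" by (rule prob)
      have \<xi>: "\<xi>0 n \<in> \<Xi> n" using elim by (simp add: \<Xi>_def)
      define F where "F j = {w \<in> space (\<Omega> n). \<not> risk l (P n)
        (ingredient n w (\<xi>0 n) j) < c}" for j
      have F_sets: "F j \<in> events" if "j \<in> {1..M}" for j
        unfolding F_def by (rule E3j_sets[OF \<xi> that])
      have F_le: "prob (F j) \<le> \<mu> n" if j: "j \<in> {1..M}" for j
        unfolding \<Omega>_def
      proof (rule measure_seeded_le[OF prob_data])
        fix u
        define B1 B2 where "B1 = fst (draw n u (\<xi>0 n) j)" and "B2 = snd (draw n u (\<xi>0 n) j)"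
        have B: "B1 \<subseteq> {..<n}" "B2 \<subseteq> {..<n}" "B1 \<inter> B2 = {}" "card B1 = k1 n" "card B2 = k2 n"
          using draw[OF \<xi> j, of u] split_sub[of n u] by (auto simp: B1_def B2_def k1_def k2_def)
        then have "B1 \<noteq> {}" using elim(2) by auto
        note eq = measure_risk_one_step_subsamples[OF l_meas P f B(1-3) this, where c = c]
        have "{z \<in> space (data_law (P n) n). (z, u) \<in> F j} = {z \<in> space (data_law (P n) n).
            \<not> risk l (P n) (one_step f (p n) (dataset z B1) (dataset z B2)) < c}"
          by (auto simp: F_def space B1_def B2_def ingredient_def)
        then show "measure (data_law (P n) n) {z \<in> space (data_law (P n) n). (z, u) \<in> F j} \<le> \<mu> n"
          using eq unfolding B(4,5) \<mu>_def by simp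
      qed
      have "E3 c n = (\<Union>j\<in>{1..M}. F j)" by (auto simp: E3_def F_def)
      then have "prob (E3 c n) \<le> (\<Sum>j\<in>{1..M}. prob (F j))"
        using F_sets by (auto intro!: finite_measure_subadditive_finite)
      also have "\<dots> \<le> (\<Sum>j\<in>{1..M}. \<mu> n)" by (intro sum_mono F_le)
      finally show ?case by simp
    qed
    have lim: "(\<lambda>n. real M * \<mu> n) \<longlonglongrightarrow> 0" using tendsto_mult[OF tendsto_const \<mu>, of "real M"] by simp
    show "(\<lambda>n. measure (\<Omega> n) (E3 c n)) \<longlonglongrightarrow> 0"
      by (rule tendsto_sandwich[OF _ le tendsto_const lim]) simp
  qed
  have comparison: "risk l (P n) (fhat n w (\<xi>0 n)) \<le> c"
    if "w \<in> space (\<Omega> n)" "w \<notin> E3 c n" "\<xi>0 n \<in> \<Xi> n" for w n c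
  proof -
    have "risk l (P n) (\<lambda>x. (\<Sum>j = 1..M. ingredient n w (\<xi>0 n) j x) / real M) \<le> c"
    proof (rule risk_average_le[OF l_meas l0 loss(2) P(2) M])
      fix j assume j: "j \<in> {1..M}"
      have sub: "fst (draw n (snd w) (\<xi>0 n) j) \<subseteq> {..<n}" "snd (draw n (snd w) (\<xi>0 n) j) \<subseteq> {..<n}"
        using draw_sub[OF that(3) j] by blast+
      show "ingredient n w (\<xi>0 n) j \<in> borel_measurable (feature_space (p n))"
        unfolding ingredient_def
        using measurable_Pair2[OF os_pair[OF sub]] that(1) space by auto
      show "risk l (P n) (ingredient n w (\<xi>0 n) j) \<le> c"
        using that(1,2) j by (auto simp: E3_def intro: less_imp_le)
    qed
    then show ?thesis by (simp add: fhat_eq candidate_def[abs_def] ingredient_def)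
  qed

  \<comment> \<open>Outside \<open>E2 K t n\<close> all candidates are estimated accurately. The absolute value in \<open>\<beta>\<close> only keeps it
    nonnegative for small \<open>n\<close>, where \<open>k n\<close> may be negative.\<close>
  define dev where "dev K t n w \<xi> \<longleftrightarrow> deviates l (P n) nrm K t (fhat n w \<xi>) (Rhat n w \<xi>)" for K t n w \<xi>
  define E2 where "E2 K t n = {w \<in> space (\<Omega> n). \<exists>\<xi>\<in>\<Xi> n. dev K t n w \<xi>}" for K t n
  have dev_sets: "{w \<in> space (\<Omega> n). dev K t n w \<xi>} \<in> sets (\<Omega> n)" if "\<xi> \<in> \<Xi> n" for K t n \<xi>
  proof -
    note [measurable] = N_meas[OF that] R_meas[OF that] Rhat_meas[OF that]
    show ?thesis unfolding dev_def deviates_def Let_def by measurable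
  qed
  have E2_sets: "E2 K t n \<in> sets (\<Omega> n)" for K t n
    unfolding E2_def using fin dev_sets by (intro sets.sets_Collect_finite_Ex) auto
  have \<Xi>_ne: "\<forall>\<^sub>F n in sequentially. Xi nu n (n - nte n) \<noteq> {}"
    using \<xi>0(1) by eventually_elim auto
  have E2: "(\<lambda>n. measure (\<Omega> n) (E2 K t n)) \<longlonglongrightarrow> 0" if K: "0 < K" and t: "0 < t" "t \<le> 1" for K t
  proof -
    define B where "B n = num_batches A nu n (n - nte n)" for n
    \<comment> \<open>a lower bound for the sizes of the batches\<close>
    define k where "k n = real (nte n) / real (B n) - 1" for n
    define \<beta> where "\<beta> n = (case cen of AVG \<Rightarrow> 2 * exp (- real (nte n) * (t\<^sup>2 / (64 * exp 1)))
        | MOM \<Rightarrow> (2 * sqrt \<bar>4 / (t\<^sup>2 * k n)\<bar>) ^ B n)" for n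
    have k: "filterlim k at_top sequentially"
    proof -
      have "\<forall>\<^sub>F n in sequentially. 0 < real (B n) / real (nte n)"
        using \<Xi>_ne eventually_ge_at_top[of 2]
      proof eventually_elim
        case (elim n)
        then show ?case using nte_pos num_batches_bounds(3)[OF _ _ A, of n nu "n - nte n"] by (simp add: B_def)
      qed
      then have "filterlim (\<lambda>n. inverse (real (B n) / real (nte n))) at_top sequentially"
        using num_batches_over_nte_tendsto_0[OF A \<Xi>_ne nte_pos nte(3)]
        by (intro filterlim_inverse_at_top) (auto simp: B_def)
      then have "filterlim (\<lambda>n. - 1 + inverse (real (B n) / real (nte n))) at_top sequentially"
        by (rule filterlim_tendsto_add_at_top[OF tendsto_const])
      then show ?thesis by (simp add: k_def[abs_def])
    qed
    have \<beta>0: "0 \<le> \<beta> n" for n by (cases cen) (auto simp: \<beta>_def)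
    have \<beta>: "(\<lambda>n. real (card (\<Xi> n)) * \<beta> n) \<longlonglongrightarrow> 0"
    proof (cases cen)
      case AVG
      have "real (card (\<Xi> n)) \<le> (real n + 1)\<^sup>2" for n unfolding \<Xi>_def by (rule card_Xi_le) simp
      from union_bound_psi1_tendsto_0[OF nte_pos nte(3) this, of "t\<^sup>2 / (64 * exp 1)"] t AVG
      show ?thesis by (simp add: \<beta>_def)
    next
      case MOM
      have "(\<lambda>n. 4 / t\<^sup>2 * inverse (k n)) \<longlonglongrightarrow> 4 / t\<^sup>2 * 0"
        by (intro tendsto_mult tendsto_const tendsto_inverse_0_at_top k)
      moreover have "4 / t\<^sup>2 * inverse (k n) = 4 / (t\<^sup>2 * k n)" for n
        by (simp add: divide_inverse mult.assoc)
      ultimately have "(\<lambda>n. 4 / (t\<^sup>2 * k n)) \<longlonglongrightarrow> 0" by (simp only: mult_zero_right)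
      then have "(\<lambda>n. \<bar>4 / (t\<^sup>2 * k n)\<bar>) \<longlonglongrightarrow> 0" by (rule tendsto_rabs_zero)
      from union_bound_mom_tendsto_0[OF A \<Xi>_ne this] MOM show ?thesis by (simp add: \<beta>_def \<Xi>_def B_def)
    qed
    have le: "\<forall>\<^sub>F n in sequentially. measure (\<Omega> n) (E2 K t n) \<le> real (card (\<Xi> n)) * \<beta> n"
      using eventually_ge_at_top[of 2] k[unfolded filterlim_at_top, rule_format, of "4 / t\<^sup>2"]
    proof eventually_elim
      case (elim n)
      interpret prob_space "\<Omega> n" by (rule prob)
      have tk: "4 \<le> t\<^sup>2 * k n" using elim(2) t(1) by (simp add: field_simps)
      have k0: "0 < k n" using elim(2) t(1) by (smt (verit) divide_pos_pos zero_less_power)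
      have single: "prob {w \<in> space (\<Omega> n). dev K t n w \<xi>} \<le> \<beta> n" if \<xi>: "\<xi> \<in> \<Xi> n" for \<xi>
        unfolding \<Omega>_def
      proof (rule measure_seeded_le[OF prob_data])
        fix u
        define I where "I = {..<n} - split n u"
        have I: "finite I" "card I = nte n" using split(2)[OF elim(1), of u] by (simp_all add: I_def)
        then have "I \<noteq> {}" using nte_pos[OF elim(1)] by auto
        note I = I this
        have bp: "batch_partition I (B n) (batch n u)" if "cen = MOM"
          using batches[OF that, of n u] \<xi> by (auto simp: I_def B_def ntr_def)
        have conc: "measure (PiM I (\<lambda>_. P n)) {y \<in> space (PiM I (\<lambda>_. P n)).
            t * C < \<bar>estimated_risk cen l I (B n) (batch n u) y g - enn2real (risk l (P n) g)\<bar>} \<le> \<beta> n"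
          if "(\<lambda>(x, y). l y (g x)) \<in> borel_measurable (P n)" "0 < C" "loss_norm nrm l (P n) g < ennreal C" for g C
        proof -
          have kI: "real (card I) / real (B n) - 1 = k n" by (simp add: I(2) k_def)
          have "0 \<le> 4 / (t\<^sup>2 * k n)" using k0 by simp
          then have "\<beta> n = (case cen of AVG \<Rightarrow> 2 * exp (- real (card I) * (t\<^sup>2 / (64 * exp 1)))
              | MOM \<Rightarrow> (2 * sqrt (4 / (t\<^sup>2 * (real (card I) / real (B n) - 1)))) ^ B n)"
            unfolding kI \<beta>_def by (simp only: abs_of_nonneg I(2))
          then show ?thesis
            by (simp only:)
              (rule measure_PiM_test_le[OF P(1) that(1) l0 that(2,3) I(1,3) t], use nrm bp tk in \<open>auto simp: kI\<close>)
        qed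
        have "{z \<in> space (data_law (P n) n). (z, u) \<in> {w \<in> space (data_law (P n) n \<Otimes>\<^sub>M measure_pmf (Q n)). dev K t n w \<xi>}}
          = {z \<in> space (data_law (P n) n). deviates l (P n) nrm K t (candidate f (p n) M z (draw n u \<xi>))
              (estimated_risk cen l I (B n) (batch n u) z (candidate f (p n) M z (draw n u \<xi>)))}"
          using space[of _ n] by (auto simp: \<Omega>_def dev_def fhat_eq Rhat_eq I_def B_def)
        also have "measure (data_law (P n) n) \<dots> \<le> \<beta> n"
          unfolding I_def
          by (rule measure_candidate_deviates_le[OF l_meas P f split_sub _ _ K \<beta>0])
            (use draw(1,2)[OF \<xi>] bp conc in \<open>auto simp: I_def\<close>)
        finally show "measure (data_law (P n) n) {z \<in> space (data_law (P n) n).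
          (z, u) \<in> {w \<in> space (data_law (P n) n \<Otimes>\<^sub>M measure_pmf (Q n)). dev K t n w \<xi>}} \<le> \<beta> n" .
      qed
      have "E2 K t n = (\<Union>\<xi>\<in>\<Xi> n. {w \<in> space (\<Omega> n). dev K t n w \<xi>})" by (auto simp: E2_def)
      then have "prob (E2 K t n) \<le> (\<Sum>\<xi>\<in>\<Xi> n. prob {w \<in> space (\<Omega> n). dev K t n w \<xi>})"
        using dev_sets fin by (auto intro!: finite_measure_subadditive_finite)
      also have "\<dots> \<le> (\<Sum>\<xi>\<in>\<Xi> n. \<beta> n)" by (intro sum_mono single)
      finally show ?case by simp
    qed
    show ?thesis by (rule tendsto_sandwich[OF _ le tendsto_const \<beta>]) simp
  qed

  have select: "xihat n w \<in> \<Xi> n" "\<xi> \<in> \<Xi> n \<Longrightarrow> Rhat n w (xihat n w) \<le> Rhat n w \<xi>"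
    if "w \<in> space (\<Omega> n)" "\<Xi> n \<noteq> {}" for n w \<xi>
    using xihat(2)[OF that(2,1)] unfolding is_arg_min_linorder by blast+

  show ?thesis
    unfolding tends_in_prob_def m_def[symmetric]
  proof (intro allI impI)
    fix U :: "ennreal set" assume U: "open U" "0 \<in> U"
    obtain \<epsilon> where \<epsilon>: "0 < \<epsilon>" "\<And>x. x < ennreal \<epsilon> \<Longrightarrow> x \<in> U"
      using open_ennreal_0_contains_segment[OF U] by blast
    define bad where "bad n = {w \<in> space (\<Omega> n). risk l (P n) (fhat n w (xihat n w)) - m \<notin> U}" for n
    have "\<forall>\<^sub>F n in sequentially. measure (\<Omega> n) (bad n) < \<delta>" if \<delta>: "0 < \<delta>" for \<delta>
    proof -
      have third: "0 < \<delta> / 3" using \<delta> by simp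
      from norm_bound[OF this] obtain K where K: "0 < K"
        "\<forall>\<^sub>F n in sequentially. measure (\<Omega> n) (E1 K n) < \<delta> / 3" by blast
      show ?thesis
      proof (cases "m = \<infinity>")
        case True
        show ?thesis
          using K(2) \<xi>0(1)
        proof eventually_elim
          case (elim n)
          interpret prob_space "\<Omega> n" by (rule prob)
          have ne: "\<Xi> n \<noteq> {}" using elim(2) by (auto simp: \<Xi>_def)
          have "bad n \<subseteq> E1 K n"
          proof
            fix w assume "w \<in> bad n"
            then have w: "w \<in> space (\<Omega> n)" "risk l (P n) (fhat n w (xihat n w)) - \<infinity> \<notin> U"
              using True by (auto simp: bad_def)
            have "risk l (P n) (fhat n w (xihat n w)) = \<infinity>"
              using w(2) U(2) by (auto simp: minus_top_ennreal infinity_ennreal_def split: if_splits)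
            then have "\<not> good K n w (xihat n w)" by (simp add: good_def)
            then show "w \<in> E1 K n" using w(1) select(1)[OF w(1) ne] by (auto simp: E1_def)
          qed
          then have "prob (bad n) \<le> prob (E1 K n)" using E1_sets by (rule finite_measure_mono)
          then show ?case using elim(1) \<delta> by simp
        qed
      next
        case False
        then obtain mr where mr: "m = ennreal mr" "0 \<le> mr"
          by (cases m rule: ennreal_cases) (auto simp: infinity_ennreal_def)
        \<comment> \<open>The choice of \<open>s\<close> makes \<open>(1 + s) * c + 2 * s\<close> smaller than \<open>(1 - s) * (mr + \<epsilon>)\<close>.\<close>
        define s where "s = \<epsilon> / (2 * (2 * mr + 2 * \<epsilon> + 3))"
        define t where "t = min 1 (s / K)"
        have s: "0 < s" "s < 1" "s * (2 * mr + 2 * \<epsilon> + 3) = \<epsilon> / 2"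
          using \<epsilon>(1) mr(2) by (auto simp: s_def field_simps add_pos_nonneg)
        have t: "0 < t" "t \<le> 1" "t * K \<le> s"
          using s(1) K(1) by (auto simp: t_def min_def field_simps)
        define c where "c = mr + \<epsilon> / 2"
        have c: "m < ennreal c" using \<epsilon>(1) mr by (simp add: c_def ennreal_less_iff)
        have "\<forall>\<^sub>F n in sequentially. measure (\<Omega> n) (E2 K t n) < \<delta> / 3"
          by (rule order_tendstoD(2)[OF E2[OF K(1) t(1,2)] third])
        moreover have "\<forall>\<^sub>F n in sequentially. measure (\<Omega> n) (E3 (ennreal c) n) < \<delta> / 3"
          by (rule order_tendstoD(2)[OF E3[OF c] third])
        ultimately show ?thesis
          using K(2) \<xi>0(1) E3_sets[OF c]
        proof eventually_elim
          case (elim n)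
          interpret prob_space "\<Omega> n" by (rule prob)
          have \<xi>: "\<xi>0 n \<in> \<Xi> n" using elim(4) by (simp add: \<Xi>_def)
          then have ne: "\<Xi> n \<noteq> {}" by auto
          have "bad n \<subseteq> E1 K n \<union> (E2 K t n \<union> E3 (ennreal c) n)"
          proof (rule ccontr)
            assume "\<not> bad n \<subseteq> E1 K n \<union> (E2 K t n \<union> E3 (ennreal c) n)"
            then obtain w where w: "w \<in> space (\<Omega> n)" "w \<notin> E1 K n" "w \<notin> E2 K t n" "w \<notin> E3 (ennreal c) n"
              and out: "risk l (P n) (fhat n w (xihat n w)) - m \<notin> U" by (auto simp: bad_def)
            define R where "R \<xi> = enn2real (risk l (P n) (fhat n w \<xi>))" for \<xi>
            note sel = select[OF w(1) ne]
            have good: "good K n w \<xi>" if "\<xi> \<in> \<Xi> n" for \<xi> using w(1,2) that by (auto simp: E1_def)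
            have close: "\<bar>Rhat n w \<xi> - R \<xi>\<bar> \<le> s * (1 + R \<xi>)" if "\<xi> \<in> \<Xi> n" for \<xi>
            proof -
              have "\<not> dev K t n w \<xi>" using w(1,3) that by (auto simp: E2_def)
              then have "\<bar>Rhat n w \<xi> - R \<xi>\<bar> \<le> t * (K * (1 + R \<xi>))"
                using good[OF that] by (simp add: dev_def deviates_def good_def Let_def R_def)
              also have "\<dots> = t * K * (1 + R \<xi>)" by simp
              also have "\<dots> \<le> s * (1 + R \<xi>)" by (intro mult_right_mono t(3)) (simp add: R_def)
              finally show ?thesis .
            qed
            have "R (\<xi>0 n) \<le> c"
              using comparison[OF w(1,4) \<xi>] \<epsilon>(1) mr(2) by (auto simp: R_def c_def intro!: enn2real_leI)
            from selection_inequality[of "Rhat n w" "xihat n w" R s "\<xi>0 n" c, OF close[OF sel(1)] close[OF \<xi>] sel(2)[OF \<xi>] this] s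
            have "(1 - s) * R (xihat n w) \<le> (1 + s) * c + 2 * s" by simp
            also have "\<dots> < (1 - s) * (mr + \<epsilon>)"
            proof -
              have "(1 - s) * (mr + \<epsilon>) - ((1 + s) * c + 2 * s) = \<epsilon> / 2 - s * (2 * mr + 3 / 2 * \<epsilon> + 2)"
                by (simp add: c_def algebra_simps)
              also have "\<dots> = s * (2 * mr + 2 * \<epsilon> + 3) - s * (2 * mr + 3 / 2 * \<epsilon> + 2)"
                by (simp only: s(3))
              also have "\<dots> = s * (\<epsilon> / 2 + 1)" by (simp add: algebra_simps)
              also have "\<dots> > 0" using s(1) \<epsilon>(1) by simp
              finally show ?thesis by simp
            qed
            finally have less: "R (xihat n w) < mr + \<epsilon>" using s(2) by simp
            have "risk l (P n) (fhat n w (xihat n w)) = ennreal (R (xihat n w))"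
              using good[OF sel(1)] by (simp add: good_def R_def infinity_ennreal_def)
            then have "risk l (P n) (fhat n w (xihat n w)) - m = ennreal (R (xihat n w) - mr)"
              using mr by (simp add: ennreal_minus)
            also have "\<dots> < ennreal \<epsilon>" using less \<epsilon>(1) by (simp add: ennreal_less_iff ennreal_lessI)
            finally show False using \<epsilon>(2) out by blast
          qed
          then have "prob (bad n) \<le> prob (E1 K n \<union> (E2 K t n \<union> E3 (ennreal c) n))"
            using E1_sets E2_sets elim(5) by (intro finite_measure_mono sets.Un)
          also have "\<dots> \<le> prob (E1 K n) + (prob (E2 K t n) + prob (E3 (ennreal c) n))"
            by (intro order.trans[OF measure_Un_le] add_mono order.refl measure_Un_le sets.Un E1_sets E2_sets elim(5))
          also have "\<dots> < \<delta>" using elim(1-3) by simp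
          finally show ?case .
        qed
      qed
    qed
    then have "(\<lambda>n. measure (\<Omega> n) (bad n)) \<longlonglongrightarrow> 0"
      by (intro order_tendstoI) (auto intro!: always_eventually intro: less_le_trans[OF _ measure_nonneg])
    then show "(\<lambda>n. measure (\<Omega> n) {w \<in> space (\<Omega> n). risk l (P n) (fhat n w (xihat n w)) - m \<notin> U}) \<longlonglongrightarrow> 0"
      by (simp only: bad_def)
  qed
qed

end
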